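(* Let $k \geq 2$ be a natural number, let $\gamma > 1$ be a real number, and let $\Gamma = \Gamma_{k,\gamma}$ be the rooted tree defined in the context. Let $\{V_\omega(x)\}_{x\in\mathscr{V}(\Gamma)}$ be a family of i.i.d. real random variables with common probability distribution $d\rho$ on $\mathbb{R}$ such that: (i) $d\rho(\xi) = \tilde\rho(\xi)\,d\xi$ with $\|\tilde\rho\|_\infty < \infty$; (ii) $\int |\xi|^\eta \tilde\rho(\xi)\, d\xi < \infty$ for some $\eta > 0$. Let $\Delta$ be either of the two Laplacians on $\ell^2(\mathscr{V}(\Gamma))$ given by $$(\Delta f)(x) = \sum_{y:\, d(x,y)=1} f(y) \qquad\text{or}\qquad (\Delta f)(x) = \sum_{y:\, d(x,y)=1} f(y) - \#\{y : d(x,y)=1\}\cdot f(x),$$ and for $\lambda>0$ let $H_{\omega,\lambda} = \Delta + \lambda V_\omega$, where $V_\omega$ acts by multiplication, $(V_\omega f)(x) = V_\omega(x) f(x)$. Then (for each of the two choices of $\Delta$) for any $\lambda > 0$ and almost every realization of $V_\omega$, the operator $H_{\omega,\lambda}$ has only pure point spectrum and the corresponding eigenfunctions decay exponentially.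
   Context: A rooted tree is a tree graph with a distinguished vertex $O$ (the root). $\mathscr{V}(\Gamma)$ denotes the set of vertices of $\Gamma$. For vertices $x,y$, $d(x,y)$ is the number of edges of the unique path of minimal length connecting them, and $|x| = d(x,O)$. A vertex $y$ is a forward neighbor of $x$ if $d(x,y)=1$ and $d(y,O)>d(x,O)$. For a real number $t$, $[t]$ denotes its integer part, and $\#A$ is the number of elements of a finite set $A$. Definition of $\Gamma_{k,\gamma}$ (for a natural number $k\ge 2$ and a real number $\gamma \ge 1$): it is the rooted tree in which the root $O$, and every vertex whose distance from $O$ equals $\sum_{j=1}^N [\gamma^j]$ for some $N \in \mathbb{N}$, $N\ge 1$, have exactly $k$ forward neighbors, while every other vertex has exactly one forward neighbor. Both Laplacians are bounded self-adjoint operators on $\ell^2(\mathscr{V}(\Gamma))$. $V_\omega$ is the (possibly unbounded) self-adjoint multiplication operator on its maximal domain $\{f\in\ell^2(\mathscr{V}(\Gamma)) : V_\omega f\in \ell^2(\mathscr{V}(\Gamma))\}$, and $H_{\omega,\lambda}$ is self-adjoint on this domain. "Only pure point spectrum" means that all spectral measures of $H_{\omega,\lambda}$ are pure point. A function $f$ on $\mathscr{V}(\Gamma)$ decays exponentially if there exist positive constants $A, C$ such that $|f(x)| \leq A e^{-C|x|}$ for all $x \in \mathscr{V}(\Gamma)$. *)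

theory Defs
  imports "HOL-Probability.Probability"
begin

section \<open>Rooted trees\<close>

text \<open>A simple graph is given by its adjacency relation; its vertices are all elements of the
  underlying type.  Hence $\ell^2$ of the vertex set consists of functions on that type.\<close>

definition is_tree :: "('v \<Rightarrow> 'v \<Rightarrow> bool) \<Rightarrow> bool" where
  "is_tree G \<longleftrightarrow>
     (\<forall>x y. G x y \<longrightarrow> G y x) \<and> (\<forall>x. \<not> G x x) \<and>
     (\<forall>x y. G\<^sup>*\<^sup>* x y) \<and>
     \<not> (\<exists>c. 3 \<le> length c \<and> distinct c \<and>
            (\<forall>i<length c. G (c ! i) (c ! (Suc i mod length c))))"

text \<open>Junk value if \<open>x\<close> and \<open>y\<close> are not connected.\<close>

definition gdist :: "('v \<Rightarrow> 'v \<Rightarrow> bool) \<Rightarrow> 'v \<Rightarrow> 'v \<Rightarrow> nat" where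
  "gdist G x y = (LEAST n. (G ^^ n) x y)"

definition neighbors :: "('v \<Rightarrow> 'v \<Rightarrow> bool) \<Rightarrow> 'v \<Rightarrow> 'v set" where
  "neighbors G x = {y. gdist G x y = 1}"

definition forward_neighbors :: "('v \<Rightarrow> 'v \<Rightarrow> bool) \<Rightarrow> 'v \<Rightarrow> 'v \<Rightarrow> 'v set" where
  "forward_neighbors G r x = {y. gdist G x y = 1 \<and> gdist G y r > gdist G x r}"

text \<open>\<open>G\<close> with root \<open>r\<close> is (a copy of) $\Gamma_{k,\gamma}$.  For \<open>k > 0\<close> the cardinality conditions
  force all sets of forward neighbors to be finite, since \<open>card\<close> of an infinite set is \<open>0\<close>.\<close>

definition is_Gamma :: "nat \<Rightarrow> real \<Rightarrow> ('v \<Rightarrow> 'v \<Rightarrow> bool) \<Rightarrow> 'v \<Rightarrow> bool" where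
  "is_Gamma k \<gamma> G r \<longleftrightarrow>
     is_tree G \<and>
     (\<forall>x. card (forward_neighbors G r x) =
        (if x = r \<or> (\<exists>N\<ge>1. int (gdist G x r) = (\<Sum>j=1..N. \<lfloor>\<gamma> ^ j\<rfloor>)) then k else 1))"

definition decays_exponentially :: "('v \<Rightarrow> 'v \<Rightarrow> bool) \<Rightarrow> 'v \<Rightarrow> ('v \<Rightarrow> complex) \<Rightarrow> bool" where
  "decays_exponentially G r f \<longleftrightarrow>
     (\<exists>A>0. \<exists>C>0. \<forall>x. cmod (f x) \<le> A * exp (- C * real (gdist G x r)))"


section \<open>The Hilbert space of square-summable functions\<close>

definition ell2 :: "('v \<Rightarrow> complex) set" where
  "ell2 = {f. (\<lambda>x. (cmod (f x))\<^sup>2) summable_on UNIV}"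

definition ell2_inner :: "('v \<Rightarrow> complex) \<Rightarrow> ('v \<Rightarrow> complex) \<Rightarrow> complex" where
  "ell2_inner f g = (\<Sum>\<^sub>\<infinity>x. cnj (f x) * g x)"

definition ell2_norm :: "('v \<Rightarrow> complex) \<Rightarrow> real" where
  "ell2_norm f = sqrt (\<Sum>\<^sub>\<infinity>x. (cmod (f x))\<^sup>2)"


section \<open>Spectral measures of an operator\<close>

definition orthogonal_projection :: "(('v \<Rightarrow> complex) \<Rightarrow> ('v \<Rightarrow> complex)) \<Rightarrow> bool" where
  "orthogonal_projection P \<longleftrightarrow>
     (\<forall>f\<in>ell2. P f \<in> ell2) \<and>
     (\<forall>f\<in>ell2. \<forall>g\<in>ell2. P (\<lambda>x. f x + g x) = (\<lambda>x. P f x + P g x)) \<and>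
     (\<forall>c. \<forall>f\<in>ell2. P (\<lambda>x. c * f x) = (\<lambda>x. c * P f x)) \<and>
     (\<forall>f\<in>ell2. P (P f) = P f) \<and>
     (\<forall>f\<in>ell2. \<forall>g\<in>ell2. ell2_inner f (P g) = ell2_inner (P f) g)"

text \<open>Countable additivity is with respect to strong convergence.  The values of \<open>E\<close> at
  non-Borel sets, and of \<open>E B\<close> outside \<open>ell2\<close>, are irrelevant.\<close>

definition projection_valued_measure ::
    "(real set \<Rightarrow> ('v \<Rightarrow> complex) \<Rightarrow> ('v \<Rightarrow> complex)) \<Rightarrow> bool" where
  "projection_valued_measure E \<longleftrightarrow>
     (\<forall>B\<in>sets borel. orthogonal_projection (E B)) \<and>
     (\<forall>f\<in>ell2. E {} f = (\<lambda>x. 0) \<and> E UNIV f = f) \<and>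
     (\<forall>A\<in>sets borel. \<forall>B\<in>sets borel. \<forall>f\<in>ell2. E (A \<inter> B) f = E A (E B f)) \<and>
     (\<forall>A :: nat \<Rightarrow> real set. range A \<subseteq> sets borel \<longrightarrow> disjoint_family A \<longrightarrow>
        (\<forall>f\<in>ell2. (\<lambda>n. ell2_norm (\<lambda>x. E (\<Union>i. A i) f x - (\<Sum>i<n. E (A i) f x)))
           \<longlonglongrightarrow> 0))"

text \<open>The finite Borel measure \<open>B \<mapsto> \<langle>f, E B f\<rangle>\<close>.\<close>

definition spectral_measure ::
    "(real set \<Rightarrow> ('v \<Rightarrow> complex) \<Rightarrow> ('v \<Rightarrow> complex)) \<Rightarrow> ('v \<Rightarrow> complex) \<Rightarrow> real measure" where
  "spectral_measure E f =
     measure_of UNIV (sets borel) (\<lambda>B. ennreal (Re (ell2_inner f (E B f))))"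

text \<open>The linear operator \<open>T\<close> with dense domain \<open>D\<close> is $\int \xi\, dE(\xi)$ in the sense of
  the spectral theorem for unbounded operators.  The quadratic form determines the operator by
  polarization.\<close>

definition spectral_resolution ::
    "('v \<Rightarrow> complex) set \<Rightarrow> (('v \<Rightarrow> complex) \<Rightarrow> ('v \<Rightarrow> complex)) \<Rightarrow>
     (real set \<Rightarrow> ('v \<Rightarrow> complex) \<Rightarrow> ('v \<Rightarrow> complex)) \<Rightarrow> bool" where
  "spectral_resolution D T E \<longleftrightarrow>
     projection_valued_measure E \<and>
     D = {f \<in> ell2. (\<integral>\<^sup>+ \<xi>. ennreal (\<xi>\<^sup>2) \<partial>spectral_measure E f) < \<infinity>} \<and>
     (\<forall>f\<in>D. T f \<in> ell2 \<and>
        ell2_inner f (T f) = complex_of_real (\<integral>\<xi>. \<xi> \<partial>spectral_measure E f))"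

definition pure_point_measure :: "real measure \<Rightarrow> bool" where
  "pure_point_measure \<mu> \<longleftrightarrow>
     (\<forall>B\<in>sets \<mu>. emeasure \<mu> B = (\<Sum>\<^sub>\<infinity>\<xi>\<in>B. emeasure \<mu> {\<xi>}))"

text \<open>For a self-adjoint operator the spectral resolution exists and is unique (on Borel sets
  and \<open>ell2\<close>).  The first conjunct rules out that the second one holds vacuously.\<close>

definition only_pure_point_spectrum ::
    "('v \<Rightarrow> complex) set \<Rightarrow> (('v \<Rightarrow> complex) \<Rightarrow> ('v \<Rightarrow> complex)) \<Rightarrow> bool" where
  "only_pure_point_spectrum D T \<longleftrightarrow>
     (\<exists>E. spectral_resolution D T E) \<and>
     (\<forall>E. spectral_resolution D T E \<longrightarrow>
        (\<forall>f\<in>ell2. pure_point_measure (spectral_measure E f)))"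

definition eigenfunction ::
    "('v \<Rightarrow> complex) set \<Rightarrow> (('v \<Rightarrow> complex) \<Rightarrow> ('v \<Rightarrow> complex)) \<Rightarrow> ('v \<Rightarrow> complex) \<Rightarrow> bool" where
  "eigenfunction D T f \<longleftrightarrow>
     f \<in> D \<and> f \<noteq> (\<lambda>x. 0) \<and> (\<exists>e::complex. T f = (\<lambda>x. e * f x))"


section \<open>The Anderson model\<close>

definition adjacency_laplacian ::
    "('v \<Rightarrow> 'v \<Rightarrow> bool) \<Rightarrow> ('v \<Rightarrow> complex) \<Rightarrow> ('v \<Rightarrow> complex)" where
  "adjacency_laplacian G f = (\<lambda>x. \<Sum>y\<in>neighbors G x. f y)"

definition graph_laplacian ::
    "('v \<Rightarrow> 'v \<Rightarrow> bool) \<Rightarrow> ('v \<Rightarrow> complex) \<Rightarrow> ('v \<Rightarrow> complex)" where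
  "graph_laplacian G f =
     (\<lambda>x. (\<Sum>y\<in>neighbors G x. f y) - of_nat (card (neighbors G x)) * f x)"

text \<open>The maximal domain of multiplication by \<open>v\<close>.\<close>

definition mult_domain :: "('v \<Rightarrow> real) \<Rightarrow> ('v \<Rightarrow> complex) set" where
  "mult_domain v = {f \<in> ell2. (\<lambda>x. complex_of_real (v x) * f x) \<in> ell2}"

text \<open>To be used with domain \<open>mult_domain v\<close>.\<close>

definition anderson ::
    "(('v \<Rightarrow> complex) \<Rightarrow> ('v \<Rightarrow> complex)) \<Rightarrow> real \<Rightarrow> ('v \<Rightarrow> real) \<Rightarrow>
     ('v \<Rightarrow> complex) \<Rightarrow> ('v \<Rightarrow> complex)" where
  "anderson \<Delta> l v f = (\<lambda>x. \<Delta> f x + complex_of_real l * (complex_of_real (v x) * f x))"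

end

theory Submission
  imports Defs "HOL-Computational_Algebra.Fundamental_Theorem_Algebra" "HOL-Complex_Analysis.Great_Picard"
begin

text \<open>The argument is that of Kunz and Souillard, adapted to trees.  In a finite ball, the quotients of
  the values of a solution at consecutive vertices of a path satisfy the recursion \<open>r' = a - t - 1 / r\<close>,
  where \<open>t\<close> is the potential at one vertex and \<open>a\<close> collects the energy and the contribution of the other
  branches.  Averaging over \<open>t\<close> therefore acts on functions of the quotient by convolution with a
  bounded density followed by inversion.  Inversion is unitary on \<open>L\<^sup>2\<close> and maps the complement of a
  bounded interval to a bounded interval, and the convolution strictly decreases the part of the norm
  carried by a bounded interval.  In a suitably weighted \<open>L\<^sup>2\<close> norm each vertex of the path thus
  contributes a factor less than one, independent of everything off the path.  Hence the
  mean eigenfunction correlators of a ball decay exponentially, uniformly in the ball.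

  Since \<open>\<gamma> > 1\<close>, the branching levels are so sparse that the tree grows subexponentially, and the
  correlator bounds can be summed over all vertices.  By compactness, for almost every potential each
  \<open>delta x\<close> is then a limit of finite sums of exponentially localized eigenvectors.  Almost surely no
  eigenfunction vanishes anywhere: given the potential off \<open>y\<close>, only countably many values at \<open>y\<close>
  allow an eigenfunction that vanishes at a neighbour of \<open>y\<close> but not at \<open>y\<close>.  So all eigenvalues are
  simple, the localized eigenvectors form an orthogonal basis, and every eigenfunction is a multiple
  of a localized one.\<close>

section \<open>Averaging over a bounded density\<close>

text \<open>The quantity to be averaged is a sum over eigenvalues, which move with the potential,
  whereas the recursion for the quotients works at a fixed energy \<open>E\<close>. The bridge is a
  window in the root quotient. Near an eigenvalue \<open>e\<close> of the ball, the inverse of the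
  diagonal Green function at the root is about \<open>(E - e) / a\<close>, where \<open>a\<close> is
  the weight of \<open>e\<close> in the spectral measure of the root; the product of inverse
  quotients down to \<open>y\<close> has modulus about \<open>|w y| / a\<close>, where
  \<open>w\<close> is the component of \<open>delta rt\<close> at \<open>e\<close>. Integrating this
  product over the energies with root quotient below \<delta> gives about
  \<open>2 * \<delta> * |w y|\<close> near each eigenvalue: the weight \<open>a\<close> cancels, and
  the potential can be averaged first, at each fixed \<open>E\<close>. Convolution alone gives no
  uniform contraction, since slowly varying functions lose almost no norm; such functions carry much
  of their mass far out, which is why the norm charges that mass extra. All bounds are uniform in
  the energy because translations preserve Lebesgue measure. The spectral resolution is built from
  the eigenvectors themselves; every other resolution is shown to concentrate the spectral measure
  of an eigenvector at its eigenvalue.\<close>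

lemma lborel_inverse:
  "distr (density lborel (\<lambda>v. ennreal (1 / v\<^sup>2))) borel inverse = (lborel :: real measure)"
proof (rule lborel_eqI[symmetric])
  fix l u :: real
  assume "\<And>b. b \<in> Basis \<Longrightarrow> l \<bullet> b \<le> u \<bullet> b"
  then have lu: "l \<le> u" by simp
  let ?S = "- {0::real}"
  let ?f = "indicator (box l u) :: real \<Rightarrow> real"
  have img: "inverse ` ?S = ?S"
    by (auto simp: image_iff) (metis ComplI inverse_inverse_eq inverse_nonzero_iff_nonzero singletonD)
  have neg: "negligible {0::real}" by simp
  have hi: "(?f has_integral (u - l)) UNIV"
  proof -
    have "((\<lambda>x. 1::real) has_integral measure lborel (box l u)) (box l u)"
      using lu by (intro has_integral_measure_lborel) auto
    then have "((\<lambda>x. if x \<in> box l u then 1::real else 0) has_integral (u - l)) UNIV"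
      using lu by (subst has_integral_restrict_UNIV) simp
    moreover have "(\<lambda>x. if x \<in> box l u then 1::real else 0) = indicator (box l u)"
      by (auto simp: indicator_def fun_eq_iff)
    ultimately show ?thesis by simp
  qed
  have hiS: "(?f has_integral (u - l)) ?S"
    by (rule has_integral_spike_set_eq[THEN iffD1, OF _ _ hi]) (auto intro: negligible_subset[OF neg])
  have "?f absolutely_integrable_on ?S \<and> integral ?S ?f = u - l"
    using hiS by (auto intro!: nonnegative_absolutely_integrable_1 simp: has_integral_iff)
  then have *: "(\<lambda>x. \<bar>- (1 / x\<^sup>2)\<bar> * ?f (inverse x)) absolutely_integrable_on ?S \<and>
      integral ?S (\<lambda>x. \<bar>- (1 / x\<^sup>2)\<bar> * ?f (inverse x)) = u - l"
  proof (subst has_absolute_integral_change_of_variables_1'[where g = inverse and f = ?f])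
    show "(inverse has_real_derivative - (1 / x\<^sup>2)) (at x within - {0})" if "x \<in> - {0}" for x :: real
      using that by (auto intro!: derivative_eq_intros simp: power2_eq_square divide_inverse)
    show "inj_on inverse (- {0::real})" by (simp add: inj_on_def)
  qed (simp_all add: img)
  then have "((\<lambda>x. \<bar>- (1 / x\<^sup>2)\<bar> * ?f (inverse x)) has_integral (u - l)) ?S"
    by (auto simp: has_integral_iff intro: set_lebesgue_integral_eq_integral(1))
  then have "((\<lambda>x. 1 / x\<^sup>2 * ?f (inverse x)) has_integral (u - l)) ?S"
    by simp
  then have "((\<lambda>x. 1 / x\<^sup>2 * ?f (inverse x)) has_integral (u - l)) UNIV"
    by (rule has_integral_spike_set_eq[THEN iffD1, rotated 2]) (auto intro: negligible_subset[OF neg])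
  then have N: "(\<integral>\<^sup>+x. ennreal (1 / x\<^sup>2 * ?f (inverse x)) \<partial>lborel) = ennreal (u - l)"
    by (intro nn_integral_has_integral_lborel) auto
  have "emeasure (distr (density lborel (\<lambda>v. ennreal (1 / v\<^sup>2))) borel inverse) (box l u)
     = emeasure (density lborel (\<lambda>v. ennreal (1 / v\<^sup>2))) (inverse -` box l u)"
    by (subst emeasure_distr) auto
  also have "\<dots> = (\<integral>\<^sup>+x. ennreal (1 / x\<^sup>2) * indicator (inverse -` box l u) x \<partial>lborel)"
    using measurable_sets[of "inverse::real\<Rightarrow>real" borel borel "box l u"] by (intro emeasure_density) auto
  also have "\<dots> = (\<integral>\<^sup>+x. ennreal (1 / x\<^sup>2 * ?f (inverse x)) \<partial>lborel)"
    by (intro nn_integral_cong) (auto simp: indicator_def)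
  finally show "emeasure (distr (density lborel (\<lambda>v. ennreal (1 / v\<^sup>2))) borel inverse) (box l u)
     = (\<Prod>b\<in>Basis. (u - l) \<bullet> b)"
    using N by simp
qed simp

text \<open>The density \<open>1 / v^2\<close> is the square of the factor \<open>1 / |v|\<close>
  that a vertex contributes to a path, so this substitution makes inversion isometric on squares
  (\<open>sqnorm_transfer\<close>). The value \<open>inverse 0 = 0\<close> is harmless since a point
  is negligible.\<close>

lemma nn_integral_inverse:
  fixes g :: "real \<Rightarrow> ennreal"
  assumes [measurable]: "g \<in> borel_measurable borel"
  shows "(\<integral>\<^sup>+v. ennreal (1 / v\<^sup>2) * g (inverse v) \<partial>lborel) = (\<integral>\<^sup>+s. g s \<partial>lborel)"
  by (subst (2) lborel_inverse[symmetric]) (simp add: nn_integral_distr nn_integral_density)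

lemma nn_integral_reflect:
  fixes g :: "real \<Rightarrow> ennreal"
  assumes [measurable]: "g \<in> borel_measurable borel"
  shows "(\<integral>\<^sup>+s. g (a - s) \<partial>lborel) = (\<integral>\<^sup>+s. g s \<partial>lborel)"
  using nn_integral_real_affine[of g "-1" a] by simp

lemma nn_integral_shift:
  fixes g :: "real \<Rightarrow> ennreal"
  assumes [measurable]: "g \<in> borel_measurable borel"
  shows "(\<integral>\<^sup>+s. g (s - a) \<partial>lborel) = (\<integral>\<^sup>+s. g s \<partial>lborel)"
  using nn_integral_real_affine[of g 1 "-a"] by simp

lemma ennreal_square_diff_le: "ennreal ((f - g)\<^sup>2) + 2 * (ennreal f * ennreal g) = ennreal f ^ 2 + ennreal g ^ 2"
  if "f \<ge> 0" "g \<ge> 0" for f g :: real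
proof -
  have "ennreal ((f - g)\<^sup>2) + 2 * (ennreal f * ennreal g) = ennreal ((f - g)\<^sup>2 + 2 * (f * g))"
    using that by (simp add: ennreal_plus ennreal_mult)
  also have "(f - g)\<^sup>2 + 2 * (f * g) = f\<^sup>2 + g\<^sup>2" by (simp add: power2_eq_square algebra_simps)
  finally show ?thesis using that by (simp add: ennreal_plus ennreal_power)
qed

definition sqnorm :: "(real \<Rightarrow> ennreal) \<Rightarrow> ennreal" where
  "sqnorm f = (\<integral>\<^sup>+s. f s ^ 2 \<partial>lborel)"

text \<open>A law with density at most \<open>b\<close>, recorded through \<open>dominated\<close>
  alone: every use of the density is a comparison of integrals with Lebesgue measure, so the density
  itself never has to be named.\<close>

locale bounded_law = prob_space \<nu> for \<nu> :: "real measure" +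
  fixes b :: real
  assumes sets_law [measurable_cong, simp]: "sets \<nu> = sets borel"
    and b_pos: "b > 0"
    and dominated: "\<And>f. f \<in> borel_measurable borel \<Longrightarrow> (\<integral>\<^sup>+t. f t \<partial>\<nu>) \<le> ennreal b * (\<integral>\<^sup>+t. f t \<partial>lborel)"
begin

lemma space_law [simp]: "space \<nu> = UNIV"
  using sets_eq_imp_space_eq[OF sets_law] by simp

lemma AE_lborel_law: "AE t in lborel. P t \<Longrightarrow> AE t in \<nu>. P t"
proof -
  assume "AE t in lborel. P t"
  then obtain N where N: "{t \<in> space lborel. \<not> P t} \<subseteq> N" "N \<in> sets lborel" "emeasure lborel N = 0"
    by (rule AE_E)
  have "(\<integral>\<^sup>+t. indicator N t \<partial>\<nu>) \<le> ennreal b * (\<integral>\<^sup>+t. indicator N t \<partial>lborel)"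
    using N by (intro dominated) auto
  then have "emeasure \<nu> N = 0" using N by simp
  then show ?thesis using N by (intro AE_I[of _ _ N]) auto
qed

text \<open>The average over \<open>t\<close> of \<open>f\<close> at a quotient, as a function of
  the inverse quotient \<open>s\<close> one vertex further down the path.\<close>

definition smear :: "real \<Rightarrow> (real \<Rightarrow> ennreal) \<Rightarrow> real \<Rightarrow> ennreal" where
  "smear a f s = (\<integral>\<^sup>+t. f (a - t - s) \<partial>\<nu>)"

lemma emeasure_law_UNIV [simp]: "emeasure \<nu> UNIV = 1"
  using emeasure_space_1 by simp

lemma measurable_smear [measurable]:
  assumes [measurable]: "f \<in> borel_measurable borel"
  shows "smear a f \<in> borel_measurable borel"
  unfolding smear_def by measurable

lemma smear_square_le:
  assumes [measurable]: "f \<in> borel_measurable borel"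
  shows "smear a f s ^ 2 \<le> (\<integral>\<^sup>+t. f (a - t - s) ^ 2 \<partial>\<nu>)"
  using Cauchy_Schwarz_nn_integral[of "\<lambda>t. f (a - t - s)" \<nu> "\<lambda>_. 1"]
  by (simp add: smear_def)

text \<open>Jensen's inequality and the density bound: smearing maps L^2 to bounded functions. This
  controls the mass outside an interval after inversion, and also the last vertex of a path, where a
  pointwise value is needed.\<close>

lemma smear_le_sqnorm:
  assumes [measurable]: "f \<in> borel_measurable borel"
  shows "smear a f s ^ 2 \<le> ennreal b * sqnorm f"
proof -
  have "smear a f s ^ 2 \<le> (\<integral>\<^sup>+t. f ((a - s) - t) ^ 2 \<partial>\<nu>)"
    using smear_square_le[of f a s] by (simp add: algebra_simps)
  also have "\<dots> \<le> ennreal b * (\<integral>\<^sup>+t. f ((a - s) - t) ^ 2 \<partial>lborel)"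
    by (rule dominated) simp
  also have "(\<integral>\<^sup>+t. f ((a - s) - t) ^ 2 \<partial>lborel) = sqnorm f"
    unfolding sqnorm_def by (rule nn_integral_reflect[of "\<lambda>t. f t ^ 2"]) simp
  finally show ?thesis .
qed

lemma integral_square_shift:
  assumes [measurable]: "f \<in> borel_measurable borel"
  shows "(\<integral>\<^sup>+s. (\<integral>\<^sup>+t. f (a - t - s) ^ 2 \<partial>\<nu>) \<partial>lborel) = sqnorm f"
proof -
  interpret pair_sigma_finite lborel \<nu> by standard
  have "(\<integral>\<^sup>+s. (\<integral>\<^sup>+t. f (a - t - s) ^ 2 \<partial>\<nu>) \<partial>lborel) = (\<integral>\<^sup>+t. (\<integral>\<^sup>+s. f (a - t - s) ^ 2 \<partial>lborel) \<partial>\<nu>)"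
    by (rule Fubini'[symmetric]) measurable
  also have "\<dots> = (\<integral>\<^sup>+t. sqnorm f \<partial>\<nu>)"
    unfolding sqnorm_def by (intro nn_integral_cong nn_integral_reflect[of "\<lambda>t. f t ^ 2"]) simp
  finally show ?thesis by (simp add: emeasure_space_1)
qed

lemma sqnorm_smear_le:
  assumes [measurable]: "f \<in> borel_measurable borel"
  shows "sqnorm (smear a f) \<le> sqnorm f"
proof -
  have "sqnorm (smear a f) \<le> (\<integral>\<^sup>+s. (\<integral>\<^sup>+t. f (a - t - s) ^ 2 \<partial>\<nu>) \<partial>lborel)"
    unfolding sqnorm_def by (intro nn_integral_mono smear_square_le) simp
  then show ?thesis by (simp add: integral_square_shift)
qed

section \<open>Strict loss of norm under smearing\<close>

definition shift_defect :: "(real \<Rightarrow> real) \<Rightarrow> real \<Rightarrow> ennreal" where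
  "shift_defect f a = (\<integral>\<^sup>+s. ennreal ((f s - f (s - a))\<^sup>2) \<partial>lborel)"

lemma shift_defect_measurable [measurable]:
  assumes [measurable]: "f \<in> borel_measurable borel"
  shows "shift_defect f \<in> borel_measurable borel"
  unfolding shift_defect_def by measurable

text \<open>The variance of the random variable \<open>f (a - t - s)\<close>, integrated over \<open>s\<close>.\<close>

lemma smear_variance:
  fixes f :: "real \<Rightarrow> real"
  assumes [measurable]: "f \<in> borel_measurable borel" and f0: "\<And>s. f s \<ge> 0"
  shows "(\<integral>\<^sup>+t. (\<integral>\<^sup>+t'. shift_defect f (t' - t) \<partial>\<nu>) \<partial>\<nu>) + 2 * sqnorm (smear a f) = 2 * sqnorm f"
proof -
  interpret P: pair_sigma_finite lborel \<nu> by standard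
  interpret Q: pair_sigma_finite \<nu> \<nu> by standard
  interpret R: pair_sigma_finite lborel "\<nu> \<Otimes>\<^sub>M \<nu>" by standard
  have D: "shift_defect f (t' - t) = (\<integral>\<^sup>+s. ennreal ((f (a - t - s) - f (a - t' - s))\<^sup>2) \<partial>lborel)" for t t'
    using nn_integral_reflect[of "\<lambda>s. ennreal ((f s - f (s - (t' - t)))\<^sup>2)" "a - t"]
    by (simp add: shift_defect_def algebra_simps)
  have "(\<integral>\<^sup>+t. (\<integral>\<^sup>+t'. shift_defect f (t' - t) \<partial>\<nu>) \<partial>\<nu>)
     = (\<integral>\<^sup>+t. (\<integral>\<^sup>+s. (\<integral>\<^sup>+t'. ennreal ((f (a - t - s) - f (a - t' - s))\<^sup>2) \<partial>\<nu>) \<partial>lborel) \<partial>\<nu>)"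
    unfolding D by (intro nn_integral_cong P.Fubini') measurable
  also have "\<dots> = (\<integral>\<^sup>+s. (\<integral>\<^sup>+t. (\<integral>\<^sup>+t'. ennreal ((f (a - t - s) - f (a - t' - s))\<^sup>2) \<partial>\<nu>) \<partial>\<nu>) \<partial>lborel)"
    by (rule P.Fubini') measurable
  finally have 1: "(\<integral>\<^sup>+t. (\<integral>\<^sup>+t'. shift_defect f (t' - t) \<partial>\<nu>) \<partial>\<nu>) = \<dots>" .
  have prod: "smear a f s ^ 2 = (\<integral>\<^sup>+t. (\<integral>\<^sup>+t'. ennreal (f (a - t - s)) * ennreal (f (a - t' - s)) \<partial>\<nu>) \<partial>\<nu>)" for s
    by (simp add: smear_def power2_eq_square nn_integral_cmult nn_integral_multc)
  have pt: "(\<integral>\<^sup>+t. (\<integral>\<^sup>+t'. ennreal ((f (a - t - s) - f (a - t' - s))\<^sup>2) \<partial>\<nu>) \<partial>\<nu>) + 2 * smear a f s ^ 2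
      = 2 * (\<integral>\<^sup>+t. ennreal (f (a - t - s)) ^ 2 \<partial>\<nu>)" for s
  proof -
    have "(\<integral>\<^sup>+t. (\<integral>\<^sup>+t'. ennreal ((f (a - t - s) - f (a - t' - s))\<^sup>2) \<partial>\<nu>) \<partial>\<nu>) + 2 * smear a f s ^ 2
      = (\<integral>\<^sup>+t. (\<integral>\<^sup>+t'. ennreal ((f (a - t - s) - f (a - t' - s))\<^sup>2) + 2 * (ennreal (f (a - t - s)) * ennreal (f (a - t' - s))) \<partial>\<nu>) \<partial>\<nu>)"
      unfolding prod by (simp add: nn_integral_add nn_integral_cmult)
    also have "\<dots> = (\<integral>\<^sup>+t. (\<integral>\<^sup>+t'. ennreal (f (a - t - s)) ^ 2 + ennreal (f (a - t' - s)) ^ 2 \<partial>\<nu>) \<partial>\<nu>)"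
      by (intro nn_integral_cong ennreal_square_diff_le f0)
    also have "\<dots> = 2 * (\<integral>\<^sup>+t. ennreal (f (a - t - s)) ^ 2 \<partial>\<nu>)"
      by (simp add: nn_integral_add emeasure_space_1 mult_2)
    finally show ?thesis .
  qed
  have "(\<integral>\<^sup>+t. (\<integral>\<^sup>+t'. shift_defect f (t' - t) \<partial>\<nu>) \<partial>\<nu>) + 2 * sqnorm (smear a f)
     = (\<integral>\<^sup>+s. (\<integral>\<^sup>+t. (\<integral>\<^sup>+t'. ennreal ((f (a - t - s) - f (a - t' - s))\<^sup>2) \<partial>\<nu>) \<partial>\<nu>) + 2 * smear a f s ^ 2 \<partial>lborel)"
    unfolding 1 sqnorm_def by (simp add: nn_integral_add nn_integral_cmult)
  also have "\<dots> = 2 * sqnorm f"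
    unfolding pt using integral_square_shift[of "\<lambda>x. ennreal (f x)" a] by (simp add: nn_integral_cmult)
  finally show ?thesis .
qed

text \<open>Two independent samples of the law are only known to differ by about
  \<open>1 / (4 * b)\<close> with probability one half, whereas the disjointness argument needs a
  shift longer than the interval. Telescoping over \<open>n\<close> small shifts bridges the
  difference; Cauchy-Schwarz makes the cost quadratic in \<open>n\<close>.\<close>

lemma shift_defect_nat:
  fixes f :: "real \<Rightarrow> real"
  assumes [measurable]: "f \<in> borel_measurable borel"
  shows "shift_defect f (real n * a) \<le> ennreal (real n ^ 2) * shift_defect f a"
proof -
  have "(f s - f (s - real n * a))\<^sup>2 \<le> real n * (\<Sum>i<n. (f (s - real i * a) - f (s - real i * a - a))\<^sup>2)" for s
  proof -
    have "f s - f (s - real n * a) = (\<Sum>i<n. f (s - real i * a) - f (s - real i * a - a))"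
      by (induction n) (auto simp: algebra_simps)
    also have "\<dots>\<^sup>2 \<le> real (card {..<n}) * (\<Sum>i<n. (f (s - real i * a) - f (s - real i * a - a))\<^sup>2)"
      using Cauchy_Schwarz_ineq_sum[of "\<lambda>_. 1" "\<lambda>i. f (s - real i * a) - f (s - real i * a - a)" "{..<n}"]
      by simp
    finally show ?thesis by simp
  qed
  then have "shift_defect f (real n * a)
     \<le> (\<integral>\<^sup>+s. ennreal (real n) * (\<Sum>i<n. ennreal ((f (s - real i * a) - f (s - real i * a - a))\<^sup>2)) \<partial>lborel)"
    unfolding shift_defect_def
    by (intro nn_integral_mono) (simp flip: ennreal_mult add: sum_nonneg)
  also have "\<dots> = ennreal (real n) * (\<Sum>i<n. \<integral>\<^sup>+s. ennreal ((f (s - real i * a) - f (s - real i * a - a))\<^sup>2) \<partial>lborel)"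
    by (simp add: nn_integral_cmult nn_integral_sum del: sum_ennreal)
  also have "(\<Sum>i<n. \<integral>\<^sup>+s. ennreal ((f (s - real i * a) - f (s - real i * a - a))\<^sup>2) \<partial>lborel)
     = (\<Sum>i<n. shift_defect f a)"
    unfolding shift_defect_def
    by (intro sum.cong refl nn_integral_shift[where g = "\<lambda>s. ennreal ((f s - f (s - a))\<^sup>2)"]) measurable
  also have "ennreal (real n) * \<dots> = ennreal (real n ^ 2) * shift_defect f a"
    by (simp add: power2_eq_square ennreal_mult mult.assoc ennreal_of_nat_eq_real_of_nat)
  finally show ?thesis .
qed

definition outer :: "real \<Rightarrow> (real \<Rightarrow> ennreal) \<Rightarrow> ennreal" where
  "outer B f = (\<integral>\<^sup>+s. f s ^ 2 * indicator (- {-B..B}) s \<partial>lborel)"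

definition inner_mass :: "real \<Rightarrow> (real \<Rightarrow> ennreal) \<Rightarrow> ennreal" where
  "inner_mass B f = (\<integral>\<^sup>+s. f s ^ 2 * indicator {-B..B} s \<partial>lborel)"

lemma inner_plus_outer:
  assumes [measurable]: "f \<in> borel_measurable borel"
  shows "inner_mass B f + outer B f = sqnorm f"
  unfolding inner_mass_def outer_def sqnorm_def
  by (subst nn_integral_add[symmetric]) (auto intro!: nn_integral_cong simp: indicator_def)

text \<open>The translates of \<open>{-B..B}\<close> by \<open>0, a, 2 a, 3 a\<close> are disjoint, so an almost shift-invariant
  function has little mass in \<open>{-B..B}\<close>.\<close>

lemma inner_mass_shift_defect:
  fixes f :: "real \<Rightarrow> real"
  assumes [measurable]: "f \<in> borel_measurable borel" and f0: "\<And>s. f s \<ge> 0" and a: "\<bar>a\<bar> > 2 * B"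
  shows "4 * inner_mass B (\<lambda>s. ennreal (f s)) \<le> 2 * sqnorm (\<lambda>s. ennreal (f s)) + 28 * shift_defect f a"
proof -
  let ?I = "\<lambda>j::nat. (\<integral>\<^sup>+s. ennreal (f (s - real j * a)) ^ 2 * indicator {-B..B} s \<partial>lborel)"
  have one: "inner_mass B (\<lambda>s. ennreal (f s)) \<le> 2 * ?I j + 2 * (ennreal (real j ^ 2) * shift_defect f a)" for j
  proof -
    have "ennreal (f s) ^ 2 * indicator {-B..B} s \<le>
        2 * (ennreal (f (s - real j * a)) ^ 2 * indicator {-B..B} s) + 2 * ennreal ((f s - f (s - real j * a))\<^sup>2)" for s
    proof -
      have "(f s)\<^sup>2 \<le> 2 * (f (s - real j * a))\<^sup>2 + 2 * (f s - f (s - real j * a))\<^sup>2"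
        using zero_le_power2[of "f s - 2 * f (s - real j * a)"] by (simp add: power2_eq_square algebra_simps)
      then have "ennreal ((f s)\<^sup>2) \<le> ennreal (2 * (f (s - real j * a))\<^sup>2 + 2 * (f s - f (s - real j * a))\<^sup>2)"
        by (rule ennreal_leI)
      then show ?thesis
        using f0 by (auto simp: indicator_def ennreal_plus ennreal_mult ennreal_power)
    qed
    then have "inner_mass B (\<lambda>s. ennreal (f s)) \<le>
       (\<integral>\<^sup>+s. 2 * (ennreal (f (s - real j * a)) ^ 2 * indicator {-B..B} s) + 2 * ennreal ((f s - f (s - real j * a))\<^sup>2) \<partial>lborel)"
      unfolding inner_mass_def by (intro nn_integral_mono)
    also have "\<dots> = 2 * ?I j + 2 * shift_defect f (real j * a)"
      unfolding shift_defect_def by (simp add: nn_integral_add nn_integral_cmult)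
    also have "\<dots> \<le> 2 * ?I j + 2 * (ennreal (real j ^ 2) * shift_defect f a)"
      by (intro add_left_mono mult_left_mono shift_defect_nat) auto
    finally show ?thesis .
  qed
  have shifted: "?I j = (\<integral>\<^sup>+s. ennreal (f s) ^ 2 * indicator {-B..B} (s + real j * a) \<partial>lborel)" for j
    using nn_integral_shift[of "\<lambda>s. ennreal (f s) ^ 2 * indicator {-B..B} (s + real j * a)" "real j * a"]
    by simp
  have disj: "(\<Sum>j<4. indicator {-B..B} (s + real j * a) :: ennreal) \<le> 1" for s
  proof -
    have "s + real i * a \<notin> {-B..B} \<or> s + real j * a \<notin> {-B..B}" if "i < j" for i j
    proof (rule ccontr)
      assume "\<not> ?thesis"
      then have "\<bar>(real j - real i) * a\<bar> \<le> 2 * B" by (auto simp: algebra_simps abs_le_iff)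
      moreover have "\<bar>(real j - real i) * a\<bar> \<ge> 1 * \<bar>a\<bar>"
        unfolding abs_mult using that by (intro mult_right_mono) auto
      ultimately show False using a by simp
    qed
    from this[of 0 1] this[of 0 2] this[of 0 3] this[of 1 2] this[of 1 3] this[of 2 3]
    show ?thesis by (auto simp: numeral_eq_Suc indicator_def)
  qed
  have "(\<Sum>j<4. ?I j) = (\<integral>\<^sup>+s. ennreal (f s) ^ 2 * (\<Sum>j<4. indicator {-B..B} (s + real j * a)) \<partial>lborel)"
    unfolding shifted by (subst nn_integral_sum[symmetric]) (auto simp: sum_distrib_left)
  also have "\<dots> \<le> (\<integral>\<^sup>+s. ennreal (f s) ^ 2 * 1 \<partial>lborel)"
    by (intro nn_integral_mono mult_left_mono disj) auto
  finally have I: "(\<Sum>j<4. ?I j) \<le> sqnorm (\<lambda>s. ennreal (f s))" by (simp add: sqnorm_def)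
  have "4 * inner_mass B (\<lambda>s. ennreal (f s)) = (\<Sum>j<4::nat. inner_mass B (\<lambda>s. ennreal (f s)))" by simp
  also have "\<dots> \<le> (\<Sum>j<4. 2 * ?I j + 2 * (ennreal (real j ^ 2) * shift_defect f a))"
    by (intro sum_mono one)
  also have "\<dots> = 2 * (\<Sum>j<4. ?I j) + 28 * shift_defect f a"
  proof -
    have "(\<Sum>j<4. 2 * (ennreal (real j ^ 2) * shift_defect f a)) = ennreal (\<Sum>j<4. 2 * (real j)^2) * shift_defect f a"
      by (subst sum_ennreal[symmetric]) (auto simp: sum_distrib_right ennreal_mult mult.assoc)
    also have "(\<Sum>j<4. 2 * (real j)^2) = 28" by (simp add: numeral_eq_Suc)
    finally show ?thesis by (simp add: sum.distrib sum_distrib_left)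
  qed
  also have "\<dots> \<le> 2 * sqnorm (\<lambda>s. ennreal (f s)) + 28 * shift_defect f a"
    by (intro add_right_mono mult_left_mono I) auto
  finally show ?thesis .
qed

text \<open>An interval of radius \<open>s\<close> carries mass at most \<open>2 * b * s\<close>,
  hence at most one half.\<close>

lemma law_far_mass:
  assumes "s > 0" "4 * (b * s) \<le> 1"
  shows "emeasure \<nu> {t'. s \<le> \<bar>t' - t\<bar>} \<ge> ennreal (1 / 2)"
proof -
  have "(\<integral>\<^sup>+t'. indicator {t-s..t+s} t' \<partial>\<nu>) \<le> ennreal b * (\<integral>\<^sup>+t'. indicator {t-s..t+s} t' \<partial>lborel)"
    by (rule dominated) auto
  also have "\<dots> = ennreal (b * (2 * s))"
    using assms b_pos by (simp add: ennreal_mult)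
  also have "\<dots> \<le> ennreal (1 / 2)" using assms by (intro ennreal_leI) simp
  finally have "emeasure \<nu> {t-s..t+s} \<le> ennreal (1 / 2)" by simp
  then have "measure \<nu> {t-s..t+s} \<le> 1 / 2"
    unfolding emeasure_eq_measure by (subst (asm) ennreal_le_iff) auto
  moreover have "measure \<nu> (- {t-s..t+s}) = 1 - measure \<nu> {t-s..t+s}"
    using prob_compl[of "{t-s..t+s}"] by (simp add: Compl_eq_Diff_UNIV)
  moreover have "measure \<nu> (- {t-s..t+s}) \<le> measure \<nu> {t'. s \<le> \<bar>t' - t\<bar>}"
    by (intro finite_measure_mono) auto
  ultimately have "1 / 2 \<le> measure \<nu> {t'. s \<le> \<bar>t' - t\<bar>}" by linarith
  then have "ennreal (1 / 2) \<le> ennreal (measure \<nu> {t'. s \<le> \<bar>t' - t\<bar>})" by (rule ennreal_leI)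
  then show ?thesis by (simp only: emeasure_eq_measure)
qed

text \<open>For samples at distance at least \<open>s\<close>, the \<open>n\<close>-fold shift moves
  {-B..B} off itself. Averaging the resulting bound on the inner mass over the pair of samples turns
  the shift defect into the loss of norm given by \<open>smear_variance\<close>. The inequality is
  written additively because subtraction in \<open>ennreal\<close> truncates.\<close>

lemma sqnorm_gap_real:
  fixes f :: "real \<Rightarrow> real"
  assumes [measurable]: "f \<in> borel_measurable borel" and f0: "\<And>s. f s \<ge> 0"
    and s: "s > 0" "4 * (b * s) \<le> 1" and n: "real n * s > 2 * B"
  shows "2 * inner_mass B f + 28 * (ennreal (real n ^ 2) * (2 * sqnorm (smear a f)))
     \<le> sqnorm f + 28 * ennreal (real n ^ 2) * (2 * sqnorm f)"
proof -
  let ?m = "inner_mass B (\<lambda>s. ennreal (f s))" and ?N = "sqnorm (\<lambda>s. ennreal (f s))" and ?k = "ennreal (real n ^ 2)"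
  let ?D = "\<lambda>t. \<integral>\<^sup>+t'. shift_defect f (t' - t) \<partial>\<nu>"
  have pt: "2 * ?m \<le> ?N + 14 * (?k * shift_defect f (t' - t))" if "s \<le> \<bar>t' - t\<bar>" for t t'
  proof -
    have "2 * B < \<bar>real n * (t' - t)\<bar>"
      using n mult_left_mono[OF that, of "real n"] by (simp add: abs_mult)
    from inner_mass_shift_defect[OF assms(1) f0 this]
    have "2 * (2 * ?m) \<le> 2 * (?N + 14 * shift_defect f (real n * (t' - t)))" by (simp add: distrib_left mult.assoc[symmetric])
    then have "2 * ?m \<le> ?N + 14 * shift_defect f (real n * (t' - t))"
      by (subst (asm) ennreal_mult_le_mult_iff) auto
    also have "\<dots> \<le> ?N + 14 * (?k * shift_defect f (t' - t))"
      by (intro add_left_mono mult_left_mono shift_defect_nat) auto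
    finally show ?thesis .
  qed
  have row: "2 * ?m \<le> ?N + 28 * (?k * ?D t)" for t
  proof (cases "2 * ?m \<le> ?N")
    case True then show ?thesis by (simp add: add_increasing2)
  next
    case False
    then have "?N < 2 * ?m" "?N < \<top>" by (auto simp: not_le less_top[symmetric])
    let ?x = "2 * ?m - ?N"
    have "?x * emeasure \<nu> {t'. s \<le> \<bar>t' - t\<bar>} = (\<integral>\<^sup>+t'. ?x * indicator {t'. s \<le> \<bar>t' - t\<bar>} t' \<partial>\<nu>)"
      by (subst nn_integral_cmult_indicator) auto
    also have "\<dots> \<le> (\<integral>\<^sup>+t'. 14 * (?k * shift_defect f (t' - t)) \<partial>\<nu>)"
      using pt \<open>?N < \<top>\<close> by (intro nn_integral_mono)
        (auto simp: indicator_def ennreal_minus_le_iff)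
    also have "\<dots> = 14 * (?k * ?D t)" by (simp add: nn_integral_cmult)
    finally have 1: "?x * emeasure \<nu> {t'. s \<le> \<bar>t' - t\<bar>} \<le> 14 * (?k * ?D t)" .
    \<comment> \<open>Restricting to the far samples, of probability at least one half, turns the
      constant 14 into 28.\<close>
    have "?x * ennreal (1 / 2) \<le> 14 * (?k * ?D t)"
      by (rule order_trans[OF mult_left_mono[OF law_far_mass[OF s]] 1]) simp
    then have "2 * (?x * ennreal (1 / 2)) \<le> 2 * (14 * (?k * ?D t))" by (rule mult_left_mono) simp
    moreover have "2 * (?x * ennreal (1 / 2)) = ?x"
    proof -
      have "2 * (?x * ennreal (1 / 2)) = ?x * (2 * ennreal (1 / 2))" by (simp only: mult_ac)
      also have "2 * ennreal (1 / 2) = 1"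
        unfolding ennreal_numeral[symmetric] by (subst ennreal_mult[symmetric]) auto
      finally show ?thesis by simp
    qed
    ultimately have "?x \<le> 28 * (?k * ?D t)" by (simp add: mult.assoc[symmetric])
    then show ?thesis by (simp add: ennreal_minus_le_iff)
  qed
  have "2 * ?m = (\<integral>\<^sup>+t. 2 * ?m \<partial>\<nu>)" by simp
  also have "\<dots> \<le> (\<integral>\<^sup>+t. ?N + 28 * (?k * ?D t) \<partial>\<nu>)"
    by (intro nn_integral_mono row)
  also have "\<dots> = ?N + 28 * (?k * (\<integral>\<^sup>+t. ?D t \<partial>\<nu>))"
    by (simp add: nn_integral_add nn_integral_cmult)
  finally have "2 * ?m + 28 * (?k * (2 * sqnorm (smear a f))) \<le> ?N + 28 * (?k * (\<integral>\<^sup>+t. ?D t \<partial>\<nu>)) + 28 * (?k * (2 * sqnorm (smear a f)))"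
    by (rule add_right_mono)
  also have "\<dots> = ?N + 28 * ?k * ((\<integral>\<^sup>+t. ?D t \<partial>\<nu>) + 2 * sqnorm (smear a f))"
    by (simp add: distrib_left mult.assoc add.assoc)
  also have "\<dots> = ?N + 28 * ?k * (2 * ?N)"
    by (subst smear_variance) (auto simp: f0)
  finally show ?thesis .
qed

text \<open>Reduction to real values: a finite norm makes \<open>f\<close> finite almost everywhere,
  and smearing does not see a Lebesgue null set because the law is dominated by Lebesgue
  measure.\<close>

lemma sqnorm_gap:
  fixes f :: "real \<Rightarrow> ennreal"
  assumes [measurable]: "f \<in> borel_measurable borel" and fin: "sqnorm f < \<top>"
    and s: "s > 0" "4 * (b * s) \<le> 1" and n: "real n * s > 2 * B"
  shows "2 * inner_mass B f + 28 * (ennreal (real n ^ 2) * (2 * sqnorm (smear a f)))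
     \<le> sqnorm f + 28 * ennreal (real n ^ 2) * (2 * sqnorm f)"
proof -
  define g where "g s = enn2real (f s)" for s
  have [measurable]: "g \<in> borel_measurable borel" unfolding g_def by measurable
  have "AE s in lborel. f s ^ 2 \<noteq> \<infinity>"
    using fin unfolding sqnorm_def by (intro nn_integral_PInf_AE) auto
  then have AE: "AE s in lborel. f s = ennreal (g s)"
    by eventually_elim (auto simp: g_def power2_eq_square ennreal_mult_eq_top_iff less_top)
  have AE': "AE t in \<nu>. f (a - t - s) = ennreal (g (a - t - s))" for s
    using AE_borel_affine[of "-1" "\<lambda>s. f s = ennreal (g s)" "a - s"] AE
    by (intro AE_lborel_law) (auto simp: algebra_simps)
  have 1: "inner_mass B f = inner_mass B (\<lambda>s. ennreal (g s))"
    unfolding inner_mass_def by (intro nn_integral_cong_AE) (use AE in eventually_elim, simp)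
  have 2: "sqnorm f = sqnorm (\<lambda>s. ennreal (g s))"
    unfolding sqnorm_def by (intro nn_integral_cong_AE) (use AE in eventually_elim, simp)
  have 3: "smear a f = smear a (\<lambda>s. ennreal (g s))"
    unfolding smear_def by (intro ext nn_integral_cong_AE) (use AE' in eventually_elim, simp)
  show ?thesis
    unfolding 1 2 3 by (rule sqnorm_gap_real[OF _ _ s n]) (auto simp: g_def)
qed

section \<open>The contraction along one edge\<close>

definition transfer :: "real \<Rightarrow> (real \<Rightarrow> ennreal) \<Rightarrow> real \<Rightarrow> ennreal" where
  "transfer a f v = ennreal (inverse \<bar>v\<bar>) * smear a f (inverse v)"

lemma transfer_square: "transfer a f v ^ 2 = ennreal (1 / v\<^sup>2) * smear a f (inverse v) ^ 2"
  by (simp add: transfer_def power_mult_distrib ennreal_power power_inverse divide_inverse)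

text \<open>The factor \<open>inverse \<bar>v\<bar>\<close> in \<open>transfer\<close> is at once
  the contribution of a vertex to the path weight and the square root of the Jacobian of inversion,
  so no norm is gained or lost here.\<close>

lemma sqnorm_transfer:
  assumes [measurable]: "f \<in> borel_measurable borel"
  shows "sqnorm (transfer a f) = sqnorm (smear a f)"
  unfolding sqnorm_def transfer_square by (rule nn_integral_inverse) measurable

text \<open>Inversion sends the outside of {-B..B} into an interval of length \<open>2 / B\<close>,
  and there the smeared function is bounded pointwise by \<open>smear_le_sqnorm\<close>.\<close>

lemma outer_transfer_le:
  assumes [measurable]: "f \<in> borel_measurable borel" and B: "B > 0"
  shows "outer B (transfer a f) \<le> ennreal (2 * b / B) * sqnorm f"
proof -
  have "outer B (transfer a f) \<le>
     (\<integral>\<^sup>+v. ennreal (1 / v\<^sup>2) * (smear a f (inverse v) ^ 2 * indicator {-(1/B)..1/B} (inverse v)) \<partial>lborel)"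
    unfolding outer_def transfer_square
  proof (intro nn_integral_mono)
    fix v
    have "inverse v \<in> {-(1/B)..1/B}" if "v \<in> - {-B..B}"
    proof -
      have "\<bar>inverse v\<bar> \<le> inverse B"
        unfolding abs_inverse using that B by (intro le_imp_inverse_le) auto
      then show ?thesis by (auto simp: divide_inverse abs_le_iff simp del: abs_inverse)
    qed
    then show "ennreal (1 / v\<^sup>2) * (smear a f (inverse v))\<^sup>2 * indicator (- {- B..B}) v
         \<le> ennreal (1 / v\<^sup>2) * ((smear a f (inverse v))\<^sup>2 * indicator {- (1 / B)..1 / B} (inverse v))"
      by (auto simp: indicator_def)
  qed
  also have "\<dots> = (\<integral>\<^sup>+s. smear a f s ^ 2 * indicator {-(1/B)..1/B} s \<partial>lborel)"
    by (rule nn_integral_inverse) measurable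
  also have "\<dots> \<le> (\<integral>\<^sup>+s. (ennreal b * sqnorm f) * indicator {-(1/B)..1/B} s \<partial>lborel)"
    by (intro nn_integral_mono mult_right_mono smear_le_sqnorm) auto
  also have "\<dots> = ennreal b * sqnorm f * ennreal (2 / B)"
    using B by (subst nn_integral_cmult_indicator) auto
  also have "\<dots> = ennreal (2 * b / B) * sqnorm f"
  proof -
    have "ennreal (2 * b / B) = ennreal b * ennreal (2 / B)"
      using B b_pos by (subst ennreal_mult[symmetric]) (auto simp: mult.commute)
    then show ?thesis by (simp only: mult_ac)
  qed
  finally show ?thesis .
qed

text \<open>The constant of \<open>sqnorm_gap\<close> for \<open>B = 16 * b\<close> and
  \<open>s = 1 / (4 * b)\<close>, where \<open>n * s > 2 * B\<close> reads
  \<open>n > 128 * b^2\<close>. The 28 goes back to \<open>2 * (0 + 1 + 4 + 9)\<close>, the cost of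
  the translates by 0, 1, 2 and 3 shifts.\<close>

definition gap :: real where "gap = 28 * (real (nat \<lceil>128 * b\<^sup>2\<rceil> + 1))\<^sup>2"

text \<open>By \<open>sqnorm_gap\<close>, smearing loses the share \<open>1 / (2 * gap)\<close> of
  the norm up to an error \<open>1 / gap\<close> times the outer mass. Charging the outer mass with
  weight \<open>2 / gap\<close> pays for this error with half of that weight. The interval of radius
  \<open>16 * b\<close> makes the outer mass created by the next inversion at most one eighth of the
  norm, so that a share \<open>1 / (4 * gap)\<close> is still lost; this is the origin of
  \<open>rate\<close>.\<close>

definition wnorm :: "(real \<Rightarrow> ennreal) \<Rightarrow> ennreal" where
  "wnorm f = sqnorm f + ennreal (2 / gap) * outer (16 * b) f"

definition rate :: real where "rate = sqrt (1 - 1 / (4 * gap))"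

lemma gap_ge: "gap \<ge> 28"
proof -
  have "1\<^sup>2 \<le> (real (nat \<lceil>128 * b\<^sup>2\<rceil> + 1))\<^sup>2"
    by (intro power_mono) (metis le_add2 of_nat_1 of_nat_le_iff, simp)
  then show ?thesis unfolding gap_def by simp
qed

lemma rate_bounds: "0 < rate" "rate < 1"
  using gap_ge by (auto simp: rate_def field_simps)

lemma outer_le_sqnorm: "outer B f \<le> sqnorm f"
  unfolding outer_def sqnorm_def by (intro nn_integral_mono) (auto simp: indicator_def)

lemma sqnorm_le_wnorm: "sqnorm f \<le> wnorm f"
  unfolding wnorm_def by simp

lemma wnorm_le_sqnorm: "wnorm f \<le> 2 * sqnorm f"
proof -
  have "ennreal (2 / gap) * outer (16 * b) f \<le> 1 * sqnorm f"
    using gap_ge by (intro mult_mono outer_le_sqnorm) (auto simp: divide_simps)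
  then show ?thesis unfolding wnorm_def by (simp add: mult_2 add_left_mono)
qed

lemma wnorm_transfer:
  assumes [measurable]: "f \<in> borel_measurable borel" and fin: "wnorm f < \<top>"
  shows "wnorm (transfer a f) \<le> ennreal (rate\<^sup>2) * wnorm f"
proof -
  let ?n = "nat \<lceil>128 * b\<^sup>2\<rceil> + 1" and ?B = "16 * b"
  have N: "sqnorm f < \<top>" using fin sqnorm_le_wnorm[of f] by (rule order.strict_trans1[rotated])
  then have NC: "sqnorm (smear a f) < \<top>" using sqnorm_smear_le[OF assms(1)] by (rule order.strict_trans1[rotated])
  have O: "outer ?B f < \<top>" using outer_le_sqnorm N by (rule order.strict_trans1)
  have I: "inner_mass ?B f < \<top>"
    using inner_plus_outer[OF assms(1), of ?B] N by (metis add_increasing2 order.strict_trans1 order_refl zero_le)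
  have OT: "outer ?B (transfer a f) < \<top>"
    using outer_le_sqnorm[of ?B "transfer a f"] NC sqnorm_transfer[OF assms(1), of a]
    by (metis order.strict_trans1)
  obtain x where x: "sqnorm f = ennreal x" "x \<ge> 0" using N by (cases "sqnorm f") auto
  obtain y where y: "outer ?B f = ennreal y" "y \<ge> 0" using O by (cases "outer ?B f") auto
  obtain z where z: "sqnorm (smear a f) = ennreal z" "z \<ge> 0" using NC by (cases "sqnorm (smear a f)") auto
  obtain m where m: "inner_mass ?B f = ennreal m" "m \<ge> 0" using I by (cases "inner_mass ?B f") auto
  obtain t where t: "outer ?B (transfer a f) = ennreal t" "t \<ge> 0" using OT by (cases "outer ?B (transfer a f)") auto
  have mx: "m + y = x"
    using inner_plus_outer[OF assms(1), of ?B] x y m by (simp flip: ennreal_plus)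
  have "real ?n > 128 * b\<^sup>2" by linarith
  then have n: "real ?n * (1 / (4 * b)) > 2 * ?B"
    using b_pos by (simp add: field_simps power2_eq_square)
  have "ennreal (2 * m + 2 * gap * z) \<le> ennreal (x + 2 * gap * x)"
    using sqnorm_gap[OF assms(1) N _ _ n, of a] b_pos m z x gap_ge
    by (simp add: gap_def ennreal_plus ennreal_mult mult_ac flip: ennreal_numeral ennreal_mult ennreal_plus
         del: of_nat_add of_nat_Suc)
  then have gapineq: "2 * m + 2 * gap * z \<le> x + 2 * gap * x"
    using x gap_ge by (subst (asm) ennreal_le_iff) auto
  have "ennreal t \<le> ennreal (1 / 8 * x)"
    using outer_transfer_le[OF assms(1), of ?B a] b_pos x t by (subst ennreal_mult) auto
  then have tx: "t \<le> x / 8" using x by (subst (asm) ennreal_le_iff) auto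
  have g: "gap > 0" using gap_ge by simp
  have "z + 2 / gap * t \<le> (1 - 1 / (4 * gap)) * (x + 2 / gap * y)"
  proof -
    have "z \<le> x - (x / 2 - y) / gap"
      using gapineq mx g by (simp add: field_simps)
    moreover have "2 / gap * t \<le> 2 / gap * (x / 8)"
      using tx g by (intro mult_left_mono) auto
    moreover have "(1 - 1 / (4 * gap)) * (2 / gap * y) \<ge> (1 / 2) * (2 / gap * y)"
      using gap_ge y by (intro mult_right_mono) (auto simp: field_simps)
    moreover have "x - (x / 2 - y) / gap + 2 / gap * (x / 8) = (1 - 1 / (4 * gap)) * x + (1 / 2) * (2 / gap * y)"
      using g by (simp add: field_simps)
    ultimately show ?thesis by (simp add: distrib_left)
  qed
  moreover have "rate\<^sup>2 = 1 - 1 / (4 * gap)"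
    using gap_ge by (simp add: rate_def field_simps)
  ultimately have "ennreal (z + 2 / gap * t) \<le> ennreal (rate\<^sup>2 * (x + 2 / gap * y))"
    by (intro ennreal_leI) simp
  moreover have "wnorm (transfer a f) = ennreal (z + 2 / gap * t)"
    unfolding wnorm_def sqnorm_transfer[OF assms(1)] z(1) t(1)
    using z(2) t(2) g by (subst ennreal_mult[symmetric]) (auto simp: ennreal_plus)
  moreover have "wnorm f = ennreal (x + 2 / gap * y)"
    unfolding wnorm_def x(1) y(1)
    using x(2) y(2) g by (subst ennreal_mult[symmetric]) (auto simp: ennreal_plus)
  ultimately show ?thesis
    using x(2) y(2) g by (simp only:) (subst ennreal_mult[symmetric], auto)
qed

end

section \<open>Square-summable functions\<close>

definition delta :: "'a \<Rightarrow> 'a \<Rightarrow> complex" where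
  "delta x = (\<lambda>y. if y = x then 1 else 0)"

lemma ell2_scale: "f \<in> ell2 \<Longrightarrow> (\<lambda>x. c * f x) \<in> ell2"
  by (simp add: ell2_def norm_mult power_mult_distrib summable_on_cmult_right)

lemma ell2_mono: "g \<in> ell2" if "f \<in> ell2" "\<And>x. cmod (g x) \<le> cmod (f x)"
  using that unfolding ell2_def
  by (auto intro: summable_on_comparison_test[where f = "\<lambda>x. (cmod (f x))\<^sup>2"] power_mono)

lemma ell2_norm_mono: "ell2_norm g \<le> ell2_norm f" if "f \<in> ell2" "\<And>x. cmod (g x) \<le> cmod (f x)"
  unfolding ell2_norm_def using that ell2_mono[OF that]
  by (intro real_sqrt_le_mono infsum_mono power_mono) (auto simp: ell2_def)

lemma norm_square_add_le: "(norm (a + b :: 'a :: real_normed_vector))\<^sup>2 \<le> 2 * (norm a)\<^sup>2 + 2 * (norm b)\<^sup>2"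
proof -
  have "(norm (a + b))\<^sup>2 \<le> (norm a + norm b)\<^sup>2"
    by (intro power_mono norm_triangle_ineq) auto
  also have "\<dots> \<le> 2 * (norm a)\<^sup>2 + 2 * (norm b)\<^sup>2"
    using zero_le_power2[of "norm a - norm b"] by (simp add: power2_eq_square algebra_simps)
  finally show ?thesis .
qed

lemma ell2_add: "(\<lambda>x. f x + g x) \<in> ell2" if "f \<in> ell2" "g \<in> ell2"
  unfolding ell2_def
proof (rule CollectI, rule summable_on_comparison_test)
  show "(\<lambda>x. 2 * (cmod (f x))\<^sup>2 + 2 * (cmod (g x))\<^sup>2) summable_on UNIV"
    using that by (intro summable_on_add summable_on_cmult_right) (auto simp: ell2_def)
qed (auto intro: norm_square_add_le)

lemma ell2_zero [simp]: "(\<lambda>x. 0) \<in> ell2"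
  by (simp add: ell2_def)

lemma ell2_uminus: "f \<in> ell2 \<Longrightarrow> (\<lambda>x. - f x) \<in> ell2"
  by (simp add: ell2_def)

lemma ell2_diff: "f \<in> ell2 \<Longrightarrow> g \<in> ell2 \<Longrightarrow> (\<lambda>x. f x - g x) \<in> ell2"
  using ell2_add[OF _ ell2_uminus, of f g] by simp

lemma ell2_sum: "(\<And>i. i \<in> I \<Longrightarrow> f i \<in> ell2) \<Longrightarrow> (\<lambda>x. \<Sum>i\<in>I. f i x) \<in> ell2"
  by (induction I rule: infinite_finite_induct) (auto intro: ell2_add)

lemma ell2_restrict: "f \<in> ell2 \<Longrightarrow> (\<lambda>x. if x \<in> A then f x else 0) \<in> ell2"
  by (erule ell2_mono) auto

lemma ell2_finite_support: "finite A \<Longrightarrow> (\<And>x. x \<notin> A \<Longrightarrow> f x = 0) \<Longrightarrow> f \<in> ell2"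
  unfolding ell2_def
  by (rule CollectI, rule finite_nonzero_values_imp_summable_on, rule finite_subset[of _ A]) auto

lemma ell2_delta [simp]: "delta x \<in> ell2"
  by (rule ell2_finite_support[of "{x}"]) (auto simp: delta_def)

lemma ell2_inner_abs_summable:
  assumes "f \<in> ell2" "g \<in> ell2"
  shows "(\<lambda>x. norm (cnj (f x) * g x)) summable_on UNIV"
proof (rule Infinite_Sum.abs_summable_on_comparison_test')
  show "(\<lambda>x. (cmod (f x))\<^sup>2 + (cmod (g x))\<^sup>2) summable_on UNIV"
    using assms by (intro summable_on_add) (auto simp: ell2_def)
  show "norm (cnj (f x) * g x) \<le> (cmod (f x))\<^sup>2 + (cmod (g x))\<^sup>2" for x
    using zero_le_power2[of "cmod (f x) - cmod (g x)"] mult_nonneg_nonneg[OF norm_ge_zero[of "f x"] norm_ge_zero[of "g x"]]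
    unfolding norm_mult complex_mod_cnj power2_diff mult.assoc by linarith
qed

lemma ell2_inner_summable: "f \<in> ell2 \<Longrightarrow> g \<in> ell2 \<Longrightarrow> (\<lambda>x. cnj (f x) * g x) summable_on UNIV"
  by (rule abs_summable_summable[OF ell2_inner_abs_summable])

lemma ell2_inner_add_right:
  "f \<in> ell2 \<Longrightarrow> g \<in> ell2 \<Longrightarrow> h \<in> ell2 \<Longrightarrow> ell2_inner f (\<lambda>x. g x + h x) = ell2_inner f g + ell2_inner f h"
  unfolding ell2_inner_def by (simp add: distrib_left infsum_add ell2_inner_summable)

lemma ell2_inner_scale_right: "ell2_inner f (\<lambda>x. c * g x) = c * ell2_inner f g"
  unfolding ell2_inner_def by (simp add: mult.left_commute[of _ c] infsum_cmult_right')

lemma ell2_inner_commute: "ell2_inner f g = cnj (ell2_inner g f)"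
  unfolding ell2_inner_def by (simp flip: infsum_cnj add: mult.commute)

lemma ell2_inner_add_left:
  "f \<in> ell2 \<Longrightarrow> g \<in> ell2 \<Longrightarrow> h \<in> ell2 \<Longrightarrow> ell2_inner (\<lambda>x. f x + g x) h = ell2_inner f h + ell2_inner g h"
  by (subst (1 2 3) ell2_inner_commute) (simp add: ell2_inner_add_right)

lemma ell2_inner_scale_left: "ell2_inner (\<lambda>x. c * f x) g = cnj c * ell2_inner f g"
  by (subst ell2_inner_commute, subst (2) ell2_inner_commute) (simp add: ell2_inner_scale_right)

lemma ell2_inner_diff_right:
  "f \<in> ell2 \<Longrightarrow> g \<in> ell2 \<Longrightarrow> h \<in> ell2 \<Longrightarrow> ell2_inner f (\<lambda>x. g x - h x) = ell2_inner f g - ell2_inner f h"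
  using ell2_inner_add_right[of f g "\<lambda>x. -1 * h x"] ell2_inner_scale_right[of f "-1" h] ell2_scale[of h "-1"] by simp

lemma ell2_inner_diff_left:
  "f \<in> ell2 \<Longrightarrow> g \<in> ell2 \<Longrightarrow> h \<in> ell2 \<Longrightarrow> ell2_inner (\<lambda>x. f x - g x) h = ell2_inner f h - ell2_inner g h"
  by (subst (1 2 3) ell2_inner_commute) (simp add: ell2_inner_diff_right)

lemma ell2_inner_zero [simp]: "ell2_inner (\<lambda>x. 0) f = 0" "ell2_inner f (\<lambda>x. 0) = 0"
  by (simp_all add: ell2_inner_def)

lemma ell2_inner_sum_right:
  "f \<in> ell2 \<Longrightarrow> (\<And>i. i \<in> I \<Longrightarrow> g i \<in> ell2) \<Longrightarrow>
    ell2_inner f (\<lambda>x. \<Sum>i\<in>I. g i x) = (\<Sum>i\<in>I. ell2_inner f (g i))"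
  by (induction I rule: infinite_finite_induct) (auto simp: ell2_inner_add_right ell2_sum)

lemma ell2_inner_sum_left:
  "f \<in> ell2 \<Longrightarrow> (\<And>i. i \<in> I \<Longrightarrow> g i \<in> ell2) \<Longrightarrow>
    ell2_inner (\<lambda>x. \<Sum>i\<in>I. g i x) f = (\<Sum>i\<in>I. ell2_inner (g i) f)"
  by (subst (1 2) ell2_inner_commute) (simp add: ell2_inner_sum_right)

lemma ell2_norm_nonneg [simp]: "ell2_norm f \<ge> 0"
  by (simp add: ell2_norm_def infsum_nonneg)

lemma ell2_norm_square: "(ell2_norm f)\<^sup>2 = (\<Sum>\<^sub>\<infinity>x. (cmod (f x))\<^sup>2)"
  by (simp add: ell2_norm_def infsum_nonneg)

lemma ell2_inner_self:
  assumes "f \<in> ell2"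
  shows "ell2_inner f f = complex_of_real ((ell2_norm f)\<^sup>2)"
proof -
  have "cnj (f x) * f x = complex_of_real ((cmod (f x))\<^sup>2)" for x
    by (metis complex_norm_square mult.commute)
  moreover have "((\<lambda>x. complex_of_real ((cmod (f x))\<^sup>2)) has_sum complex_of_real ((ell2_norm f)\<^sup>2)) UNIV"
    unfolding ell2_norm_square using assms by (intro has_sum_of_real has_sum_infsum) (simp add: ell2_def)
  ultimately show ?thesis
    unfolding ell2_inner_def by (simp only: infsumI)
qed

lemma ell2_inner_finite_left:
  assumes "finite X" "\<And>x. x \<notin> X \<Longrightarrow> f x = 0"
  shows "ell2_inner f g = (\<Sum>x\<in>X. cnj (f x) * g x)"
proof -
  have "ell2_inner f g = (\<Sum>\<^sub>\<infinity>x\<in>X. cnj (f x) * g x)"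
    unfolding ell2_inner_def by (rule infsum_cong_neutral) (use assms(2) in auto)
  then show ?thesis using assms(1) by simp
qed

lemma ell2_norm_finite:
  assumes "finite X" "\<And>x. x \<notin> X \<Longrightarrow> f x = 0"
  shows "(ell2_norm f)\<^sup>2 = (\<Sum>x\<in>X. (cmod (f x))\<^sup>2)"
proof -
  have "(ell2_norm f)\<^sup>2 = (\<Sum>\<^sub>\<infinity>x\<in>X. (cmod (f x))\<^sup>2)"
    unfolding ell2_norm_square by (rule infsum_cong_neutral) (use assms(2) in auto)
  then show ?thesis using assms(1) by simp
qed

lemma ell2_inner_delta [simp]: "ell2_inner (delta x) f = f x"
  by (subst ell2_inner_finite_left[of "{x}"]) (auto simp: delta_def)

lemma ell2_inner_delta_right [simp]: "ell2_inner f (delta x) = cnj (f x)"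
  by (subst ell2_inner_commute) simp

lemma ell2_sum_le_norm:
  assumes "f \<in> ell2" "finite X"
  shows "(\<Sum>x\<in>X. (cmod (f x))\<^sup>2) \<le> (ell2_norm f)\<^sup>2"
  unfolding ell2_norm_square using assms by (intro finite_sum_le_infsum) (auto simp: ell2_def)

lemma ell2_cmod_le_norm:
  assumes "f \<in> ell2" shows "cmod (f x) \<le> ell2_norm f"
  by (rule power2_le_imp_le) (use ell2_sum_le_norm[OF assms, of "{x}"] in auto)

lemma ell2_norm_eq_0: "f \<in> ell2 \<Longrightarrow> ell2_norm f = 0 \<Longrightarrow> f x = 0"
  using ell2_cmod_le_norm[of f x] by simp

lemma ell2_norm_scale: "ell2_norm (\<lambda>x. c * f x) = cmod c * ell2_norm f"
  unfolding ell2_norm_def by (simp add: norm_mult power_mult_distrib infsum_cmult_right' real_sqrt_mult)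

lemma ell2_norm_diff_square:
  assumes "f \<in> ell2" "g \<in> ell2"
  shows "(ell2_norm (\<lambda>x. f x - g x))\<^sup>2 = (ell2_norm f)\<^sup>2 - 2 * Re (ell2_inner f g) + (ell2_norm g)\<^sup>2"
proof -
  have "complex_of_real ((ell2_norm (\<lambda>x. f x - g x))\<^sup>2)
      = ell2_inner f f - ell2_inner f g - (ell2_inner g f - ell2_inner g g)"
    using assms ell2_diff[OF assms]
    by (subst ell2_inner_self[symmetric]) (simp_all add: ell2_inner_diff_left ell2_inner_diff_right)
  also have "ell2_inner g f = cnj (ell2_inner f g)" by (rule ell2_inner_commute)
  finally have "complex_of_real ((ell2_norm (\<lambda>x. f x - g x))\<^sup>2)
      = complex_of_real ((ell2_norm f)\<^sup>2) - ell2_inner f g - cnj (ell2_inner f g) + complex_of_real ((ell2_norm g)\<^sup>2)"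
    using assms by (simp add: ell2_inner_self)
  from arg_cong[OF this, of Re] show ?thesis by simp
qed

lemma ell2_Cauchy_Schwarz:
  assumes "f \<in> ell2" "g \<in> ell2"
  shows "cmod (ell2_inner f g) \<le> ell2_norm f * ell2_norm g"
proof (cases "ell2_norm g = 0")
  case True
  then have "g = (\<lambda>x. 0)" using assms by (auto intro: ell2_norm_eq_0)
  then show ?thesis by simp
next
  case False
  define n where "n = (ell2_norm g)\<^sup>2"
  define i where "i = ell2_inner f g"
  define c where "c = cnj i / complex_of_real n"
  have n: "n > 0" using False by (simp add: n_def)
  have "0 \<le> (ell2_norm (\<lambda>x. f x - c * g x))\<^sup>2" by simp
  also have "\<dots> = (ell2_norm f)\<^sup>2 - 2 * Re (c * i) + (cmod c * ell2_norm g)\<^sup>2"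
    unfolding ell2_norm_diff_square[OF assms(1) ell2_scale[OF assms(2)]] ell2_inner_scale_right ell2_norm_scale i_def ..
  also have "c * i = complex_of_real ((cmod i)\<^sup>2 / n)"
    unfolding c_def of_real_divide complex_norm_square by simp
  also have "(cmod c * ell2_norm g)\<^sup>2 = (cmod i)\<^sup>2 / n"
    using n by (simp add: c_def norm_divide power_mult_distrib power_divide n_def[symmetric] power2_eq_square[of n])
  finally have "(cmod i)\<^sup>2 / n \<le> (ell2_norm f)\<^sup>2" by simp
  then have "(cmod i)\<^sup>2 \<le> (ell2_norm f * ell2_norm g)\<^sup>2"
    using n by (simp add: pos_divide_le_eq power_mult_distrib n_def)
  then show ?thesis unfolding i_def by (rule power2_le_imp_le) simp
qed

lemma ell2_inner_uminus_left [simp]: "ell2_inner (\<lambda>x. - f x) g = - ell2_inner f g"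
  by (simp add: ell2_inner_def infsum_uminus)

text \<open>Closes duality arguments: once a squared norm is bounded by the norm times
  \<open>m\<close>, one factor cancels.\<close>

lemma square_le_if_le_mult:
  fixes n m S :: real
  assumes "n\<^sup>2 = S" "S \<le> n * m" "n \<ge> 0" "m \<ge> 0"
  shows "S \<le> m\<^sup>2"
proof (cases "n = 0")
  case False
  then have "n * n \<le> n * m" "n > 0" using assms by (auto simp: power2_eq_square)
  then have "n \<le> m" by simp
  then show ?thesis using assms by (auto intro: power_mono)
qed (use assms in auto)

lemma ell2_boundedI:
  assumes "\<And>X. finite X \<Longrightarrow> (\<Sum>x\<in>X. (cmod (f x))\<^sup>2) \<le> B\<^sup>2" and "B \<ge> 0"
  shows "f \<in> ell2" and "ell2_norm f \<le> B"
proof -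
  have *: "(\<lambda>x. (cmod (f x))\<^sup>2) summable_on UNIV"
    using assms(1) by (intro nonneg_bdd_above_summable_on) (auto intro!: bdd_aboveI[of _ "B\<^sup>2"])
  then show "f \<in> ell2" by (simp add: ell2_def)
  have "(ell2_norm f)\<^sup>2 \<le> B\<^sup>2"
    unfolding ell2_norm_square using assms(1) by (intro infsum_le_finite_sums *) auto
  then show "ell2_norm f \<le> B" using assms(2) by (rule power2_le_imp_le)
qed

text \<open>Together with \<open>eq_0_if_le_epsilon\<close> this extends identities from finitely
  supported functions to all of \<open>ell2\<close>.\<close>

lemma ell2_truncate:
  assumes "f \<in> ell2" "\<epsilon> > 0"
  shows "\<exists>X. finite X \<and> ell2_norm (\<lambda>x. f x - (if x \<in> X then f x else 0)) \<le> \<epsilon>"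
proof -
  have "((\<lambda>x. (cmod (f x))\<^sup>2) has_sum (ell2_norm f)\<^sup>2) UNIV"
    using assms by (simp add: ell2_def ell2_norm_square)
  from has_sum_finite_approximation[OF this, of "\<epsilon>\<^sup>2"] assms(2) obtain X where
    X: "finite X" "\<bar>(\<Sum>x\<in>X. (cmod (f x))\<^sup>2) - (ell2_norm f)\<^sup>2\<bar> \<le> \<epsilon>\<^sup>2"
    by (auto simp: dist_real_def)
  let ?g = "\<lambda>x. if x \<in> X then f x else 0"
  have "(ell2_norm ?g)\<^sup>2 = (\<Sum>x\<in>X. (cmod (f x))\<^sup>2)"
    by (subst ell2_norm_finite[OF X(1)]) auto
  moreover have "ell2_inner f ?g = complex_of_real (\<Sum>x\<in>X. (cmod (f x))\<^sup>2)"
    by (subst ell2_inner_commute, subst ell2_inner_finite_left[OF X(1)])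
      (auto simp: complex_norm_square mult.commute intro!: sum.cong simp flip: of_real_power)
  ultimately have "(ell2_norm (\<lambda>x. f x - ?g x))\<^sup>2 \<le> \<epsilon>\<^sup>2"
    using assms(1) X(2) by (subst ell2_norm_diff_square) (auto intro: ell2_restrict)
  then have "ell2_norm (\<lambda>x. f x - ?g x) \<le> \<epsilon>"
    by (rule power2_le_imp_le) (use assms(2) in simp)
  then show ?thesis using X(1) by blast
qed

lemma eq_0_if_le_epsilon:
  fixes c :: complex and B :: real
  assumes *: "\<And>\<epsilon>. \<epsilon> > 0 \<Longrightarrow> cmod c \<le> \<epsilon> * B"
  shows "c = 0"
proof -
  have "cmod c \<le> 0 + e" if "e > 0" for e
  proof -
    have B: "\<bar>B\<bar> + 1 > 0" by simp
    have "cmod c \<le> e / (\<bar>B\<bar> + 1) * B"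
      by (rule *) (use that B in simp)
    also have "\<dots> \<le> e / (\<bar>B\<bar> + 1) * (\<bar>B\<bar> + 1)"
      by (rule mult_left_mono) (use that B in auto)
    also have "\<dots> = e" using B by simp
    finally show ?thesis by simp
  qed
  then have "cmod c \<le> 0" by (rule field_le_epsilon)
  then show ?thesis by simp
qed

section \<open>Orthonormal families, Bessel and Parseval\<close>

locale orthonormal_family =
  fixes \<phi> :: "'i \<Rightarrow> 'v \<Rightarrow> complex" and \<Lambda> :: "'i set"
  assumes ell2_family [simp]: "\<And>e. \<phi> e \<in> ell2"
    and orthonormal: "\<And>e e'. e \<in> \<Lambda> \<Longrightarrow> e' \<in> \<Lambda> \<Longrightarrow> ell2_inner (\<phi> e) (\<phi> e') = (if e = e' then 1 else 0)"
    and family_zero: "\<And>e. e \<notin> \<Lambda> \<Longrightarrow> \<phi> e = (\<lambda>x. 0)"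
begin

text \<open>Vectors with index outside \<Lambda> are zero, so coefficients exist on the whole index
  type and coefficient sequences live in \<open>ell2\<close> over that type, with all its
  lemmas.\<close>

definition coef :: "('v \<Rightarrow> complex) \<Rightarrow> 'i \<Rightarrow> complex" where
  "coef f e = ell2_inner (\<phi> e) f"

lemma coef_family: "coef (\<phi> e) = (if e \<in> \<Lambda> then delta e else (\<lambda>x. 0))"
proof
  fix e' show "coef (\<phi> e) e' = (if e \<in> \<Lambda> then delta e else (\<lambda>x. 0)) e'"
    by (cases "e \<in> \<Lambda>"; cases "e' \<in> \<Lambda>") (auto simp: coef_def orthonormal family_zero delta_def)
qed

lemma coef_delta: "coef (delta x) e = cnj (\<phi> e x)"
  by (simp add: coef_def)

lemma Bessel_finite:
  assumes f: "f \<in> ell2" and F: "finite F"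
  shows "(\<Sum>e\<in>F. (cmod (coef f e))\<^sup>2) \<le> (ell2_norm f)\<^sup>2"
proof -
  define S where "S = (\<Sum>e\<in>F. (cmod (coef f e))\<^sup>2)"
  let ?g = "\<lambda>x. \<Sum>e\<in>F. coef f e * \<phi> e x"
  have g: "?g \<in> ell2" by (auto intro!: ell2_sum ell2_scale)
  have sq: "cnj (coef f e) * coef f e = complex_of_real ((cmod (coef f e))\<^sup>2)" for e
    by (metis complex_norm_square mult.commute)
  have "ell2_inner ?g f = (\<Sum>e\<in>F. cnj (coef f e) * coef f e)"
    using f by (subst ell2_inner_sum_left) (auto simp: ell2_scale ell2_inner_scale_left coef_def)
  then have 1: "ell2_inner ?g f = complex_of_real S" by (simp only: sq S_def of_real_sum)
  have "ell2_inner (\<phi> e) ?g = coef f e" if "e \<in> F" for e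
  proof -
    have "ell2_inner (\<phi> e) ?g = (\<Sum>e'\<in>F. coef f e' * ell2_inner (\<phi> e) (\<phi> e'))"
      by (subst ell2_inner_sum_right) (auto simp: ell2_scale ell2_inner_scale_right)
    also have "\<dots> = (\<Sum>e'\<in>F. if e' = e then coef f e else 0)"
    proof (intro sum.cong refl)
      fix e' show "coef f e' * ell2_inner (\<phi> e) (\<phi> e') = (if e' = e then coef f e else 0)"
        by (cases "e \<in> \<Lambda>"; cases "e' \<in> \<Lambda>") (auto simp: orthonormal family_zero coef_def)
    qed
    finally show ?thesis using that F by simp
  qed
  then have "ell2_inner ?g ?g = (\<Sum>e\<in>F. cnj (coef f e) * coef f e)"
    using g by (subst ell2_inner_sum_left) (auto simp: ell2_scale ell2_inner_scale_left)
  then have "complex_of_real ((ell2_norm ?g)\<^sup>2) = complex_of_real S"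
    using g by (simp only: sq S_def of_real_sum ell2_inner_self)
  then have 2: "(ell2_norm ?g)\<^sup>2 = S" by (simp only: of_real_eq_iff)
  have S0: "S \<ge> 0" unfolding S_def by (simp add: sum_nonneg)
  have "S \<le> ell2_norm ?g * ell2_norm f"
    using ell2_Cauchy_Schwarz[OF g f] 1 S0 by simp
  with 2 have "S \<le> (ell2_norm f)\<^sup>2" by (rule square_le_if_le_mult) auto
  then show ?thesis by (simp add: S_def)
qed

lemma coef_ell2 [simp]: "f \<in> ell2 \<Longrightarrow> coef f \<in> ell2"
  by (rule ell2_boundedI[of _ "ell2_norm f"]) (auto intro: Bessel_finite)

lemma coef_norm_le: "f \<in> ell2 \<Longrightarrow> ell2_norm (coef f) \<le> ell2_norm f"
  by (rule ell2_boundedI) (auto intro: Bessel_finite)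

text \<open>The sum of the vectors \<open>c e * \<phi> e\<close>, that is, the adjoint of
  \<open>coef\<close>. Giving it pointwise as an inner product of coefficient sequences avoids
  convergence of a series of functions.\<close>

definition synth :: "('i \<Rightarrow> complex) \<Rightarrow> 'v \<Rightarrow> complex" where
  "synth c x = ell2_inner (coef (delta x)) c"

lemma coef_add: "f \<in> ell2 \<Longrightarrow> g \<in> ell2 \<Longrightarrow> coef (\<lambda>x. f x + g x) = (\<lambda>e. coef f e + coef g e)"
  unfolding coef_def by (intro ext ell2_inner_add_right) auto

lemma coef_diff: "f \<in> ell2 \<Longrightarrow> g \<in> ell2 \<Longrightarrow> coef (\<lambda>x. f x - g x) = (\<lambda>e. coef f e - coef g e)"
  unfolding coef_def by (intro ext ell2_inner_diff_right) auto

lemma coef_scale: "coef (\<lambda>x. c * f x) = (\<lambda>e. c * coef f e)"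
  unfolding coef_def by (intro ext ell2_inner_scale_right)

lemma inner_synth_finite:
  assumes X: "finite X" "\<And>x. x \<notin> X \<Longrightarrow> g x = 0" and c: "c \<in> ell2"
  shows "ell2_inner g (synth c) = ell2_inner (coef g) c"
proof -
  have g: "g = (\<lambda>y. \<Sum>x\<in>X. g x * delta x y)"
  proof
    fix y
    have "(\<Sum>x\<in>X. g x * delta x y) = (\<Sum>x\<in>X. if x = y then g y else 0)"
      by (intro sum.cong) (auto simp: delta_def)
    then show "g y = (\<Sum>x\<in>X. g x * delta x y)" using X by simp
  qed
  have "coef g = (\<lambda>e. \<Sum>x\<in>X. g x * coef (delta x) e)"
    unfolding coef_def by (subst g, subst ell2_inner_sum_right) (auto simp: ell2_scale ell2_inner_scale_right)
  then have "ell2_inner (coef g) c = (\<Sum>x\<in>X. cnj (g x) * ell2_inner (coef (delta x)) c)"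
    using c by (simp add: ell2_inner_sum_left ell2_scale ell2_inner_scale_left)
  then show ?thesis
    using X by (simp add: ell2_inner_finite_left synth_def)
qed

text \<open>Boundedness by duality: pair \<open>synth c\<close> with its own truncation and apply
  Bessel to the truncation.\<close>

lemma synth_finite_bound:
  assumes c: "c \<in> ell2" and X: "finite X"
  shows "(\<Sum>x\<in>X. (cmod (synth c x))\<^sup>2) \<le> (ell2_norm c)\<^sup>2"
proof -
  define S where "S = (\<Sum>x\<in>X. (cmod (synth c x))\<^sup>2)"
  let ?g = "\<lambda>x. if x \<in> X then synth c x else 0"
  have g: "?g \<in> ell2" using X by (rule ell2_finite_support) auto
  have S0: "S \<ge> 0" by (simp add: S_def sum_nonneg)
  have N: "(ell2_norm ?g)\<^sup>2 = S" unfolding S_def by (subst ell2_norm_finite[OF X]) auto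
  have "ell2_inner ?g (synth c) = complex_of_real S"
    unfolding S_def by (subst ell2_inner_finite_left[OF X])
      (auto simp: complex_norm_square mult.commute intro!: sum.cong simp flip: of_real_power)
  moreover have "ell2_inner ?g (synth c) = ell2_inner (coef ?g) c"
    using X c by (intro inner_synth_finite) auto
  ultimately have "S \<le> ell2_norm (coef ?g) * ell2_norm c"
    using ell2_Cauchy_Schwarz[OF coef_ell2[OF g] c] S0 by simp
  also have "\<dots> \<le> ell2_norm ?g * ell2_norm c"
    using g by (intro mult_right_mono coef_norm_le) auto
  finally have "S \<le> ell2_norm ?g * ell2_norm c" .
  with N have "S \<le> (ell2_norm c)\<^sup>2" by (rule square_le_if_le_mult) auto
  then show ?thesis by (simp add: S_def)
qed

lemma synth_ell2 [simp]: "c \<in> ell2 \<Longrightarrow> synth c \<in> ell2"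
  by (rule ell2_boundedI[of _ "ell2_norm c"]) (auto intro: synth_finite_bound)

lemma synth_norm_le: "c \<in> ell2 \<Longrightarrow> ell2_norm (synth c) \<le> ell2_norm c"
  by (rule ell2_boundedI) (auto intro: synth_finite_bound)

lemma inner_synth:
  assumes f: "f \<in> ell2" and c: "c \<in> ell2"
  shows "ell2_inner f (synth c) = ell2_inner (coef f) c"
proof -
  have "ell2_inner f (synth c) - ell2_inner (coef f) c = 0"
  proof (rule eq_0_if_le_epsilon)
    fix \<epsilon> :: real assume "\<epsilon> > 0"
    from ell2_truncate[OF f this] obtain X where X: "finite X"
      "ell2_norm (\<lambda>x. f x - (if x \<in> X then f x else 0)) \<le> \<epsilon>" by blast
    let ?g = "\<lambda>x. if x \<in> X then f x else 0"
    let ?d = "\<lambda>x. f x - ?g x"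
    have g: "?g \<in> ell2" and d: "?d \<in> ell2" using f by (auto intro: ell2_restrict ell2_diff)
    have "ell2_inner ?g (synth c) = ell2_inner (coef ?g) c"
      using X c by (intro inner_synth_finite) auto
    then have "ell2_inner f (synth c) - ell2_inner (coef f) c = ell2_inner ?d (synth c) - ell2_inner (coef ?d) c"
      using f g c by (simp add: ell2_inner_diff_left coef_diff)
    then have "cmod (ell2_inner f (synth c) - ell2_inner (coef f) c) = cmod (ell2_inner ?d (synth c) - ell2_inner (coef ?d) c)"
      by (rule arg_cong)
    also have "\<dots> \<le> cmod (ell2_inner ?d (synth c)) + cmod (ell2_inner (coef ?d) c)"
      by (rule norm_triangle_ineq4)
    also have "\<dots> \<le> ell2_norm ?d * ell2_norm (synth c) + ell2_norm (coef ?d) * ell2_norm c"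
      using d c by (intro add_mono ell2_Cauchy_Schwarz) auto
    also have "\<dots> \<le> \<epsilon> * ell2_norm c + \<epsilon> * ell2_norm c"
      using X(2) d c coef_norm_le[OF d] \<open>\<epsilon> > 0\<close> by (intro add_mono mult_mono synth_norm_le) auto
    finally show "cmod (ell2_inner f (synth c) - ell2_inner (coef f) c) \<le> \<epsilon> * (2 * ell2_norm c)" by simp
  qed
  then show ?thesis by simp
qed

lemma coef_synth: "c \<in> ell2 \<Longrightarrow> e \<in> \<Lambda> \<Longrightarrow> coef (synth c) e = c e"
  by (subst coef_def, subst inner_synth) (auto simp: coef_family)

lemma coef_outside: "e \<notin> \<Lambda> \<Longrightarrow> coef f e = 0"
  by (simp add: coef_def family_zero)

end

locale orthonormal_basis = orthonormal_family +
  assumes total: "\<And>x \<epsilon>. \<epsilon> > 0 \<Longrightarrow> \<exists>F c. finite F \<and> ell2_norm (\<lambda>y. delta x y - (\<Sum>e\<in>F. c e * \<phi> e y)) \<le> \<epsilon>"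
begin

text \<open>Approximating the unit vectors is enough: \<open>f x\<close> is the inner product of
  \<open>delta x\<close> with \<open>f\<close>, and the approximating combination is orthogonal to
  \<open>f\<close>.\<close>

lemma coef_eq_0:
  assumes f: "f \<in> ell2" and 0: "\<And>e. e \<in> \<Lambda> \<Longrightarrow> coef f e = 0"
  shows "f x = 0"
proof (rule eq_0_if_le_epsilon)
  fix \<epsilon> :: real assume "\<epsilon> > 0"
  from total[OF this] obtain F c where F: "finite F"
    "ell2_norm (\<lambda>y. delta x y - (\<Sum>e\<in>F. c e * \<phi> e y)) \<le> \<epsilon>" by blast
  let ?s = "\<lambda>y. \<Sum>e\<in>F. c e * \<phi> e y"
  have s: "?s \<in> ell2" by (auto intro!: ell2_sum ell2_scale)
  have "coef f e = 0" for e using 0 coef_outside[of e f] by (cases "e \<in> \<Lambda>") auto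
  then have "ell2_inner ?s f = 0"
    using f by (subst ell2_inner_sum_left) (auto simp: ell2_scale ell2_inner_scale_left coef_def)
  then have "f x = ell2_inner (\<lambda>y. delta x y - ?s y) f"
    using f s by (simp add: ell2_inner_diff_left)
  then have "cmod (f x) = cmod (ell2_inner (\<lambda>y. delta x y - ?s y) f)"
    by (rule arg_cong)
  also have "\<dots> \<le> ell2_norm (\<lambda>y. delta x y - ?s y) * ell2_norm f"
    using f s by (intro ell2_Cauchy_Schwarz ell2_diff) auto
  also have "\<dots> \<le> \<epsilon> * ell2_norm f" using F by (intro mult_right_mono) auto
  finally show "cmod (f x) \<le> \<epsilon> * ell2_norm f" .
qed

lemma synth_coef:
  assumes "f \<in> ell2" shows "synth (coef f) = f"
proof
  fix x
  have "f x - synth (coef f) x = 0"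
    using assms by (intro coef_eq_0[where f = "\<lambda>x. f x - synth (coef f) x"])
      (auto intro!: ell2_diff simp: coef_diff coef_synth)
  then show "synth (coef f) x = f x" by simp
qed

lemma Parseval: "f \<in> ell2 \<Longrightarrow> g \<in> ell2 \<Longrightarrow> ell2_inner f g = ell2_inner (coef f) (coef g)"
  using inner_synth[of f "coef g"] by (simp add: synth_coef)

end

section \<open>Operators with an orthonormal basis of eigenvectors\<close>

locale pvm =
  fixes E :: "real set \<Rightarrow> ('v \<Rightarrow> complex) \<Rightarrow> ('v \<Rightarrow> complex)"
  assumes pvm: "projection_valued_measure E"
begin

lemma proj: "B \<in> sets borel \<Longrightarrow> orthogonal_projection (E B)"
  using pvm by (auto simp: projection_valued_measure_def)

lemma E_ell2 [simp]: "B \<in> sets borel \<Longrightarrow> f \<in> ell2 \<Longrightarrow> E B f \<in> ell2"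
  using proj[of B] by (auto simp: orthogonal_projection_def)

lemma E_idem: "B \<in> sets borel \<Longrightarrow> f \<in> ell2 \<Longrightarrow> E B (E B f) = E B f"
  using proj[of B] by (auto simp: orthogonal_projection_def)

lemma E_selfadjoint: "B \<in> sets borel \<Longrightarrow> f \<in> ell2 \<Longrightarrow> g \<in> ell2 \<Longrightarrow> ell2_inner f (E B g) = ell2_inner (E B f) g"
  using proj[of B] by (auto simp: orthogonal_projection_def)

lemma E_empty: "f \<in> ell2 \<Longrightarrow> E {} f = (\<lambda>x. 0)"
  using pvm by (auto simp: projection_valued_measure_def)

lemma E_UNIV: "f \<in> ell2 \<Longrightarrow> E UNIV f = f"
  using pvm by (auto simp: projection_valued_measure_def)

lemma E_inter: "A \<in> sets borel \<Longrightarrow> B \<in> sets borel \<Longrightarrow> f \<in> ell2 \<Longrightarrow> E A (E B f) = E (A \<inter> B) f"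
  using pvm by (auto simp: projection_valued_measure_def)

lemma E_union: "range A \<subseteq> sets borel \<Longrightarrow> disjoint_family A \<Longrightarrow> f \<in> ell2 \<Longrightarrow>
    (\<lambda>n. ell2_norm (\<lambda>x. E (\<Union>i. A i) f x - (\<Sum>i<n. E (A i) f x))) \<longlonglongrightarrow> 0" for A :: "nat \<Rightarrow> real set"
  using pvm by (auto simp: projection_valued_measure_def)

lemma E_form: "B \<in> sets borel \<Longrightarrow> f \<in> ell2 \<Longrightarrow> ell2_inner f (E B f) = complex_of_real ((ell2_norm (E B f))\<^sup>2)"
  by (metis E_ell2 E_idem E_selfadjoint ell2_inner_self)

lemma E_compl:
  assumes B: "B \<in> sets borel" and f: "f \<in> ell2"
  shows "E (- B) f = (\<lambda>x. f x - E B f x)"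
proof -
  \<comment> \<open>Additivity is given for sequences, so the pair \<open>B\<close>,
    \<open>- B\<close> is continued by empty sets.\<close>
  define A where "A = (\<lambda>i::nat. if i = 0 then B else if i = 1 then - B else {})"
  have ran: "range A \<subseteq> sets borel" using B by (auto simp: A_def)
  have disj: "disjoint_family A" by (auto simp: A_def disjoint_family_on_def)
  have un: "(\<Union>i. A i) = UNIV" unfolding A_def by (auto split: if_splits)
  let ?g = "\<lambda>x. f x - (E B f x + E (- B) f x)"
  have "(\<Sum>i<n. E (A i) f x) = E B f x + E (- B) f x" if "n \<ge> 2" for n x
  proof -
    have "(\<Sum>i<n. E (A i) f x) = (\<Sum>i<2. E (A i) f x)"
      using that by (intro sum.mono_neutral_right) (auto simp: A_def E_empty[OF f])
    then show ?thesis by (simp add: A_def numeral_2_eq_2)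
  qed
  then have "eventually (\<lambda>n. ell2_norm (\<lambda>x. E (\<Union>i. A i) f x - (\<Sum>i<n. E (A i) f x)) = ell2_norm ?g) sequentially"
    unfolding eventually_sequentially un by (intro exI[of _ 2]) (simp add: E_UNIV[OF f])
  with E_union[OF ran disj f] have "(\<lambda>n. ell2_norm ?g) \<longlonglongrightarrow> 0"
    by (rule Lim_transform_eventually)
  then have "ell2_norm ?g = 0" by (simp add: LIMSEQ_const_iff)
  moreover have "?g \<in> ell2" using f B by (intro ell2_diff ell2_add) auto
  ultimately have "?g x = 0" for x by (rule ell2_norm_eq_0[rotated])
  then have "f x = E B f x + E (- B) f x" for x by simp
  then show ?thesis by (simp add: fun_eq_iff)
qed

lemma sets_spectral [simp, measurable_cong]: "sets (spectral_measure E f) = sets borel"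
  by (simp add: spectral_measure_def sigma_algebra.sigma_sets_eq[OF sets.sigma_algebra_axioms[of borel], simplified])

lemma space_spectral [simp]: "space (spectral_measure E f) = UNIV"
  by (simp add: spectral_measure_def)

text \<open>Strong convergence of the partial sums gives, by Cauchy-Schwarz, convergence of the
  quadratic form, which is the countable additivity that \<open>measure_of\<close> requires.\<close>

lemma emeasure_spectral:
  assumes f: "f \<in> ell2" and B: "B \<in> sets borel"
  shows "emeasure (spectral_measure E f) B = ennreal ((ell2_norm (E B f))\<^sup>2)"
proof -
  have Re: "Re (ell2_inner f (E B f)) = (ell2_norm (E B f))\<^sup>2" if "B \<in> sets borel" for B
    using E_form[OF that f] by simp
  have "emeasure (spectral_measure E f) B = ennreal (Re (ell2_inner f (E B f)))"
  proof (rule emeasure_measure_of[OF spectral_measure_def])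
    show "sets borel \<subseteq> Pow UNIV" by simp
    show "positive (sets (spectral_measure E f)) (\<lambda>B. ennreal (Re (ell2_inner f (E B f))))"
      by (simp add: positive_def E_empty[OF f])
    show "countably_additive (sets (spectral_measure E f)) (\<lambda>B. ennreal (Re (ell2_inner f (E B f))))"
      unfolding countably_additive_def sets_spectral
    proof (intro allI impI)
      fix A :: "nat \<Rightarrow> real set"
      assume A: "range A \<subseteq> sets borel" "disjoint_family A" "(\<Union>i. A i) \<in> sets borel"
      let ?s = "\<lambda>n x. \<Sum>i<n. E (A i) f x" and ?u = "E (\<Union>i. A i) f"
      have s: "?s n \<in> ell2" for n using A f by (auto intro!: ell2_sum)
      have u: "?u \<in> ell2" using A f by auto
      have "(\<lambda>n. cmod (ell2_inner f ?u - (\<Sum>i<n. ell2_inner f (E (A i) f)))) \<longlonglongrightarrow> 0"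
      proof (rule Lim_null_comparison)
        show "(\<lambda>n. ell2_norm f * ell2_norm (\<lambda>x. ?u x - ?s n x)) \<longlonglongrightarrow> 0"
          using E_union[OF A(1,2) f] by (auto intro: tendsto_mult_right_zero)
        show "\<forall>\<^sub>F n in sequentially. norm (cmod (ell2_inner f ?u - (\<Sum>i<n. ell2_inner f (E (A i) f))))
           \<le> ell2_norm f * ell2_norm (\<lambda>x. ?u x - ?s n x)"
        proof (intro always_eventually allI)
          fix n
          have "ell2_inner f (\<lambda>x. ?u x - ?s n x) = ell2_inner f ?u - ell2_inner f (?s n)"
            using f u s by (intro ell2_inner_diff_right)
          also have "ell2_inner f (?s n) = (\<Sum>i<n. ell2_inner f (E (A i) f))"
            using f A by (intro ell2_inner_sum_right) auto
          finally show "norm (cmod (ell2_inner f ?u - (\<Sum>i<n. ell2_inner f (E (A i) f))))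
             \<le> ell2_norm f * ell2_norm (\<lambda>x. ?u x - ?s n x)"
            using ell2_Cauchy_Schwarz[OF f ell2_diff[OF u s], of n] by simp
        qed
      qed
      then have "(\<lambda>n. \<Sum>i<n. ell2_inner f (E (A i) f)) \<longlonglongrightarrow> ell2_inner f ?u"
        unfolding tendsto_norm_zero_iff using LIM_zero_cancel tendsto_minus by fastforce
      from tendsto_Re[OF this] have "(\<lambda>i. Re (ell2_inner f (E (A i) f))) sums Re (ell2_inner f ?u)"
        by (simp add: sums_def)
      then show "(\<Sum>i. ennreal (Re (ell2_inner f (E (A i) f)))) = ennreal (Re (ell2_inner f ?u))"
        using A by (intro suminf_ennreal_eq) (auto simp: Re)
    qed
  qed (use B in simp)
  then show ?thesis using Re[OF B] by simp
qed

lemma finite_spectral: "f \<in> ell2 \<Longrightarrow> finite_measure (spectral_measure E f)"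
  by (rule finite_measureI) (simp add: emeasure_spectral)

lemma spectral_restrict:
  assumes f: "f \<in> ell2" and B: "B \<in> sets borel"
  shows "spectral_measure E (E B f) = density (spectral_measure E f) (indicator B)"
proof (rule measure_eqI)
  fix A assume "A \<in> sets (spectral_measure E (E B f))"
  then have A: "A \<in> sets borel" by simp
  have "emeasure (density (spectral_measure E f) (indicator B)) A = emeasure (spectral_measure E f) (A \<inter> B)"
    using A B by (subst emeasure_density) (auto simp flip: indicator_inter_arith simp: Int_commute)
  then show "emeasure (spectral_measure E (E B f)) A = emeasure (density (spectral_measure E f) (indicator B)) A"
    using A B f by (simp add: emeasure_spectral E_inter)
qed simp

end

text \<open>The infinite sum is the supremum over finite subsets, and along an enumeration of
  \<open>B \<inter> L\<close> finite subsets exhaust the mass by continuity from below.\<close>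

lemma pure_point_measureI:
  fixes \<mu> :: "real measure"
  assumes sets: "sets \<mu> = sets borel" and L: "countable L" "emeasure \<mu> (- L) = 0"
  shows "pure_point_measure \<mu>"
  unfolding pure_point_measure_def
proof
  fix B assume B: "B \<in> sets \<mu>"
  have Bb: "B \<in> sets borel" using B sets by simp
  have single: "{x} \<in> sets \<mu>" for x using sets by simp
  have cnt: "C \<in> sets \<mu>" if "countable C" for C
    using that by (rule sets.countable[rotated]) (rule single)
  have fin: "(\<Sum>x\<in>F. emeasure \<mu> {x}) = emeasure \<mu> F" if "finite F" for F
    using that by (intro emeasure_eq_sum_singleton[symmetric]) (auto intro: single)
  have sup: "(\<Sum>\<^sub>\<infinity>x\<in>B. emeasure \<mu> {x}) = (SUP F\<in>{F. finite F \<and> F \<subseteq> B}. emeasure \<mu> F)"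
    by (subst nonneg_infsum_complete) (auto simp: fin intro!: SUP_cong)
  have eq: "emeasure \<mu> B = emeasure \<mu> (B \<inter> L)"
  proof -
    have "emeasure \<mu> B = emeasure \<mu> (B \<inter> L) + emeasure \<mu> (B - L)"
      using Bb cnt[OF L(1)] B sets by (subst plus_emeasure) (auto intro!: arg_cong[of _ _ "emeasure \<mu>"])
    moreover have "emeasure \<mu> (B - L) \<le> emeasure \<mu> (- L)"
      using cnt[OF L(1)] sets by (intro emeasure_mono) (auto simp: borel_comp)
    ultimately show ?thesis using L(2) by simp
  qed
  show "emeasure \<mu> B = (\<Sum>\<^sub>\<infinity>x\<in>B. emeasure \<mu> {x})"
  proof (rule antisym)
    show "(\<Sum>\<^sub>\<infinity>x\<in>B. emeasure \<mu> {x}) \<le> emeasure \<mu> B"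
      unfolding sup using B by (auto intro!: SUP_least emeasure_mono)
    show "emeasure \<mu> B \<le> (\<Sum>\<^sub>\<infinity>x\<in>B. emeasure \<mu> {x})"
    proof (cases "B \<inter> L = {}")
      case True then show ?thesis by (simp add: eq)
    next
      case False
      have c: "countable (B \<inter> L)" using L by auto
      define F where "F n = from_nat_into (B \<inter> L) ` {..<n::nat}" for n
      have Fs: "F n \<subseteq> B \<inter> L" for n using from_nat_into[OF False] by (auto simp: F_def)
      have U: "(\<Union>n. F n) = B \<inter> L"
      proof
        show "B \<inter> L \<subseteq> (\<Union>n. F n)"
        proof
          fix x assume "x \<in> B \<inter> L"
          then obtain n where "x = from_nat_into (B \<inter> L) n" using from_nat_into_surj[OF c] by metis
          then show "x \<in> (\<Union>n. F n)" by (auto simp: F_def intro!: exI[of _ "Suc n"])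
        qed
      qed (use Fs in blast)
      have "(SUP n. emeasure \<mu> (F n)) = emeasure \<mu> (\<Union>n. F n)"
        by (rule SUP_emeasure_incseq) (auto simp: F_def incseq_def intro!: cnt countable_finite)
      then have "emeasure \<mu> B = (SUP n. emeasure \<mu> (F n))" by (simp add: U eq)
      also have "\<dots> \<le> (\<Sum>\<^sub>\<infinity>x\<in>B. emeasure \<mu> {x})"
        unfolding sup using Fs by (auto intro!: SUP_least SUP_upper simp: F_def)
      finally show ?thesis .
    qed
  qed
qed

section \<open>Spectral resolution from a basis of eigenvectors\<close>

locale eigen_operator = orthonormal_basis \<phi> \<Lambda>
  for \<phi> :: "real \<Rightarrow> 'v \<Rightarrow> complex" and \<Lambda> :: "real set" +
  fixes D :: "('v \<Rightarrow> complex) set" and T :: "('v \<Rightarrow> complex) \<Rightarrow> ('v \<Rightarrow> complex)"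
  assumes D_ell2: "f \<in> D \<Longrightarrow> f \<in> ell2"
    and T_ell2: "f \<in> D \<Longrightarrow> T f \<in> ell2"
    and D_diff: "f \<in> D \<Longrightarrow> g \<in> D \<Longrightarrow> (\<lambda>x. f x - g x) \<in> D"
    and T_diff: "f \<in> D \<Longrightarrow> g \<in> D \<Longrightarrow> T (\<lambda>x. f x - g x) = (\<lambda>x. T f x - T g x)"
    and symmetric: "f \<in> D \<Longrightarrow> g \<in> D \<Longrightarrow> ell2_inner f (T g) = ell2_inner (T f) g"
    and eig_D: "e \<in> \<Lambda> \<Longrightarrow> \<phi> e \<in> D"
    and eig: "e \<in> \<Lambda> \<Longrightarrow> T (\<phi> e) = (\<lambda>x. complex_of_real e * \<phi> e x)"
    and delta_D: "delta x \<in> D"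
    and maximal: "f \<in> ell2 \<Longrightarrow> g \<in> ell2 \<Longrightarrow> (\<And>x. ell2_inner (T (delta x)) f = g x) \<Longrightarrow> f \<in> D"
    and countable_eig: "countable \<Lambda>"
begin

definition spec :: "real set \<Rightarrow> ('v \<Rightarrow> complex) \<Rightarrow> 'v \<Rightarrow> complex" where
  "spec B f = synth (\<lambda>e. if e \<in> B then coef f e else 0)"

lemma coef_spec: "f \<in> ell2 \<Longrightarrow> coef (spec B f) = (\<lambda>e. if e \<in> B then coef f e else 0)"
proof
  fix e assume f: "f \<in> ell2"
  then have "(\<lambda>e. if e \<in> B then coef f e else 0) \<in> ell2" by (intro ell2_restrict) simp
  then show "coef (spec B f) e = (if e \<in> B then coef f e else 0)"
    by (cases "e \<in> \<Lambda>") (simp_all add: spec_def coef_synth coef_outside)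
qed

lemma spec_ell2 [simp]: "f \<in> ell2 \<Longrightarrow> spec B f \<in> ell2"
  unfolding spec_def by (intro synth_ell2 ell2_restrict) simp

lemma eq_if_coef_eq: "f \<in> ell2 \<Longrightarrow> g \<in> ell2 \<Longrightarrow> coef f = coef g \<Longrightarrow> f = g"
  by (metis synth_coef)

lemma norm_coef: "f \<in> ell2 \<Longrightarrow> ell2_norm (coef f) = ell2_norm f"
  using coef_norm_le[of f] synth_norm_le[of "coef f"] by (simp add: synth_coef)

lemma orthogonal_projection_spec: "orthogonal_projection (spec B)"
  unfolding orthogonal_projection_def
proof (intro conjI ballI allI)
  fix f g :: "'v \<Rightarrow> complex" and c :: complex
  assume f: "f \<in> ell2"
  show "spec B f \<in> ell2" using f by simp
  show "spec B (\<lambda>x. c * f x) = (\<lambda>x. c * spec B f x)"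
    using f by (intro eq_if_coef_eq) (auto simp: coef_spec coef_scale ell2_scale)
  show "spec B (spec B f) = spec B f"
    using f by (intro eq_if_coef_eq) (auto simp: coef_spec)
  assume g: "g \<in> ell2"
  show "spec B (\<lambda>x. f x + g x) = (\<lambda>x. spec B f x + spec B g x)"
    using f g by (intro eq_if_coef_eq) (auto simp: coef_spec coef_add ell2_add)
  show "ell2_inner f (spec B g) = ell2_inner (spec B f) g"
    unfolding Parseval[OF f spec_ell2[OF g]] Parseval[OF spec_ell2[OF f] g] coef_spec[OF f] coef_spec[OF g]
    unfolding ell2_inner_def by (intro infsum_cong) auto
qed

text \<open>In coefficients, the union and the partial sum differ by the part on
  \<open>?R n\<close>. Each index eventually leaves \<open>?R n\<close>, and finitely many indices
  carry the coefficient sequence up to an error \<open>r / 2\<close> in norm.\<close>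

lemma pvm_spec: "projection_valued_measure spec"
  unfolding projection_valued_measure_def
proof (intro conjI ballI allI impI orthogonal_projection_spec)
  fix f :: "'v \<Rightarrow> complex" assume f: "f \<in> ell2"
  show "spec {} f = (\<lambda>x. 0)" by (simp add: spec_def synth_def fun_eq_iff)
  show "spec UNIV f = f" using f by (simp add: spec_def synth_coef)
  show "spec (A \<inter> B) f = spec A (spec B f)" for A B
    using f by (intro eq_if_coef_eq) (auto simp: coef_spec)
  fix A :: "nat \<Rightarrow> real set"
  assume A: "disjoint_family A"
  let ?s = "\<lambda>n x. \<Sum>i<n. spec (A i) f x" and ?R = "\<lambda>n. (\<Union>i. A i) - (\<Union>i<n. A i)"
  have s: "?s n \<in> ell2" for n using f by (auto intro!: ell2_sum)
  have coefs: "coef (?s n) e = (if e \<in> (\<Union>i<n. A i) then coef f e else 0)" for n e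
  proof -
    have "coef (?s n) e = (\<Sum>i<n. coef (spec (A i) f) e)"
      unfolding coef_def using f by (intro ell2_inner_sum_right) auto
    also have "\<dots> = (\<Sum>i<n. if e \<in> A i then coef f e else 0)" using f by (simp add: coef_spec)
    also have "\<dots> = (if e \<in> (\<Union>i<n. A i) then coef f e else 0)"
    proof (cases "e \<in> (\<Union>i<n. A i)")
      case True
      then obtain i where i: "i < n" "e \<in> A i" by auto
      have "e \<in> A j \<longleftrightarrow> j = i" for j using i A by (auto simp: disjoint_family_on_def)
      then show ?thesis using i by simp
    next
      case False then show ?thesis by (simp add: sum.neutral)
    qed
    finally show ?thesis .
  qed
  have diff: "(\<lambda>x. spec (\<Union>i. A i) f x - ?s n x) = spec (?R n) f" for n
    using f s by (intro eq_if_coef_eq) (auto simp: coef_diff coef_spec coefs ell2_diff)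
  have bound: "ell2_norm (spec (?R n) f) \<le> ell2_norm (\<lambda>e. if e \<in> ?R n then coef f e else 0)" for n
    unfolding spec_def using f by (intro synth_norm_le ell2_restrict) simp
  have "(\<lambda>n. ell2_norm (\<lambda>e. if e \<in> ?R n then coef f e else 0)) \<longlonglongrightarrow> 0"
  proof (rule LIMSEQ_I)
    fix r :: real assume "r > 0"
    then have r2: "r / 2 > 0" by simp
    from ell2_truncate[OF coef_ell2[OF f] r2] obtain X where X: "finite X"
      "ell2_norm (\<lambda>e. coef f e - (if e \<in> X then coef f e else 0)) \<le> r / 2" by blast
    have "\<forall>e\<in>X. \<exists>m. \<forall>n\<ge>m. e \<notin> ?R n"
    proof
      fix e show "\<exists>m. \<forall>n\<ge>m. e \<notin> ?R n"
      proof (cases "e \<in> (\<Union>i. A i)")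
        case True
        then obtain i where "e \<in> A i" by auto
        then show ?thesis by (intro exI[of _ "Suc i"]) (auto simp: Suc_le_eq)
      qed auto
    qed
    then obtain m where m: "\<And>e n. e \<in> X \<Longrightarrow> n \<ge> m e \<Longrightarrow> e \<notin> ?R n" by metis
    have "ell2_norm (\<lambda>e. if e \<in> ?R n then coef f e else 0) < r" if n: "n \<ge> Max (insert 0 (m ` X))" for n
    proof -
      have "e \<notin> ?R n" if "e \<in> X" for e using that n X(1) by (intro m) auto
      then have "cmod (if e \<in> ?R n then coef f e else 0) \<le> cmod (coef f e - (if e \<in> X then coef f e else 0))" for e
        by auto
      then have "ell2_norm (\<lambda>e. if e \<in> ?R n then coef f e else 0) \<le> ell2_norm (\<lambda>e. coef f e - (if e \<in> X then coef f e else 0))"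
        using f by (intro ell2_norm_mono ell2_diff ell2_restrict) auto
      then show ?thesis using X(2) \<open>r > 0\<close> by linarith
    qed
    then show "\<exists>no. \<forall>n\<ge>no. norm (ell2_norm (\<lambda>e. if e \<in> ?R n then coef f e else 0) - 0) < r"
      by (intro exI[of _ "Max (insert 0 (m ` X))"]) auto
  qed
  then show "(\<lambda>n. ell2_norm (\<lambda>x. spec (\<Union>i. A i) f x - ?s n x)) \<longlonglongrightarrow> 0"
    unfolding diff by (rule Lim_null_comparison[rotated]) (use bound in \<open>auto intro!: always_eventually\<close>)
qed

sublocale spec: pvm spec
  by standard (rule pvm_spec)

text \<open>Point masses of size \<open>|coef f e|^2\<close>, written with the counting measure so
  that integrals become infinite sums, and then transported to the Borel sets.\<close>

definition coef_measure :: "('v \<Rightarrow> complex) \<Rightarrow> real measure" where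
  "coef_measure f = distr (density (count_space UNIV) (\<lambda>e. ennreal ((cmod (coef f e))\<^sup>2))) borel (\<lambda>e. e)"

lemma nn_integral_count_space_eq_infsum:
  fixes g :: "'b \<Rightarrow> real"
  assumes "g summable_on UNIV" "\<And>x. g x \<ge> 0"
  shows "(\<integral>\<^sup>+x. ennreal (g x) \<partial>count_space UNIV) = ennreal (infsum g UNIV)"
proof -
  have "Infinite_Sum.abs_summable_on g UNIV" using assms by simp
  then have "Infinite_Set_Sum.abs_summable_on g UNIV" by (rule abs_summable_equivalent[THEN iffD1])
  then show ?thesis using assms by (simp add: nn_integral_conv_infsetsum infsetsum_infsum)
qed

lemma spectral_measure_spec:
  assumes f: "f \<in> ell2"
  shows "spectral_measure spec f = coef_measure f"
proof (rule measure_eqI)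
  fix B assume "B \<in> sets (spectral_measure spec f)"
  then have B: "B \<in> sets borel" by simp
  let ?c = "\<lambda>e. if e \<in> B then coef f e else 0"
  have c: "?c \<in> ell2" using f by (intro ell2_restrict) simp
  have "emeasure (coef_measure f) B = (\<integral>\<^sup>+e. ennreal ((cmod (coef f e))\<^sup>2) * indicator B e \<partial>count_space UNIV)"
    unfolding coef_measure_def using B by (subst emeasure_distr) (auto simp: emeasure_density)
  also have "\<dots> = (\<integral>\<^sup>+e. ennreal ((cmod (?c e))\<^sup>2) \<partial>count_space UNIV)"
    by (intro nn_integral_cong) (auto simp: indicator_def)
  also have "\<dots> = ennreal ((ell2_norm ?c)\<^sup>2)"
    using c unfolding ell2_norm_square by (intro nn_integral_count_space_eq_infsum) (auto simp: ell2_def)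
  also have "ell2_norm ?c = ell2_norm (spec B f)"
    using norm_coef[OF spec_ell2[OF f], of B] coef_spec[OF f, of B] by simp
  finally show "emeasure (spectral_measure spec f) B = emeasure (coef_measure f) B"
    using f B by (simp add: spec.emeasure_spectral)
qed (simp add: coef_measure_def)

lemma coef_T: "f \<in> D \<Longrightarrow> coef (T f) e = complex_of_real e * coef f e"
proof (cases "e \<in> \<Lambda>")
  case True
  assume f: "f \<in> D"
  have "coef (T f) e = ell2_inner (T (\<phi> e)) f"
    unfolding coef_def using symmetric[OF eig_D[OF True] f] .
  then show ?thesis using True by (simp add: eig ell2_inner_scale_left coef_def)
qed (simp add: coef_outside)

text \<open>The assumption \<open>maximal\<close> says that the operator is as large as the adjoint
  of its restriction to the unit vectors. Hence square-summability of \<open>e * coef f e\<close>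
  suffices for membership: the synthesis of these coefficients is the candidate for
  \<open>T f\<close>.\<close>

lemma domain_iff: "f \<in> D \<longleftrightarrow> f \<in> ell2 \<and> (\<lambda>e. complex_of_real e * coef f e) \<in> ell2"
proof safe
  assume "f \<in> D"
  then show "f \<in> ell2" "(\<lambda>e. complex_of_real e * coef f e) \<in> ell2"
    using coef_ell2[OF T_ell2, of f] D_ell2[of f] coef_T[of f] by (auto simp flip: coef_T)
next
  assume f: "f \<in> ell2" and c: "(\<lambda>e. complex_of_real e * coef f e) \<in> ell2"
  show "f \<in> D"
  proof (rule maximal[OF f synth_ell2[OF c]])
    fix x
    have "ell2_inner (T (delta x)) f = ell2_inner (coef (T (delta x))) (coef f)"
      by (rule Parseval[OF T_ell2[OF delta_D] f])
    also have "\<dots> = synth (\<lambda>e. complex_of_real e * coef f e) x"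
      unfolding synth_def ell2_inner_def coef_T[OF delta_D]
      by (intro infsum_cong) (simp add: mult_ac)
    finally show "ell2_inner (T (delta x)) f = synth (\<lambda>e. complex_of_real e * coef f e) x" .
  qed
qed

lemma nn_integral_coef_measure:
  assumes "g \<in> borel_measurable borel"
  shows "(\<integral>\<^sup>+\<xi>. g \<xi> \<partial>coef_measure f) = (\<integral>\<^sup>+e. ennreal ((cmod (coef f e))\<^sup>2) * g e \<partial>count_space UNIV)"
  unfolding coef_measure_def using assms by (simp add: nn_integral_distr nn_integral_density)

lemma ell2_iff_nn_integral: "c \<in> ell2 \<longleftrightarrow> (\<integral>\<^sup>+e. ennreal ((cmod (c e))\<^sup>2) \<partial>count_space UNIV) < \<infinity>"
proof
  assume "c \<in> ell2"
  then show "(\<integral>\<^sup>+e. ennreal ((cmod (c e))\<^sup>2) \<partial>count_space UNIV) < \<infinity>"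
    by (subst nn_integral_count_space_eq_infsum) (auto simp: ell2_def)
next
  assume "(\<integral>\<^sup>+e. ennreal ((cmod (c e))\<^sup>2) \<partial>count_space UNIV) < \<infinity>"
  then have "integrable (count_space UNIV) (\<lambda>e. (cmod (c e))\<^sup>2)"
    by (intro integrableI_bounded) auto
  then have "Infinite_Set_Sum.abs_summable_on (\<lambda>e. (cmod (c e))\<^sup>2) UNIV"
    by (simp add: abs_summable_on_def)
  then have "Infinite_Sum.abs_summable_on (\<lambda>e. (cmod (c e))\<^sup>2) UNIV"
    by (rule abs_summable_equivalent[THEN iffD2])
  then show "c \<in> ell2" by (simp add: ell2_def)
qed

lemma spectral_resolution_spec: "spectral_resolution D T spec"
  unfolding spectral_resolution_def
proof (intro conjI pvm_spec ballI)
  have "(\<integral>\<^sup>+\<xi>. ennreal (\<xi>\<^sup>2) \<partial>spectral_measure spec f) =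
      (\<integral>\<^sup>+e. ennreal ((cmod (complex_of_real e * coef f e))\<^sup>2) \<partial>count_space UNIV)" if "f \<in> ell2" for f
    unfolding spectral_measure_spec[OF that]
    by (subst nn_integral_coef_measure)
      (auto intro!: nn_integral_cong simp: norm_mult power_mult_distrib mult.commute ennreal_mult)
  then show "D = {f \<in> ell2. (\<integral>\<^sup>+\<xi>. ennreal (\<xi>\<^sup>2) \<partial>spectral_measure spec f) < \<infinity>}"
    by (auto simp: domain_iff ell2_iff_nn_integral[of "\<lambda>e. complex_of_real e * coef _ e"])
  fix f assume f: "f \<in> D"
  show "T f \<in> ell2" using f by (rule T_ell2)
  have c: "coef f \<in> ell2" "coef (T f) \<in> ell2" using D_ell2[OF f] T_ell2[OF f] by auto
  have eq: "cnj (coef f e) * coef (T f) e = complex_of_real (e * (cmod (coef f e))\<^sup>2)" for e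
    unfolding coef_T[OF f] of_real_mult complex_norm_square by (simp add: mult_ac)
  have sm: "Infinite_Sum.abs_summable_on (\<lambda>e. e * (cmod (coef f e))\<^sup>2) UNIV"
    using ell2_inner_abs_summable[OF c] unfolding eq norm_of_real by simp
  have "ell2_inner f (T f) = ell2_inner (coef f) (coef (T f))"
    using D_ell2[OF f] T_ell2[OF f] by (rule Parseval)
  also have "\<dots> = (\<Sum>\<^sub>\<infinity>e. complex_of_real (e * (cmod (coef f e))\<^sup>2))"
    unfolding ell2_inner_def eq ..
  also have "\<dots> = complex_of_real (\<Sum>\<^sub>\<infinity>e. e * (cmod (coef f e))\<^sup>2)"
    using sm by (intro infsumI has_sum_of_real has_sum_infsum) (rule abs_summable_summable)
  also have "(\<Sum>\<^sub>\<infinity>e. e * (cmod (coef f e))\<^sup>2) = infsetsum (\<lambda>e. e * (cmod (coef f e))\<^sup>2) UNIV"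
    using sm by (intro infsetsum_infsum[symmetric] abs_summable_equivalent[THEN iffD1])
  also have "\<dots> = (\<integral>\<xi>. \<xi> \<partial>coef_measure f)"
    unfolding coef_measure_def infsetsum_def
    by (subst integral_distr) (auto simp: integral_density mult.commute)
  finally show "ell2_inner f (T f) = complex_of_real (\<integral>\<xi>. \<xi> \<partial>spectral_measure spec f)"
    by (simp add: spectral_measure_spec[OF D_ell2[OF f]])
qed

section \<open>An arbitrary spectral resolution of the operator\<close>

context
  fixes E assumes res: "spectral_resolution D T E"
begin

interpretation E: pvm E
  using res by unfold_locales (simp add: spectral_resolution_def)

lemma form_E: "f \<in> D \<Longrightarrow> ell2_inner f (T f) = complex_of_real (\<integral>\<xi>. \<xi> \<partial>spectral_measure E f)"
  using res by (auto simp: spectral_resolution_def)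

lemma domain_E: "f \<in> D \<longleftrightarrow> f \<in> ell2 \<and> (\<integral>\<^sup>+\<xi>. ennreal (\<xi>\<^sup>2) \<partial>spectral_measure E f) < \<infinity>"
  using res by (auto simp: spectral_resolution_def)

text \<open>Expanding \<open>\<langle>\<phi> - g, T (\<phi> - g)\<rangle>\<close> for \<open>g = E B \<phi>\<close> and comparing with the integral over the
  complement of \<open>B\<close>.\<close>

lemma integral_over_bounded:
  assumes e: "e \<in> \<Lambda>" and B: "B \<in> sets borel" "\<And>\<xi>. \<xi> \<in> B \<Longrightarrow> \<bar>\<xi>\<bar> \<le> K"
  shows "(\<integral>\<xi>. indicator B \<xi> * (\<xi> - e) \<partial>spectral_measure E (\<phi> e)) = 0"
proof -
  let ?\<mu> = "spectral_measure E (\<phi> e)"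
  interpret finite_measure ?\<mu> by (rule E.finite_spectral) simp
  define g where "g = E B (\<phi> e)"
  define h where "h = E (- B) (\<phi> e)"
  have Bc: "- B \<in> sets borel" using B by (simp add: borel_comp)
  have \<phi>D: "\<phi> e \<in> D" using e by (rule eig_D)
  have g: "g \<in> ell2" using B by (simp add: g_def)
  have h: "h = (\<lambda>x. \<phi> e x - g x)" unfolding h_def g_def using B by (intro E.E_compl) auto
  have int2: "integrable ?\<mu> (\<lambda>\<xi>. \<xi>\<^sup>2)"
    using \<phi>D unfolding domain_E by (intro integrableI_bounded) auto
  have int: "integrable ?\<mu> (\<lambda>\<xi>. \<xi>)"
  proof (rule Bochner_Integration.integrable_bound)
    show "integrable ?\<mu> (\<lambda>\<xi>. 1 + \<xi>\<^sup>2)" using int2 by simp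
    have "\<bar>\<xi>\<bar> \<le> 1 + \<xi>\<^sup>2" for \<xi> :: real
      using zero_le_power2[of "\<bar>\<xi>\<bar> - 1"] by (simp add: power2_eq_square algebra_simps)
    then show "AE \<xi> in ?\<mu>. norm \<xi> \<le> norm (1 + \<xi>\<^sup>2)" by auto
  qed simp
  have int_ind: "integrable ?\<mu> (\<lambda>\<xi>. indicator C \<xi> * \<xi>)" if "C \<in> sets borel" for C
    using int that by (intro integrable_mult_indicator[where 'b = real, simplified]) auto
  have int_ind1: "integrable ?\<mu> (indicator C :: real \<Rightarrow> real)" if "C \<in> sets borel" for C
    using that by (intro integrable_real_indicator) (auto simp: less_top[symmetric])
  have gD: "g \<in> D"
    unfolding domain_E
  proof
    have "(\<integral>\<^sup>+\<xi>. ennreal (\<xi>\<^sup>2) \<partial>spectral_measure E g) = (\<integral>\<^sup>+\<xi>. indicator B \<xi> * ennreal (\<xi>\<^sup>2) \<partial>?\<mu>)"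
      unfolding g_def using B by (subst E.spectral_restrict) (auto simp: nn_integral_density)
    also have "\<dots> \<le> (\<integral>\<^sup>+\<xi>. ennreal (\<xi>\<^sup>2) \<partial>?\<mu>)"
      by (intro nn_integral_mono) (auto simp: indicator_def)
    also have "\<dots> < \<infinity>" using \<phi>D by (simp add: domain_E)
    finally show "(\<integral>\<^sup>+\<xi>. ennreal (\<xi>\<^sup>2) \<partial>spectral_measure E g) < \<infinity>" .
  qed (rule g)
  have hD: "h \<in> D" unfolding h using \<phi>D gD by (rule D_diff)
  have form_restrict: "(\<integral>\<xi>. \<xi> \<partial>spectral_measure E (E C (\<phi> e))) = (\<integral>\<xi>. indicator C \<xi> * \<xi> \<partial>?\<mu>)"
    if C: "C \<in> sets borel" for C
  proof -
    have "density ?\<mu> (indicator C) = density ?\<mu> (\<lambda>x. ennreal (indicator C x))"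
      by (simp add: ennreal_indicator)
    then show ?thesis
      using C by (subst E.spectral_restrict) (auto simp: integral_density)
  qed
  define I where "I = (\<integral>\<xi>. indicator B \<xi> * \<xi> \<partial>?\<mu>)"
  define m where "m = measure ?\<mu> B"
  have m: "ell2_inner (\<phi> e) g = complex_of_real m"
    using B by (simp add: g_def E.E_form m_def measure_def E.emeasure_spectral)
  then have m': "ell2_inner g (\<phi> e) = complex_of_real m"
    by (subst ell2_inner_commute) simp
  have tot: "(\<integral>\<xi>. \<xi> \<partial>?\<mu>) = e"
    using form_E[OF \<phi>D] e by (simp add: eig ell2_inner_scale_right orthonormal)
  have sp: "(\<integral>\<xi>. indicator (- B) \<xi> * \<xi> \<partial>?\<mu>) = e - I"
  proof -
    have "(\<integral>\<xi>. indicator (- B) \<xi> * \<xi> \<partial>?\<mu>) = (\<integral>\<xi>. \<xi> - indicator B \<xi> * \<xi> \<partial>?\<mu>)"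
      by (intro Bochner_Integration.integral_cong) (auto simp: indicator_def)
    also have "\<dots> = e - I" using int int_ind[OF B(1)] by (simp add: tot I_def)
    finally show ?thesis .
  qed
  have "ell2_inner h (T h) = complex_of_real (e - I)"
    using form_E[OF hD] form_restrict[OF Bc] sp by (simp add: h_def)
  moreover have "ell2_inner g (T g) = complex_of_real I"
    using form_E[OF gD] form_restrict[OF B(1)] by (simp add: g_def I_def)
  moreover have "ell2_inner h (T h) = complex_of_real (e - 2 * e * m) + ell2_inner g (T g)"
  proof -
    have Th: "T h = (\<lambda>x. T (\<phi> e) x - T g x)" unfolding h using \<phi>D gD by (rule T_diff)
    have s: "ell2_inner (\<phi> e) (T g) = complex_of_real (e * m)"
      using symmetric[OF \<phi>D gD] e m by (simp add: eig ell2_inner_scale_left)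
    have "ell2_inner h (T h) = ell2_inner (\<phi> e) (T (\<phi> e)) - ell2_inner (\<phi> e) (T g) - (ell2_inner g (T (\<phi> e)) - ell2_inner g (T g))"
      unfolding Th unfolding h using g T_ell2[OF \<phi>D] T_ell2[OF gD]
      by (simp add: ell2_inner_diff_left ell2_inner_diff_right ell2_diff)
    then show ?thesis
      using e m' by (simp add: s eig ell2_inner_scale_right orthonormal algebra_simps)
  qed
  ultimately have "complex_of_real (e - I) = complex_of_real (e - 2 * e * m + I)" by simp
  then have "I = e * m" by (simp only: of_real_eq_iff)
  moreover have "(\<integral>\<xi>. indicator B \<xi> * (\<xi> - e) \<partial>?\<mu>) = I - e * m"
  proof -
    have "(\<integral>\<xi>. indicator B \<xi> * (\<xi> - e) \<partial>?\<mu>) = (\<integral>\<xi>. indicator B \<xi> * \<xi> - e * indicator B \<xi> \<partial>?\<mu>)"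
      by (intro Bochner_Integration.integral_cong) (auto simp: algebra_simps)
    also have "\<dots> = I - e * m"
      using int_ind[OF B(1)] int_ind1[OF B(1)] B by (simp add: I_def m_def)
    finally show ?thesis .
  qed
  ultimately show ?thesis by simp
qed

text \<open>On a bounded set to one side of \<open>e\<close> the function \<open>\<xi> - e\<close>
  has a strict sign, so its vanishing integral (\<open>integral_over_bounded\<close>) forces a null
  set. Countably many such sets cover the complement of \<open>e\<close>.\<close>

lemma spectral_measure_eigenvector:
  assumes e: "e \<in> \<Lambda>"
  shows "emeasure (spectral_measure E (\<phi> e)) (- {e}) = 0"
proof -
  let ?\<mu> = "spectral_measure E (\<phi> e)"
  interpret finite_measure ?\<mu> by (rule E.finite_spectral) simp
  have null: "emeasure ?\<mu> B = 0"
    if B: "B \<in> sets borel" "\<And>\<xi>. \<xi> \<in> B \<Longrightarrow> \<bar>\<xi>\<bar> \<le> K" and s: "\<bar>s\<bar> = 1" "\<And>\<xi>. \<xi> \<in> B \<Longrightarrow> s * (\<xi> - e) > 0" for B K s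
  proof -
    let ?f = "\<lambda>\<xi>. indicator B \<xi> * (s * (\<xi> - e))"
    have "(\<integral>\<xi>. ?f \<xi> \<partial>?\<mu>) = (\<integral>\<xi>. s * (indicator B \<xi> * (\<xi> - e)) \<partial>?\<mu>)"
      by (intro Bochner_Integration.integral_cong) auto
    then have "(\<integral>\<xi>. ?f \<xi> \<partial>?\<mu>) = 0"
      using integral_over_bounded[OF e B] by simp
    moreover have "integrable ?\<mu> ?f"
    proof (rule integrable_const_bound[of _ "\<bar>K\<bar> + \<bar>e\<bar>"])
      have "\<bar>\<xi> - e\<bar> \<le> \<bar>K\<bar> + \<bar>e\<bar>" if "\<xi> \<in> B" for \<xi> using B(2)[OF that] by linarith
      then show "AE x in ?\<mu>. norm (?f x) \<le> \<bar>K\<bar> + \<bar>e\<bar>"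
        using s(1) by (intro AE_I2) (auto simp: indicator_def abs_mult)
    qed (use B in measurable)
    moreover have "AE x in ?\<mu>. 0 \<le> ?f x" using s(2) by (intro AE_I2) (auto simp: indicator_def less_imp_le)
    ultimately have "AE x in ?\<mu>. ?f x = 0" by (simp add: integral_nonneg_eq_0_iff_AE)
    then have "AE x in ?\<mu>. x \<notin> B"
      by eventually_elim (use s(2) in \<open>force simp: indicator_def\<close>)
    then show ?thesis using B by (subst (asm) AE_iff_null) (auto simp: null_sets_def)
  qed
  have "emeasure ?\<mu> ({e<..e + real n} \<union> {e - real n..<e}) = 0" for n
  proof -
    have "emeasure ?\<mu> {e<..e + real n} = 0" by (rule null[where K = "\<bar>e\<bar> + real n" and s = 1]) auto
    moreover have "emeasure ?\<mu> {e - real n..<e} = 0" by (rule null[where K = "\<bar>e\<bar> + real n" and s = "-1"]) auto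
    ultimately show ?thesis
      using emeasure_subadditive[of "{e<..e + real n}" ?\<mu> "{e - real n..<e}"] by simp
  qed
  then have "emeasure ?\<mu> (\<Union>n. {e<..e + real n} \<union> {e - real n..<e}) = 0"
    by (intro emeasure_UN_eq_0) auto
  moreover have "(\<Union>n. {e<..e + real n} \<union> {e - real n..<e}) = - {e}"
  proof -
    have "x \<in> (\<Union>n. {e<..e + real n} \<union> {e - real n..<e})" if "x \<noteq> e" for x
    proof -
      obtain n where "real n \<ge> \<bar>x - e\<bar>" using real_arch_simple by blast
      then show ?thesis using that by (intro UN_I[of n]) auto
    qed
    then have "- {e} \<subseteq> (\<Union>n. {e<..e + real n} \<union> {e - real n..<e})" by blast
    moreover have "(\<Union>n. {e<..e + real n} \<union> {e - real n..<e}) \<subseteq> - {e}" by auto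
    ultimately show ?thesis by blast
  qed
  ultimately show ?thesis by simp
qed

text \<open>The projection belonging to the complement of \<Lambda> kills every eigenvector; by
  self-adjointness all coefficients of \<open>E (- \<Lambda>) f\<close> vanish, so the spectral
  measure of \<open>f\<close> lives on the countable set \<Lambda>.\<close>

lemma pure_point_E:
  assumes f: "f \<in> ell2"
  shows "pure_point_measure (spectral_measure E f)"
proof (rule pure_point_measureI[OF _ countable_eig])
  have L: "\<Lambda> \<in> sets borel" by (rule sets.countable[OF _ countable_eig]) simp
  then have Lc: "- \<Lambda> \<in> sets borel" by (simp add: borel_comp)
  have zero: "E (- \<Lambda>) (\<phi> e) = (\<lambda>x. 0)" for e
  proof (cases "e \<in> \<Lambda>")
    case True
    have "emeasure (spectral_measure E (\<phi> e)) (- \<Lambda>) \<le> emeasure (spectral_measure E (\<phi> e)) (- {e})"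
      using True by (intro emeasure_mono) (auto simp: borel_comp)
    then have "ennreal ((ell2_norm (E (- \<Lambda>) (\<phi> e)))\<^sup>2) = 0"
      using spectral_measure_eigenvector[OF True] Lc by (simp add: E.emeasure_spectral)
    then have "ell2_norm (E (- \<Lambda>) (\<phi> e)) = 0" by simp
    then show ?thesis using Lc by (intro ext ell2_norm_eq_0) auto
  next
    case False
    then have "\<phi> e = (\<lambda>x. 0 * \<phi> e x)" by (simp add: family_zero)
    moreover have "E (- \<Lambda>) (\<lambda>x. 0 * \<phi> e x) = (\<lambda>x. 0 * E (- \<Lambda>) (\<phi> e) x)"
      using E.proj[OF Lc] ell2_family unfolding orthogonal_projection_def by blast
    ultimately show ?thesis by simp
  qed
  have "E (- \<Lambda>) f x = 0" for x
  proof (rule coef_eq_0)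
    show "coef (E (- \<Lambda>) f) e = 0" for e
      unfolding coef_def using f Lc by (subst E.E_selfadjoint) (auto simp: zero)
  qed (use f Lc in simp)
  then have "E (- \<Lambda>) f = (\<lambda>x. 0)" by auto
  then show "emeasure (spectral_measure E f) (- \<Lambda>) = 0"
    using f Lc by (simp add: E.emeasure_spectral ell2_norm_def)
qed simp

end

theorem only_pure_point_spectrum: "only_pure_point_spectrum D T"
  unfolding only_pure_point_spectrum_def using spectral_resolution_spec pure_point_E by blast

end

section \<open>Trees of subexponential growth\<close>

locale tree_graph =
  fixes G :: "'v \<Rightarrow> 'v \<Rightarrow> bool"
  assumes tree: "is_tree G"
begin

lemma G_sym: "G x y \<Longrightarrow> G y x"
  using tree by (auto simp: is_tree_def)

lemma G_irrefl [simp]: "\<not> G x x"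
  using tree by (auto simp: is_tree_def)

lemma G_connected: "G\<^sup>*\<^sup>* x y"
  using tree by (auto simp: is_tree_def)

abbreviation d :: "'v \<Rightarrow> 'v \<Rightarrow> nat" where "d \<equiv> gdist G"

lemma relpowp_gdist: "(G ^^ d x y) x y"
  unfolding gdist_def using G_connected[of x y] by (auto simp: rtranclp_power intro: LeastI)

lemma gdist_le: "(G ^^ n) x y \<Longrightarrow> d x y \<le> n"
  unfolding gdist_def by (rule Least_le)

lemma gdist_self [simp]: "d x x = 0"
  using gdist_le[of 0 x x] by simp

lemma gdist_eq_0 [simp]: "d x y = 0 \<longleftrightarrow> x = y"
  using relpowp_gdist[of x y] by auto

lemma relpowp_sym: "(G ^^ n) x y \<Longrightarrow> (G ^^ n) y x"
proof (induction n arbitrary: y)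
  case (Suc n)
  then obtain z where "(G ^^ n) x z" "G z y" by auto
  then show ?case using Suc.IH G_sym by (intro relpowp_Suc_I2) auto
qed auto

lemma gdist_sym: "d x y = d y x"
  using gdist_le[OF relpowp_sym[OF relpowp_gdist[of x y]]] gdist_le[OF relpowp_sym[OF relpowp_gdist[of y x]]] by simp

lemma gdist_triangle: "d x z \<le> d x y + d y z"
  by (rule gdist_le) (metis relpowp_add relpowp_gdist relcomppI)

lemma gdist_le_1: "G x y \<Longrightarrow> d x y \<le> 1"
  by (rule gdist_le) (simp only: relpowp_1)

lemma gdist_adj: "G x y \<Longrightarrow> d z y \<le> Suc (d z x)"
  using gdist_triangle[of z y x] gdist_le_1[of x y] by simp

lemma gdist_eq_1 [simp]: "d x y = Suc 0 \<longleftrightarrow> G x y"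
proof
  assume "d x y = Suc 0" then show "G x y" using relpowp_gdist[of x y] by (simp only: relpowp_1 One_nat_def[symmetric])
next
  assume G: "G x y"
  then have "d x y \<le> 1" by (rule gdist_le_1)
  moreover have "d x y \<noteq> 0" using G by auto
  ultimately show "d x y = Suc 0" by linarith
qed

lemma neighbors_eq: "neighbors G x = {y. G x y}"
  unfolding neighbors_def by auto

text \<open>The root is a parameter because every vertex serves as a root: each
  \<open>delta x\<close> has to be approximated by vectors localized at \<open>x\<close>, and zeros
  of eigenfunctions are studied in the tree rooted at the zero.\<close>

definition par :: "'v \<Rightarrow> 'v \<Rightarrow> 'v" where
  "par rt x = (SOME p. G x p \<and> d rt x = Suc (d rt p))"

lemma par: assumes "x \<noteq> rt" shows "G x (par rt x)" "d rt x = Suc (d rt (par rt x))"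
proof -
  obtain n where n: "d rt x = Suc n" using assms by (cases "d rt x") auto
  with relpowp_gdist[of rt x] obtain p where p: "(G ^^ n) rt p" "G p x" by auto
  have "d rt p \<le> n" using p(1) by (rule gdist_le)
  moreover have "d rt x \<le> Suc (d rt p)" using p(2) by (rule gdist_adj)
  ultimately have "G x p \<and> d rt x = Suc (d rt p)" using p G_sym n by auto
  then have "G x (par rt x) \<and> d rt x = Suc (d rt (par rt x))" unfolding par_def by (rule someI)
  then show "G x (par rt x)" "d rt x = Suc (d rt (par rt x))" by auto
qed

lemma gdist_anc: "i \<le> d rt x \<Longrightarrow> d rt ((par rt ^^ i) x) = d rt x - i"
proof (induction i)
  case (Suc i)
  then have "(par rt ^^ i) x \<noteq> rt" by (metis Suc_leD Suc_le_eq gdist_self zero_less_diff less_not_refl)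
  from par(2)[OF this] Suc show ?case by simp
qed simp

lemma anc_eq_root: "(par rt ^^ d rt x) x = rt"
  using gdist_anc[of "d rt x" rt x] by (metis diff_self_eq_0 gdist_eq_0 order_refl)

lemma no_cycle:
  assumes "distinct c" "3 \<le> length c" "successively G c" "G (last c) (hd c)"
  shows False
proof -
  have "G (c ! i) (c ! (Suc i mod length c))" if "i < length c" for i
  proof (cases "Suc i < length c")
    case True then show ?thesis using assms(3) by (simp add: successively_conv_nth)
  next
    case False
    then have "Suc i = length c" using that by simp
    then have "i = length c - 1" "c \<noteq> []" using assms(2) by auto
    then show ?thesis using assms(4) \<open>Suc i = length c\<close> by (simp add: last_conv_nth hd_conv_nth)
  qed
  with assms(1,2) show False using tree by (auto simp: is_tree_def)
qed

text \<open>The path follows the two lines of ancestors up to the vertex where they first meet.\<close>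

lemma level_path:
  assumes "d rt x = d rt y" "x \<noteq> y"
  obtains c where "distinct c" "3 \<le> length c" "successively G c" "hd c = x" "last c = y" "\<And>z. z \<in> set c \<Longrightarrow> d rt z \<le> d rt x"
proof -
  let ?a = "\<lambda>i. (par rt ^^ i) x" and ?b = "\<lambda>i. (par rt ^^ i) y"
  define m where "m = (LEAST i. ?a i = ?b i)"
  have top: "?a (d rt x) = ?b (d rt x)" using anc_eq_root[of rt x] anc_eq_root[of rt y] assms by simp
  have m_eq: "?a m = ?b m" unfolding m_def using top by (rule LeastI)
  have m_le: "m \<le> d rt x" unfolding m_def using top by (rule Least_le)
  have m_min: "?a i \<noteq> ?b i" if "i < m" for i using that not_less_Least unfolding m_def by blast
  have m0: "m > 0" using m_eq assms(2) by (cases m) auto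
  have da: "d rt (?a i) = d rt x - i" "d rt (?b i) = d rt x - i" if "i \<le> m" for i
    using gdist_anc[of i rt x] gdist_anc[of i rt y] that m_le assms(1) by auto
  have step: "G (?a i) (?a (Suc i))" "G (?b (Suc i)) (?b i)" if "i < m" for i
  proof -
    have "?a i \<noteq> rt" "?b i \<noteq> rt" using da[of i] that m_le by auto
    then show "G (?a i) (?a (Suc i))" "G (?b (Suc i)) (?b i)" using par(1) G_sym by auto
  qed
  let ?c1 = "map ?a [0..<Suc m]" and ?c2 = "rev (map ?b [0..<m])"
  have "distinct (?c1 @ ?c2)"
  proof -
    have neq: "i = j" if "i \<le> m" "j \<le> m" "d rt (?a i) = d rt (?a j) \<or> d rt (?b i) = d rt (?b j) \<or> d rt (?a i) = d rt (?b j)" for i j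
      using that da[of i] da[of j] m_le by auto
    have "inj_on ?a {0..<Suc m}" by (rule inj_onI, rule neq) auto
    moreover have "inj_on ?b {0..<m}" by (rule inj_onI, rule neq) auto
    moreover have "?a i \<noteq> ?b j" if "i < Suc m" "j < m" for i j
      using neq[of i j] m_min[of j] that by (metis less_Suc_eq_le less_imp_le)
    ultimately show ?thesis by (auto simp: distinct_map simp del: upt_Suc)
  qed
  moreover have "3 \<le> length (?c1 @ ?c2)" using m0 by simp
  moreover have "successively G (?c1 @ ?c2)"
  proof -
    have "successively G ?c1" using step(1) by (auto simp: successively_conv_nth simp del: upt_Suc)
    moreover have "successively G ?c2"
      unfolding successively_rev using step(2) by (auto simp: successively_conv_nth)
    moreover have "last ?c1 = ?b m" using m_eq by simp
    moreover have "hd ?c2 = ?b (m - 1)" using m0 by (simp add: hd_rev last_map)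
    moreover have "G (?b m) (?b (m - 1))" using step(2)[of "m - 1"] m0 by simp
    ultimately show ?thesis by (simp add: successively_append_iff del: upt_Suc)
  qed
  moreover have "hd (?c1 @ ?c2) = x" by (simp add: upt_rec)
  moreover have "last (?c1 @ ?c2) = y" using m0 by (simp add: last_rev hd_map)
  moreover have "d rt z \<le> d rt x" if "z \<in> set (?c1 @ ?c2)" for z using that da by auto
  ultimately show thesis by (rule that)
qed

text \<open>An edge inside a level would close the path of \<open>level_path\<close> to a
  cycle.\<close>

lemma adjacent_levels_differ: "G x y \<Longrightarrow> d rt x \<noteq> d rt y"
proof
  assume G: "G x y" and eq: "d rt x = d rt y"
  have "x \<noteq> y" using G by auto
  from level_path[OF eq this] obtain c where "distinct c" "3 \<le> length c" "successively G c" "hd c = x" "last c = y"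
    by metis
  with G show False using no_cycle[of c] G_sym by auto
qed

text \<open>Two parents would be joined by a path that stays in levels no deeper than theirs;
  \<open>w\<close> lies one level deeper and closes it to a cycle.\<close>

lemma parent_unique:
  assumes "G w x" "G w y" "d rt w = Suc (d rt x)" "d rt w = Suc (d rt y)"
  shows "x = y"
proof (rule ccontr)
  assume ne: "x \<noteq> y"
  have eq: "d rt x = d rt y" using assms by simp
  from level_path[OF eq ne] obtain c where c: "distinct c" "3 \<le> length c" "successively G c" "hd c = x" "last c = y"
    "\<And>z. z \<in> set c \<Longrightarrow> d rt z \<le> d rt x" by metis
  have "w \<notin> set c" using c(6)[of w] assms by auto
  moreover have "c \<noteq> []" using c(2) by auto
  ultimately show False
    using no_cycle[of "w # c"] c assms(1,2) G_sym by (auto simp: successively_Cons)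
qed

definition children :: "'v \<Rightarrow> 'v \<Rightarrow> 'v set" where
  "children rt x = {c. G x c \<and> d rt c = Suc (d rt x)}"

lemma par_eqI: "G x p \<Longrightarrow> d rt x = Suc (d rt p) \<Longrightarrow> par rt x = p"
  using parent_unique[of x "par rt x" p rt] par[of x rt] by fastforce

lemma children_iff: "c \<in> children rt x \<longleftrightarrow> c \<noteq> rt \<and> par rt c = x"
  using par[of c rt] par_eqI[of c x rt] G_sym by (auto simp: children_def)

lemma adjacent_iff: "G x y \<longleftrightarrow> y \<in> children rt x \<or> (x \<noteq> rt \<and> y = par rt x)"
proof
  assume G: "G x y"
  have "d rt y \<le> Suc (d rt x)" "d rt x \<le> Suc (d rt y)" using gdist_adj G G_sym by auto
  moreover have "d rt x \<noteq> d rt y" using G by (rule adjacent_levels_differ)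
  ultimately consider "d rt y = Suc (d rt x)" | "d rt x = Suc (d rt y)" by linarith
  then show "y \<in> children rt x \<or> (x \<noteq> rt \<and> y = par rt x)"
  proof cases
    case 2 then show ?thesis using par_eqI[OF G] by auto
  qed (use G in \<open>auto simp: children_def\<close>)
qed (auto simp: children_def par)

lemma par_notin_children: "x \<noteq> rt \<Longrightarrow> par rt x \<notin> children rt x"
  using par(2)[of x rt] by (auto simp: children_def)

lemma adjacent_set: "{y. G x y} = children rt x \<union> (if x = rt then {} else {par rt x})"
  using adjacent_iff[of x _ rt] by auto

lemma gdist_children: "c \<in> children rt x \<Longrightarrow> d rt c = Suc (d rt x)"
  by (simp add: children_def)

lemma forward_neighbors_eq: "forward_neighbors G rt x = children rt x"
proof -
  have "d rt y > d rt x \<longleftrightarrow> d rt y = Suc (d rt x)" if "G x y" for y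
    using gdist_adj[OF that, of rt] by auto
  then show ?thesis by (auto simp: forward_neighbors_def children_def gdist_sym[of _ rt])
qed

end

text \<open>Summability for every \<tau> below 1 is subexponential growth of the spheres, in the
  form in which the sums over vertices use it and for every choice of the root.\<close>

locale subexponential_tree = tree_graph G for G :: "'v \<Rightarrow> 'v \<Rightarrow> bool" +
  fixes Dmax :: nat
  assumes finite_adj: "finite {y. G x y}"
    and card_adj: "card {y. G x y} \<le> Dmax"
    and summable_exp: "\<And>(\<tau>::real) rt. 0 < \<tau> \<Longrightarrow> \<tau> < 1 \<Longrightarrow> (\<lambda>x. \<tau> ^ gdist G rt x) summable_on UNIV"
begin

lemma finite_children [simp]: "finite (children rt x)"
  using finite_adj[of x] by (rule rev_finite_subset) (auto simp: children_def)

lemma finite_ball: "finite {x. d rt x \<le> n}"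
proof (induction n)
  case (Suc n)
  have "{x. d rt x \<le> Suc n} \<subseteq> {x. d rt x \<le> n} \<union> (\<Union>x\<in>{x. d rt x \<le> n}. children rt x)"
  proof
    fix x assume x: "x \<in> {x. d rt x \<le> Suc n}"
    show "x \<in> {x. d rt x \<le> n} \<union> (\<Union>x\<in>{x. d rt x \<le> n}. children rt x)"
    proof (cases "d rt x \<le> n")
      case False
      then have "x \<noteq> rt" by auto
      then have "x \<in> children rt (par rt x)" "d rt (par rt x) \<le> n" using par[of x rt] x by (auto simp: children_iff)
      then show ?thesis by auto
    qed auto
  qed
  then show ?case by (rule finite_subset) (use Suc in auto)
qed simp

text \<open>A summable family of positive terms has a countable index set.\<close>

lemma countable_vertices: "countable (UNIV :: 'v set)"
proof -
  have "countable {x \<in> UNIV. (1/2::real) ^ d undefined x \<noteq> 0}"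
    by (rule summable_countable_real) (rule summable_exp, auto)
  then show ?thesis by simp
qed

end

section \<open>Growth of the tree with sparse branching levels\<close>

lemma floor_power_unbounded:
  assumes "\<gamma> > (1::real)"
  shows "\<exists>j0. \<forall>j\<ge>j0. \<lfloor>\<gamma> ^ j\<rfloor> \<ge> int A"
proof -
  obtain j0 where j0: "real A < \<gamma> ^ j0" using real_arch_pow[OF assms] by blast
  have "\<lfloor>\<gamma> ^ j\<rfloor> \<ge> int A" if "j \<ge> j0" for j
  proof -
    have "\<gamma> ^ j0 \<le> \<gamma> ^ j" using that assms by (intro power_increasing) auto
    then show ?thesis using j0 by (simp add: le_floor_iff)
  qed
  then show ?thesis by blast
qed

definition branching_levels :: "real \<Rightarrow> nat set" where
  "branching_levels \<gamma> = {m. m = 0 \<or> (\<exists>N\<ge>1. int m = (\<Sum>j=1..N. \<lfloor>\<gamma> ^ j\<rfloor>))}"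

text \<open>The gaps between branching levels tend to infinity, so these levels have density zero.\<close>

lemma branching_levels_sparse:
  assumes \<gamma>: "\<gamma> > 1" and A: "A > 0"
  shows "\<exists>C. \<forall>n. card (branching_levels \<gamma> \<inter> {..<n}) \<le> C + n div A"
proof -
  obtain j0 where j0: "\<And>j. j \<ge> j0 \<Longrightarrow> \<lfloor>\<gamma> ^ j\<rfloor> \<ge> int A"
    using floor_power_unbounded[OF \<gamma>] by blast
  define t where "t N = nat (\<Sum>j=1..N. \<lfloor>\<gamma> ^ j\<rfloor>)" for N
  have nonneg: "\<lfloor>\<gamma> ^ j\<rfloor> \<ge> 0" for j using \<gamma> by simp
  have t_int: "int (t N) = (\<Sum>j=1..N. \<lfloor>\<gamma> ^ j\<rfloor>)" for N
    unfolding t_def using nonneg by (simp add: sum_nonneg)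
  have t_ge: "int (t N) \<ge> int A * (int N - int j0)" for N
  proof (cases "j0 \<le> N")
    case True
    have "int A * (int N - int j0) = (\<Sum>j=Suc j0..N. int A)" using True by (simp add: of_nat_diff)
    also have "\<dots> \<le> (\<Sum>j=Suc j0..N. \<lfloor>\<gamma> ^ j\<rfloor>)" by (intro sum_mono j0) auto
    also have "\<dots> \<le> (\<Sum>j=1..N. \<lfloor>\<gamma> ^ j\<rfloor>)" by (intro sum_mono2) (use \<gamma> in auto)
    finally show ?thesis by (simp add: t_int)
  next
    case False
    then have "int A * (int N - int j0) \<le> 0" by (intro mult_nonneg_nonpos) auto
    then show ?thesis by linarith
  qed
  have "card (branching_levels \<gamma> \<inter> {..<n}) \<le> (j0 + 2) + n div A" for n
  proof -
    have "branching_levels \<gamma> \<inter> {..<n} \<subseteq> insert 0 (t ` {..j0 + n div A})"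
    proof
      fix m assume m: "m \<in> branching_levels \<gamma> \<inter> {..<n}"
      show "m \<in> insert 0 (t ` {..j0 + n div A})"
      proof (cases "m = 0")
        case False
        then obtain N where "int m = (\<Sum>j=1..N. \<lfloor>\<gamma> ^ j\<rfloor>)"
          using m by (auto simp: branching_levels_def)
        then have N: "m = t N" using t_int[of N] by linarith
        have "N \<le> j0 + n div A"
        proof (rule ccontr)
          assume "\<not> ?thesis"
          then have "int N - int j0 \<ge> int (n div A) + 1" by linarith
          then have "int A * (int N - int j0) \<ge> int A * (int (n div A) + 1)" using A by (intro mult_left_mono) auto
          moreover have "int A * (int (n div A) + 1) > int n"
          proof -
            have "n < A * (n div A) + A" using A by (metis add.commute add_less_cancel_right div_mult_mod_eq mod_less_divisor mult.commute nat_add_left_cancel_less)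
            then have "int n < int (A * (n div A) + A)" by (simp only: of_nat_less_iff)
            then show ?thesis by (simp add: algebra_simps)
          qed
          ultimately have "int n < int (t N)" using t_ge[of N] by linarith
          then show False using m N by simp
        qed
        then show ?thesis using N by auto
      qed auto
    qed
    then have "card (branching_levels \<gamma> \<inter> {..<n}) \<le> card (insert 0 (t ` {..j0 + n div A}))"
      by (intro card_mono) auto
    also have "\<dots> \<le> Suc (card {..j0 + n div A})"
      by (rule order_trans[OF card_insert_le_m1]) (auto intro: card_image_le simp del: card_atMost)
    finally show ?thesis by simp
  qed
  then show ?thesis by blast
qed

text \<open>Only branching levels multiply the size of a sphere, so level \<open>n\<close> has at
  most \<open>k ^ (C + n div A)\<close> vertices, where \<open>A\<close> is arbitrary by sparsity:
  growth below every exponential rate.\<close>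

lemma Gamma_subexponential_tree:
  fixes G :: "'v \<Rightarrow> 'v \<Rightarrow> bool"
  assumes k: "k \<ge> 2" and \<gamma>: "\<gamma> > 1" and Gam: "is_Gamma k \<gamma> G r"
  shows "subexponential_tree G (k + 1)"
proof -
  interpret tree_graph G using Gam by unfold_locales (simp add: is_Gamma_def)
  have crd: "card (children r x) = (if d r x \<in> branching_levels \<gamma> then k else 1)" for x
    using Gam unfolding is_Gamma_def forward_neighbors_eq branching_levels_def
    by (auto simp: gdist_sym[of x r])
  have fin: "finite (children r x)" for x
    using crd[of x] k by (intro card_ge_0_finite) auto
  have finite_adj: "finite {y. G x y}" and card_adj: "card {y. G x y} \<le> k + 1" for x
  proof -
    show "finite {y. G x y}" unfolding adjacent_set[of x r] using fin by auto
    have "card {y. G x y} \<le> card (children r x) + card (if x = r then {} else {par r x})"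
      unfolding adjacent_set[of x r] by (rule card_Un_le)
    also have "\<dots> \<le> k + 1" using crd[of x] k by auto
    finally show "card {y. G x y} \<le> k + 1" .
  qed
  define S where "S n = {x. d r x = n}" for n
  have S_Suc: "S (Suc n) = (\<Union>x\<in>S n. children r x)" for n
  proof -
    have "x \<in> (\<Union>x\<in>S n. children r x)" if "d r x = Suc n" for x
    proof -
      have "x \<noteq> r" using that by auto
      then show ?thesis using that par[of x r] by (intro UN_I[of "par r x"]) (auto simp: S_def children_iff)
    qed
    then show ?thesis by (auto simp: S_def gdist_children)
  qed
  have S: "finite (S n) \<and> card (S n) \<le> k ^ card (branching_levels \<gamma> \<inter> {..<n})" for n
  proof (induction n)
    case 0
    have "S 0 = {r}" by (auto simp: S_def)
    then show ?case by simp
  next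
    case (Suc n)
    let ?B = "branching_levels \<gamma>"
    have "card (S (Suc n)) \<le> (\<Sum>x\<in>S n. card (children r x))"
      unfolding S_Suc using Suc by (intro card_UN_le) auto
    also have "\<dots> = card (S n) * (if n \<in> ?B then k else 1)" by (simp add: crd S_def)
    also have "\<dots> \<le> k ^ card (?B \<inter> {..<n}) * (if n \<in> ?B then k else 1)"
      using Suc by (intro mult_right_mono) auto
    also have "\<dots> = k ^ card (?B \<inter> {..<Suc n})"
    proof (cases "n \<in> ?B")
      case True
      then have "?B \<inter> {..<Suc n} = insert n (?B \<inter> {..<n})" by auto
      then show ?thesis using True by simp
    next
      case False
      then have "?B \<inter> {..<Suc n} = ?B \<inter> {..<n}" by (auto simp: less_Suc_eq)
      then show ?thesis using False by simp
    qed
    finally show ?case using Suc fin by (simp add: S_Suc)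
  qed
  have summable_r: "(\<lambda>x. \<tau> ^ d r x) summable_on UNIV" if \<tau>: "0 < \<tau>" "\<tau> < 1" for \<tau> :: real
  proof -
    \<comment> \<open>\<open>A\<close> is taken so large that the growth factor per level,
      \<open>k powr (1 / A)\<close>, stays below \<open>1 / \<tau>\<close>.\<close>
    have "(\<lambda>A. real k powr (1 / real A) * \<tau>) \<longlonglongrightarrow> real k powr 0 * \<tau>"
      using k by (intro tendsto_intros lim_1_over_n) auto
    then have "eventually (\<lambda>A. real k powr (1 / real A) * \<tau> < 1) sequentially"
      using \<tau> k by (intro order_tendstoD(2)) auto
    then have "eventually (\<lambda>A. real k powr (1 / real A) * \<tau> < 1 \<and> A > 0) sequentially"
      using eventually_gt_at_top by (rule eventually_conj)
    then obtain A where A: "real k powr (1 / real A) * \<tau> < 1" "A > 0"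
      using eventually_happens'[OF sequentially_bot] by blast
    obtain C where C: "\<And>n. card (branching_levels \<gamma> \<inter> {..<n}) \<le> C + n div A"
      using branching_levels_sparse[OF \<gamma> A(2)] by blast
    define q where "q = real k powr (1 / real A) * \<tau>"
    have q: "0 \<le> q" "q < 1" using A \<tau> by (auto simp: q_def)
    have level: "real (card (S n)) * \<tau> ^ n \<le> real k ^ C * q ^ n" for n
    proof -
      have "card (S n) \<le> k ^ (C + n div A)"
        using S[of n] power_increasing[OF C[of n], of k] k by linarith
      then have "real (card (S n)) \<le> real (k ^ (C + n div A))" by (simp only: of_nat_le_iff)
      also have "\<dots> = real k ^ C * real k powr real (n div A)"
        using k by (simp add: power_add powr_realpow)
      also have "\<dots> \<le> real k ^ C * real k powr (real n / real A)"
      proof (intro mult_left_mono powr_mono)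
        have "real (n div A * A) \<le> real n" by (simp only: of_nat_le_iff div_times_less_eq_dividend)
        then show "real (n div A) \<le> real n / real A" using A(2) by (simp add: le_divide_eq)
      qed (use k in auto)
      also have "real k powr (real n / real A) = (real k powr (1 / real A)) ^ n"
        using k by (subst powr_realpow[symmetric]) (auto simp: powr_powr)
      finally show ?thesis
        using \<tau> by (auto simp: q_def power_mult_distrib mult.assoc[symmetric] intro!: mult_right_mono)
    qed
    show ?thesis
    proof (rule nonneg_bdd_above_summable_on)
      show "bdd_above (sum (\<lambda>x. \<tau> ^ d r x) ` {F :: 'v set. F \<subseteq> UNIV \<and> finite F})"
      proof (rule bdd_aboveI2)
        fix F :: "'v set" assume "F \<in> {F :: 'v set. F \<subseteq> UNIV \<and> finite F}"
        then have F: "finite F" by simp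
        define n where "n = Max (insert 0 (d r ` F))"
        have "F \<subseteq> (\<Union>m\<in>{..n}. S m)"
          using F by (auto simp: S_def n_def)
        then have "(\<Sum>x\<in>F. \<tau> ^ d r x) \<le> (\<Sum>x\<in>(\<Union>m\<in>{..n}. S m). \<tau> ^ d r x)"
          using S \<tau> by (intro sum_mono2) auto
        also have "\<dots> = (\<Sum>m\<le>n. \<Sum>x\<in>S m. \<tau> ^ d r x)"
          using S by (intro sum.UNION_disjoint) (auto simp: S_def)
        also have "\<dots> = (\<Sum>m\<le>n. real (card (S m)) * \<tau> ^ m)"
          by (intro sum.cong) (auto simp: S_def)
        also have "\<dots> \<le> (\<Sum>m\<le>n. real k ^ C * q ^ m)" by (intro sum_mono level)
        also have "\<dots> \<le> (\<Sum>m. real k ^ C * q ^ m)"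
          using q by (intro sum_le_suminf summable_mult summable_geometric) auto
        finally show "(\<Sum>x\<in>F. \<tau> ^ d r x) \<le> (\<Sum>m. real k ^ C * q ^ m)" .
      qed
    qed (use \<tau> in auto)
  qed
  show ?thesis
  proof unfold_locales
    fix \<tau> :: real and rt assume \<tau>: "0 < \<tau>" "\<tau> < 1"
    show "(\<lambda>x. \<tau> ^ gdist G rt x) summable_on UNIV"
    proof (rule summable_on_comparison_test)
      show "(\<lambda>x. (1 / \<tau>) ^ d r rt * \<tau> ^ d r x) summable_on UNIV"
        by (intro summable_on_cmult_right summable_r \<tau>)
      fix x
      \<comment> \<open>Moving the root from \<open>r\<close> to \<open>rt\<close> costs a constant
        factor only.\<close>
      have "\<tau> ^ (d r rt + d rt x) \<le> \<tau> ^ d r x"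
        using \<tau> gdist_triangle[of r x rt] by (intro power_decreasing) auto
      then show "\<tau> ^ d rt x \<le> (1 / \<tau>) ^ d r rt * \<tau> ^ d r x"
        using \<tau> by (simp add: power_add power_divide field_simps)
    qed (use \<tau> in auto)
  qed (use finite_adj card_adj in auto)
qed

section \<open>Symmetric operators on finite sets\<close>

locale symmetric_finite_operator =
  fixes A :: "('v \<Rightarrow> complex) \<Rightarrow> 'v \<Rightarrow> complex" and X :: "'v set"
  assumes finite_X: "finite X"
    and A_add: "A (\<lambda>x. f x + g x) = (\<lambda>x. A f x + A g x)"
    and A_scale: "A (\<lambda>x. c * f x) = (\<lambda>x. c * A f x)"
    and A_support: "x \<notin> X \<Longrightarrow> A f x = 0"
    and A_symmetric: "(\<And>x. x \<notin> X \<Longrightarrow> f x = 0) \<Longrightarrow> (\<And>x. x \<notin> X \<Longrightarrow> g x = 0) \<Longrightarrow>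
      (\<Sum>x\<in>X. cnj (f x) * A g x) = (\<Sum>x\<in>X. cnj (A f x) * g x)"
begin

lemma A_diff: "A (\<lambda>x. f x - g x) = (\<lambda>x. A f x - A g x)"
  using A_add[of f "\<lambda>x. -1 * g x"] A_scale[of "-1" g] by simp

lemma A_zero: "A (\<lambda>x. 0) = (\<lambda>x. 0)"
  using A_scale[of 0 "\<lambda>x. 0"] by simp

lemma A_sum: "A (\<lambda>x. \<Sum>i\<in>I. f i x) = (\<lambda>x. \<Sum>i\<in>I. A (f i) x)"
  by (induction I rule: infinite_finite_induct) (auto simp: A_zero A_add)

definition ip :: "('v \<Rightarrow> complex) \<Rightarrow> ('v \<Rightarrow> complex) \<Rightarrow> complex" where
  "ip f g = (\<Sum>x\<in>X. cnj (f x) * g x)"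

definition supported :: "('v \<Rightarrow> complex) \<Rightarrow> bool" where
  "supported f \<longleftrightarrow> (\<forall>x. x \<notin> X \<longrightarrow> f x = 0)"

lemma ip_symmetric: "supported f \<Longrightarrow> supported g \<Longrightarrow> ip f (A g) = ip (A f) g"
  unfolding ip_def supported_def by (intro A_symmetric) auto

lemma ip_scale_right: "ip f (\<lambda>x. c * g x) = c * ip f g"
  by (simp add: ip_def sum_distrib_left mult_ac)

lemma ip_scale_left: "ip (\<lambda>x. c * f x) g = cnj c * ip f g"
  by (simp add: ip_def sum_distrib_left mult_ac)

lemma ip_diff_right: "ip f (\<lambda>x. g x - h x) = ip f g - ip f h"
  by (simp add: ip_def algebra_simps sum_subtractf)

lemma ip_self: "ip f f = complex_of_real (\<Sum>x\<in>X. (cmod (f x))\<^sup>2)"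
  unfolding ip_def of_real_sum complex_norm_square by (simp add: mult.commute)

lemma ip_self_eq_0: "supported f \<Longrightarrow> ip f f = 0 \<Longrightarrow> f = (\<lambda>x. 0)"
proof
  fix x assume f: "supported f" "ip f f = 0"
  then have "(\<Sum>x\<in>X. (cmod (f x))\<^sup>2) = 0" by (simp only: ip_self of_real_eq_0_iff)
  then show "f x = 0" using f(1) finite_X by (cases "x \<in> X") (auto simp: sum_nonneg_eq_0_iff supported_def)
qed

text \<open>The operator \<open>p(A)\<close> applied to \<open>f\<close>.\<close>

definition act :: "complex poly \<Rightarrow> ('v \<Rightarrow> complex) \<Rightarrow> 'v \<Rightarrow> complex" where
  "act p f x = (\<Sum>i\<le>degree p. coeff p i * (A ^^ i) f x)"

lemma act_extend: "degree p \<le> n \<Longrightarrow> act p f x = (\<Sum>i\<le>n. coeff p i * (A ^^ i) f x)"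
  unfolding act_def by (intro sum.mono_neutral_left) (auto simp: coeff_eq_0)

lemma act_add: "act (p + q) f x = act p f x + act q f x"
proof -
  let ?n = "max (degree p) (degree q)"
  have "degree (p + q) \<le> ?n" by (rule degree_add_le_max)
  then show ?thesis
    by (simp add: act_extend[of _ ?n] sum.distrib distrib_right)
qed

lemma act_smult: "act (smult c p) f x = c * act p f x"
  by (simp add: act_extend[of _ "degree p"] degree_smult_le sum_distrib_left mult.assoc)

lemma act_pCons_0: "act (pCons 0 p) f x = A (act p f) x"
proof -
  have "A (act p f) = A (\<lambda>x. \<Sum>i\<le>degree p. coeff p i * (A ^^ i) f x)"
    by (simp add: act_def[abs_def])
  also have "\<dots> = (\<lambda>x. \<Sum>i\<le>degree p. coeff p i * (A ^^ Suc i) f x)"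
    by (simp add: A_sum A_scale)
  finally show ?thesis
    by (simp add: act_extend[of _ "Suc (degree p)"] degree_pCons_le sum.atMost_Suc_shift del: sum.atMost_Suc)
qed

lemma act_linear_factor: "act ([:- l, 1:] * p) f = (\<lambda>x. A (act p f) x - l * act p f x)"
proof
  fix x
  have "[:- l, 1:] * p = smult (- l) p + pCons 0 p" by simp
  then have "act ([:- l, 1:] * p) f x = act (smult (- l) p + pCons 0 p) f x" by (rule arg_cong)
  then show "act ([:- l, 1:] * p) f x = A (act p f) x - l * act p f x"
    unfolding act_add act_smult act_pCons_0 by simp
qed

lemma supported_act: "supported f \<Longrightarrow> supported (act p f)"
proof -
  assume f: "supported f"
  have "(A ^^ i) f x = 0" if "x \<notin> X" for i x
    using f that by (cases i) (auto simp: supported_def A_support)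
  then show ?thesis by (simp add: supported_def act_def)
qed

lemma funpow_diff: "(A ^^ i) (\<lambda>x. f x - g x) = (\<lambda>x. (A ^^ i) f x - (A ^^ i) g x)"
  by (induction i) (auto simp: A_diff)

lemma act_diff: "act p (\<lambda>x. f x - g x) = (\<lambda>x. act p f x - act p g x)"
  by (simp add: act_def[abs_def] funpow_diff sum_subtractf right_diff_distrib)

lemma act_eigen:
  assumes "A g = (\<lambda>x. l * g x)"
  shows "act p g = (\<lambda>x. poly p l * g x)"
proof -
  have "(A ^^ i) g = (\<lambda>x. l ^ i * g x)" for i
    by (induction i) (auto simp: A_scale assms)
  then show ?thesis
    by (simp add: act_def[abs_def] poly_altdef sum_distrib_right mult.assoc)
qed

text \<open>Takes the place of a dimension count. Prescribing that low coefficients vanish yields,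
  for each new point \<open>y\<close>, a second polynomial of strictly larger degree than the first;
  a combination of the two cancels the value at \<open>y\<close> and is still nonzero.\<close>

lemma ex_annihilating_on:
  assumes "finite S"
  shows "\<exists>p. p \<noteq> 0 \<and> (\<forall>i<m. coeff p i = 0) \<and> (\<forall>x\<in>S. act p f x = 0)"
  using assms
proof (induction S arbitrary: m)
  case empty
  show ?case by (intro exI[of _ "monom 1 m"]) auto
next
  case (insert y S)
  obtain p where p: "p \<noteq> 0" "\<forall>i<m. coeff p i = 0" "\<forall>x\<in>S. act p f x = 0" using insert.IH by blast
  obtain q where q: "q \<noteq> 0" "\<forall>i<max m (Suc (degree p)). coeff q i = 0" "\<forall>x\<in>S. act q f x = 0"
    using insert.IH by blast
  show ?case
  proof (cases "act p f y = 0")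
    case True then show ?thesis using p by auto
  next
    case False
    define s where "s = - act q f y / act p f y"
    let ?r = "q + smult s p"
    have "coeff q (degree p) = 0" using q(2) by auto
    have "?r \<noteq> 0"
    proof
      assume "?r = 0"
      then have "coeff ?r (degree q) = 0" by simp
      moreover have "degree q > degree p" using q(1,2) by (metis leading_coeff_0_iff lessI less_max_iff_disj linorder_neqE_nat not_less_eq order_less_trans)
      ultimately show False using q(1) by (simp add: coeff_eq_0)
    qed
    moreover have "\<forall>i<m. coeff ?r i = 0" using p q by auto
    moreover have "act ?r f x = 0" if "x \<in> insert y S" for x
      unfolding act_add act_smult using that p q False by (auto simp: s_def)
    ultimately show ?thesis by blast
  qed
qed

definition decomposable :: "('v \<Rightarrow> complex) \<Rightarrow> bool" where
  "decomposable f \<longleftrightarrow> (\<exists>S w. finite (S :: real set) \<and>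
     (\<forall>e. supported (w e) \<and> A (w e) = (\<lambda>x. complex_of_real e * w e x)) \<and> f = (\<lambda>x. \<Sum>e\<in>S. w e x))"

text \<open>One root \<open>l\<close> of \<open>p\<close> is split off at a time. With
  \<open>p'\<close> the cofactor, \<open>g = p'(A) f\<close> is an eigenvector for \<open>l\<close>;
  removing a suitable multiple of \<open>g\<close> from \<open>f\<close> leaves a vector annihilated
  by \<open>p'\<close>.\<close>

lemma decomposable_if_annihilated:
  assumes "p \<noteq> 0" "supported f" "act p f = (\<lambda>x. 0)"
  shows "decomposable f"
  using assms
proof (induction "degree p" arbitrary: p f)
  case 0
  then obtain c where "p = [:c:]" "c \<noteq> 0" by (metis degree_eq_zeroE pCons_eq_0_iff)
  then have "f = (\<lambda>x. 0)" using 0 by (auto simp: act_def fun_eq_iff)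
  then show ?case
    unfolding decomposable_def by (intro exI[of _ "{}"] exI[of _ "\<lambda>_ _. 0"]) (auto simp: supported_def A_zero)
next
  case (Suc n)
  obtain l where "poly p l = 0"
    using fundamental_theorem_of_algebra_alt[of p] Suc(2) Suc.prems(1) by (metis degree_pCons_0 nat.distinct(1) pCons_0_0 degree_0)
  then obtain p' where p': "p = [:- l, 1:] * p'" by (metis dvdE poly_eq_0_iff_dvd)
  have p'0: "p' \<noteq> 0" using Suc.prems(1) p' by auto
  have deg: "degree p' = n" using Suc(2) p'0 unfolding p' by (subst (asm) degree_mult_eq) auto
  define g where "g = act p' f"
  have gs: "supported g" unfolding g_def using Suc.prems(2) by (rule supported_act)
  have "(\<lambda>x. A g x - l * g x) = (\<lambda>x. 0)"
    using Suc.prems(3) unfolding p' act_linear_factor g_def .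
  then have Ag: "A g = (\<lambda>x. l * g x)" by (metis (no_types, lifting) eq_iff_diff_eq_0)
  show ?case
  proof (cases "g = (\<lambda>x. 0)")
    case True
    then show ?thesis using Suc(1)[OF deg[symmetric] p'0 Suc.prems(2)] by (simp add: g_def)
  next
    case False
    have nz: "ip g g \<noteq> 0" using ip_self_eq_0[OF gs] False by auto
    have "l * ip g g = cnj l * ip g g"
      using ip_symmetric[OF gs gs] by (simp add: Ag ip_scale_left ip_scale_right)
    then have "cnj l = l" using nz by simp
    then obtain e where e: "l = complex_of_real e" by (metis Reals_cases Reals_cnj_iff)
    \<comment> \<open>At a double root, \<open>g = (A - l) h\<close> for some \<open>h\<close>. As
      \<open>l\<close> is real, symmetry moves \<open>A - l\<close> onto \<open>g\<close>, where it
      gives zero, so \<open>g\<close> would be orthogonal to itself.\<close>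
    have c: "poly p' l \<noteq> 0"
    proof
      assume "poly p' l = 0"
      then obtain p'' where p'': "p' = [:- l, 1:] * p''" by (metis dvdE poly_eq_0_iff_dvd)
      define h where "h = act p'' f"
      have hs: "supported h" unfolding h_def using Suc.prems(2) by (rule supported_act)
      have gh: "g = (\<lambda>x. A h x - l * h x)" unfolding g_def p'' act_linear_factor h_def ..
      have "ip g g = ip g (A h) - l * ip g h"
        by (subst (2) gh) (simp add: ip_diff_right ip_scale_right)
      also have "ip g (A h) = l * ip g h"
        using ip_symmetric[OF gs hs] by (simp add: Ag ip_scale_left \<open>cnj l = l\<close>)
      finally show False using nz by simp
    qed
    \<comment> \<open>Scaled so that \<open>p'(A) h = g\<close>.\<close>
    define h where "h = (\<lambda>x. inverse (poly p' l) * g x)"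
    have hs: "supported h" using gs by (auto simp: h_def supported_def)
    have Ah: "A h = (\<lambda>x. complex_of_real e * h x)" unfolding h_def A_scale Ag e by (simp add: mult_ac)
    have "act p' h = g" unfolding act_eigen[OF Ah[folded e]] using c by (auto simp: h_def fun_eq_iff)
    then have "act p' (\<lambda>x. f x - h x) = (\<lambda>x. 0)" by (simp add: act_diff g_def)
    moreover have "supported (\<lambda>x. f x - h x)" using Suc.prems(2) hs by (auto simp: supported_def)
    ultimately have "decomposable (\<lambda>x. f x - h x)" using Suc(1)[OF deg[symmetric] p'0] by blast
    then obtain S w where S: "finite S" "\<And>e. supported (w e)" "\<And>e. A (w e) = (\<lambda>x. complex_of_real e * w e x)"
      "(\<lambda>x. f x - h x) = (\<lambda>x. \<Sum>e\<in>S. w e x)" unfolding decomposable_def by blast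
    define w' where "w' e' = (\<lambda>x. (if e' \<in> S then w e' x else 0) + (if e' = e then h x else 0))" for e'
    have "supported (w' e') \<and> A (w' e') = (\<lambda>x. complex_of_real e' * w' e' x)" for e'
      using S(2,3)[of e'] hs Ah
      by (cases "e' \<in> S"; cases "e' = e") (simp_all add: w'_def supported_def A_add A_zero distrib_left)
    moreover have "f = (\<lambda>x. \<Sum>e'\<in>insert e S. w' e' x)"
    proof
      fix x
      have "(\<Sum>e'\<in>insert e S. w' e' x) = (\<Sum>e'\<in>insert e S. if e' \<in> S then w e' x else 0) + (\<Sum>e'\<in>insert e S. if e' = e then h x else 0)"
        by (simp add: w'_def sum.distrib del: sum.insert)
      also have "(\<Sum>e'\<in>insert e S. if e' \<in> S then w e' x else 0) = (\<Sum>e'\<in>S. w e' x)"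
        using S(1) by (intro sum.mono_neutral_cong_right) auto
      also have "(\<Sum>e'\<in>insert e S. if e' = e then h x else 0) = h x"
        using S(1) by (simp del: sum.insert)
      finally show "f x = (\<Sum>e'\<in>insert e S. w' e' x)" using fun_cong[OF S(4), of x] by (simp add: diff_eq_eq)
    qed
    ultimately show ?thesis
      unfolding decomposable_def using S(1) by (intro exI[of _ "insert e S"] exI[of _ w']) auto
  qed
qed

text \<open>A generalized eigenvector of a symmetric operator is an eigenvector, so the annihilating
  polynomial of \<open>f\<close> splits into distinct real linear factors.\<close>

lemma eigen_decomposition:
  assumes f: "supported f"
  obtains S w where "finite S" "\<And>e. supported (w e)" "\<And>e. A (w e) = (\<lambda>x. complex_of_real e * w e x)"
    "f = (\<lambda>x. \<Sum>e\<in>S. w e x)" "\<And>e e'. e \<noteq> e' \<Longrightarrow> ip (w e) (w e') = 0"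
proof -
  obtain p where p: "p \<noteq> 0" "\<forall>x\<in>X. act p f x = 0"
    using ex_annihilating_on[OF finite_X, of 0 f] by blast
  have "act p f = (\<lambda>x. 0)"
    using p(2) supported_act[OF f, of p] by (auto simp: supported_def)
  from decomposable_if_annihilated[OF p(1) f this] obtain S w where
    S: "finite S" "\<And>e. supported (w e)" "\<And>e. A (w e) = (\<lambda>x. complex_of_real e * w e x)"
    "f = (\<lambda>x. \<Sum>e\<in>S. w e x)" unfolding decomposable_def by blast
  have "ip (w e) (w e') = 0" if "e \<noteq> e'" for e e'
  proof -
    have "complex_of_real e' * ip (w e) (w e') = complex_of_real e * ip (w e) (w e')"
      using ip_symmetric[OF S(2) S(2), of e e'] by (simp add: S(3) ip_scale_left ip_scale_right)
    then show ?thesis using that by simp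
  qed
  with S show thesis by (rule that)
qed

end

section \<open>Green functions of a ball\<close>

context subexponential_tree
begin

definition hop :: "('v \<Rightarrow> real) \<Rightarrow> ('v \<Rightarrow> complex) \<Rightarrow> 'v \<Rightarrow> complex" where
  "hop q f x = (\<Sum>y | G x y. f y) + complex_of_real (q x) * f x"

abbreviation ball :: "'v \<Rightarrow> nat \<Rightarrow> 'v set" where
  "ball rt L \<equiv> {x. d rt x \<le> L}"

definition cut :: "('v \<Rightarrow> real) \<Rightarrow> 'v set \<Rightarrow> ('v \<Rightarrow> complex) \<Rightarrow> 'v \<Rightarrow> complex" where
  "cut q X f x = (if x \<in> X then hop q f x else 0)"

lemma symmetric_finite_operator_cut:
  assumes X: "finite X"
  shows "symmetric_finite_operator (cut q X) X"
proof
  fix f g :: "'v \<Rightarrow> complex"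
  assume f: "\<And>x. x \<notin> X \<Longrightarrow> f x = 0" and g: "\<And>x. x \<notin> X \<Longrightarrow> g x = 0"
  have nb: "(\<Sum>y | G x y. h y) = (\<Sum>y\<in>X. if G x y then h y else 0)" if "\<And>x. x \<notin> X \<Longrightarrow> h x = 0" for x and h :: "'v \<Rightarrow> complex"
  proof -
    have "(\<Sum>y | G x y. h y) = (\<Sum>y\<in>{y. G x y} \<inter> X. h y)"
      using finite_adj that by (intro sum.mono_neutral_right) auto
    also have "\<dots> = (\<Sum>y\<in>X. if G x y then h y else 0)"
      using X by (simp add: sum.inter_filter[symmetric] Int_def conj_commute)
    finally show ?thesis .
  qed
  have "(\<Sum>x\<in>X. cnj (f x) * (\<Sum>y | G x y. g y)) = (\<Sum>x\<in>X. \<Sum>y\<in>X. if G x y then cnj (f x) * g y else 0)"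
  proof (intro sum.cong refl)
    fix x
    have "cnj (f x) * (\<Sum>y | G x y. g y) = cnj (f x) * (\<Sum>y\<in>X. if G x y then g y else 0)"
      by (subst nb[OF g]) auto
    also have "\<dots> = (\<Sum>y\<in>X. if G x y then cnj (f x) * g y else 0)"
      unfolding sum_distrib_left by (intro sum.cong) auto
    finally show "cnj (f x) * (\<Sum>y | G x y. g y) = (\<Sum>y\<in>X. if G x y then cnj (f x) * g y else 0)" .
  qed
  also have "\<dots> = (\<Sum>y\<in>X. \<Sum>x\<in>X. if G y x then cnj (f x) * g y else 0)"
    by (subst sum.swap) (intro sum.cong refl, auto dest: G_sym)
  also have "\<dots> = (\<Sum>y\<in>X. cnj (\<Sum>x | G y x. f x) * g y)"
  proof (intro sum.cong refl)
    fix y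
    have "cnj (\<Sum>x | G y x. f x) * g y = cnj (\<Sum>x\<in>X. if G y x then f x else 0) * g y"
      by (subst nb[OF f]) auto
    also have "\<dots> = (\<Sum>x\<in>X. if G y x then cnj (f x) * g y else 0)"
      unfolding cnj_sum sum_distrib_right by (intro sum.cong) auto
    finally show "(\<Sum>x\<in>X. if G y x then cnj (f x) * g y else 0) = cnj (\<Sum>x | G y x. f x) * g y" ..
  qed
  finally show "(\<Sum>x\<in>X. cnj (f x) * cut q X g x) = (\<Sum>x\<in>X. cnj (cut q X f x) * g x)"
    by (simp add: cut_def hop_def algebra_simps sum.distrib)
qed (auto simp: X cut_def hop_def algebra_simps sum.distrib sum_distrib_left)

text \<open>For \<open>E\<close> outside an exceptional set, \<open>ratio rt q E n z\<close> is the quotient of the values at the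
  parent of \<open>z\<close> and at \<open>z\<close> of a solution on the subtree below \<open>z\<close> cut off \<open>n\<close> levels further
  down; at the root it is the inverse of the diagonal Green function.  The junk value
  \<open>inverse 0 = 0\<close> only occurs on the exceptional set.\<close>

primrec ratio :: "'v \<Rightarrow> ('v \<Rightarrow> real) \<Rightarrow> real \<Rightarrow> nat \<Rightarrow> 'v \<Rightarrow> real" where
  "ratio rt q E 0 z = E - q z"
| "ratio rt q E (Suc n) z = E - q z - (\<Sum>c\<in>children rt z. inverse (ratio rt q E n c))"

definition ratio_in :: "'v \<Rightarrow> ('v \<Rightarrow> real) \<Rightarrow> nat \<Rightarrow> real \<Rightarrow> 'v \<Rightarrow> real" where
  "ratio_in rt q L E z = ratio rt q E (L - d rt z) z"

text \<open>Under this condition all inverses of quotients in the ball are true inverses. For almost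
  every potential it holds at almost every energy (\<open>AE_regular\<close>).\<close>

definition regular :: "'v \<Rightarrow> ('v \<Rightarrow> real) \<Rightarrow> nat \<Rightarrow> real \<Rightarrow> bool" where
  "regular rt q L E \<longleftrightarrow> (\<forall>z\<in>ball rt L. ratio_in rt q L E z \<noteq> 0)"

text \<open>The Green function at \<open>y\<close> relative to its value at the root: the product
  runs over the path from \<open>y\<close> upwards and leaves out the root.\<close>

definition path_weight :: "'v \<Rightarrow> ('v \<Rightarrow> real) \<Rightarrow> nat \<Rightarrow> real \<Rightarrow> 'v \<Rightarrow> real" where
  "path_weight rt q L E y = (\<Prod>i<d rt y. inverse (ratio_in rt q L E ((par rt ^^ i) y)))"

definition green :: "'v \<Rightarrow> ('v \<Rightarrow> real) \<Rightarrow> nat \<Rightarrow> real \<Rightarrow> 'v \<Rightarrow> real" where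
  "green rt q L E y = (if d rt y \<le> L then inverse (ratio_in rt q L E rt) * path_weight rt q L E y else 0)"

lemma path_weight_root [simp]: "path_weight rt q L E rt = 1"
  by (simp add: path_weight_def)

lemma path_weight_child:
  assumes "c \<in> children rt z"
  shows "path_weight rt q L E c = inverse (ratio_in rt q L E c) * path_weight rt q L E z"
proof -
  have "d rt c = Suc (d rt z)" "par rt c = z" using assms by (auto simp: gdist_children children_iff)
  then show ?thesis unfolding path_weight_def by (simp add: prod.lessThan_Suc_shift funpow_swap1 del: prod.lessThan_Suc)
qed

lemma ratio_in_expand:
  assumes "d rt z \<le> L"
  shows "ratio_in rt q L E z = E - q z - (\<Sum>c\<in>children rt z. if d rt c \<le> L then inverse (ratio_in rt q L E c) else 0)"
proof (cases "d rt z = L")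
  case True
  then have "(\<Sum>c\<in>children rt z. if d rt c \<le> L then inverse (ratio_in rt q L E c) else 0) = 0"
    by (intro sum.neutral) (auto simp: gdist_children)
  then show ?thesis using True by (simp add: ratio_in_def)
next
  case False
  then have "L - d rt z = Suc (L - Suc (d rt z))" using assms by simp
  then have "ratio_in rt q L E z = E - q z - (\<Sum>c\<in>children rt z. inverse (ratio rt q E (L - Suc (d rt z)) c))"
    by (simp add: ratio_in_def)
  also have "(\<Sum>c\<in>children rt z. inverse (ratio rt q E (L - Suc (d rt z)) c)) =
      (\<Sum>c\<in>children rt z. if d rt c \<le> L then inverse (ratio_in rt q L E c) else 0)"
    using False assms by (intro sum.cong) (auto simp: gdist_children ratio_in_def)
  finally show ?thesis .
qed

lemma sum_adjacent:
  fixes f :: "'v \<Rightarrow> 'b :: comm_monoid_add"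
  shows "(\<Sum>y | G x y. f y) = (\<Sum>c\<in>children rt x. f c) + (if x = rt then 0 else f (par rt x))"
  unfolding adjacent_set[of x rt] by (subst sum.union_disjoint) (auto simp: par_notin_children)

text \<open>At \<open>z\<close> only children and the parent enter. By the recursion, the children
  together contribute \<open>E - q z - u\<close> times the value at \<open>z\<close>, where
  \<open>u\<close> is the quotient there, and \<open>u\<close> times this value is the value at the
  parent, or 1 at the root.\<close>

lemma green_equation:
  assumes reg: "regular rt q L E" and z: "d rt z \<le> L"
  shows "E * green rt q L E z - ((\<Sum>y | G z y. green rt q L E y) + q z * green rt q L E z) = (if z = rt then 1 else 0)"
proof -
  let ?g = "green rt q L E" and ?u = "ratio_in rt q L E"
  have u: "?u z \<noteq> 0" using reg z by (auto simp: regular_def)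
  have "(\<Sum>c\<in>children rt z. ?g c) = (\<Sum>c\<in>children rt z. (if d rt c \<le> L then inverse (?u c) else 0)) * ?g z"
    unfolding sum_distrib_right using z
    by (intro sum.cong refl) (auto simp: green_def path_weight_child)
  also have "\<dots> = (E - q z - ?u z) * ?g z" using ratio_in_expand[OF z, of q E] by simp
  finally have c: "(\<Sum>c\<in>children rt z. ?g c) = (E - q z - ?u z) * ?g z" .
  have p: "?u z * ?g z = (if z = rt then 1 else ?g (par rt z))"
  proof (cases "z = rt")
    case True then show ?thesis using u by (simp add: green_def)
  next
    case False
    then have "z \<in> children rt (par rt z)" "d rt (par rt z) \<le> L" using par[of z rt] z by (auto simp: children_iff)
    then show ?thesis using u z False by (auto simp: green_def path_weight_child)
  qed
  show ?thesis unfolding sum_adjacent[of ?g z rt] c using p by (auto simp: algebra_simps)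
qed

text \<open>From the leaves upwards, the quotient at a vertex times the value there is the value at
  the parent, or 0 at the root. From the root downwards all values then vanish.\<close>

lemma regular_unique:
  assumes reg: "regular rt q L E"
    and supp: "\<And>z. \<not> d rt z \<le> L \<Longrightarrow> h z = 0"
    and eq: "\<And>z. d rt z \<le> L \<Longrightarrow> complex_of_real E * h z - hop q h z = 0"
  shows "h z = 0"
proof -
  let ?u = "\<lambda>z. complex_of_real (ratio_in rt q L E z)"
  have u: "?u z \<noteq> 0" if "d rt z \<le> L" for z using reg that by (auto simp: regular_def)
  have step: "?u z * h z = (if z = rt then 0 else h (par rt z))" if "d rt z \<le> L" for z
    using that
  proof (induction "L - d rt z" arbitrary: z rule: less_induct)
    case less
    have ch: "h c = (if d rt c \<le> L then inverse (?u c) else 0) * h z" if c: "c \<in> children rt z" for c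
    proof (cases "d rt c \<le> L")
      case True
      then have "?u c * h c = (if c = rt then 0 else h (par rt c))"
        using c by (intro less.hyps) (auto simp: gdist_children)
      then have "?u c * h c = h z" using c by (auto simp: children_iff)
      then show ?thesis using True u[OF True] by (auto simp: field_simps)
    qed (use supp in auto)
    have "(\<Sum>c\<in>children rt z. h c) = (\<Sum>c\<in>children rt z. (if d rt c \<le> L then inverse (?u c) else 0)) * h z"
      unfolding sum_distrib_right using ch by (intro sum.cong) auto
    also have "(\<Sum>c\<in>children rt z. (if d rt c \<le> L then inverse (?u c) else 0)) =
        complex_of_real (\<Sum>c\<in>children rt z. (if d rt c \<le> L then inverse (ratio_in rt q L E c) else 0))"
      by (simp add: if_distrib[of complex_of_real] cong: if_cong)
    also have "\<dots> = complex_of_real (E - q z - ratio_in rt q L E z)"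
      using ratio_in_expand[OF less.prems, of q E] by simp
    finally have "(\<Sum>c\<in>children rt z. h c) = (complex_of_real E - complex_of_real (q z) - ?u z) * h z" by simp
    then show ?case
      using eq[OF less.prems] unfolding hop_def sum_adjacent[of h z rt] by (auto simp: algebra_simps)
  qed
  have "h z = 0" if "d rt z \<le> L" for z
    using that
  proof (induction "d rt z" arbitrary: z)
    case 0
    then have "z = rt" by (metis gdist_eq_0)
    then show ?case using step[OF 0(2)] u[OF 0(2)] by simp
  next
    case (Suc n)
    then have "z \<noteq> rt" by auto
    then have "h (par rt z) = 0" using Suc par(2)[of z rt] by auto
    then show ?case using step[OF Suc.prems] u[OF Suc.prems] \<open>z \<noteq> rt\<close> by auto
  qed
  then show ?thesis using supp by blast
qed

end

context subexponential_tree
begin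

section \<open>Spectral decomposition of the root vector in a ball\<close>

definition mass :: "'v \<Rightarrow> nat \<Rightarrow> ('v \<Rightarrow> complex) \<Rightarrow> real" where
  "mass rt L f = (\<Sum>x\<in>ball rt L. (cmod (f x))\<^sup>2)"

text \<open>For \<open>e\<close> in \<open>S\<close>, \<open>w e\<close> is the projection of
  \<open>delta rt\<close> to the eigenspace of \<open>e\<close>, not normalized: its value at the
  root is its squared norm, and its modulus at \<open>y\<close> is the eigenfunction correlator of
  \<open>rt\<close> and \<open>y\<close>. Multiple eigenvalues need no separate treatment in this
  form.\<close>

definition ball_eigen :: "'v \<Rightarrow> ('v \<Rightarrow> real) \<Rightarrow> nat \<Rightarrow> real set \<Rightarrow> (real \<Rightarrow> 'v \<Rightarrow> complex) \<Rightarrow> bool" where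
  "ball_eigen rt q L S w \<longleftrightarrow> finite S \<and>
     (\<forall>e z. \<not> d rt z \<le> L \<longrightarrow> w e z = 0) \<and>
     (\<forall>e z. d rt z \<le> L \<longrightarrow> hop q (w e) z = complex_of_real e * w e z) \<and>
     (\<forall>x. delta rt x = (\<Sum>e\<in>S. w e x)) \<and>
     (\<forall>e e'. e \<noteq> e' \<longrightarrow> (\<Sum>x\<in>ball rt L. cnj (w e x) * w e' x) = 0) \<and>
     (\<forall>e\<in>S. mass rt L (w e) > 0 \<and> w e rt = complex_of_real (mass rt L (w e)))"

lemma ball_eigen_exists: "\<exists>S w. ball_eigen rt q L S w"
proof -
  interpret symmetric_finite_operator "cut q (ball rt L)" "ball rt L"
    by (rule symmetric_finite_operator_cut) (rule finite_ball)
  have sup: "supported (delta rt)" by (auto simp: supported_def delta_def)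
  obtain S w where S: "finite S" "\<And>e. supported (w e)"
    "\<And>e. cut q (ball rt L) (w e) = (\<lambda>x. complex_of_real e * w e x)"
    "delta rt = (\<lambda>x. \<Sum>e\<in>S. w e x)" "\<And>e e'. e \<noteq> e' \<Longrightarrow> ip (w e) (w e') = 0"
    using eigen_decomposition[OF sup] by blast
  \<comment> \<open>Zero components are dropped so that all masses are positive.\<close>
  define S' where "S' = {e \<in> S. w e \<noteq> (\<lambda>x. 0)}"
  have ip_mass: "ip f f = complex_of_real (mass rt L f)" for f
    unfolding ip_self mass_def ..
  have S': "delta rt x = (\<Sum>e\<in>S'. w e x)" for x
  proof -
    have "(\<Sum>e\<in>S'. w e x) = (\<Sum>e\<in>S. w e x)"
      using S(1) unfolding S'_def by (intro sum.mono_neutral_left) (auto simp: fun_eq_iff)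
    then show ?thesis using S(4) by simp
  qed
  have "ball_eigen rt q L S' w"
    unfolding ball_eigen_def
  proof (intro conjI allI impI ballI)
    show "finite S'" using S(1) by (simp add: S'_def)
    show "w e z = 0" if "\<not> d rt z \<le> L" for e z using S(2)[of e] that by (auto simp: supported_def)
    show "hop q (w e) z = complex_of_real e * w e z" if "d rt z \<le> L" for e z
      using fun_cong[OF S(3), of e z] that by (simp add: cut_def)
    show "delta rt x = (\<Sum>e\<in>S'. w e x)" for x by (rule S')
    show "(\<Sum>x\<in>ball rt L. cnj (w e x) * w e' x) = 0" if "e \<noteq> e'" for e e'
      using S(5)[OF that] by (simp add: ip_def)
    fix e assume e: "e \<in> S'"
    have "ip (w e) (w e) \<noteq> 0" using ip_self_eq_0[OF S(2)[of e]] e by (auto simp: S'_def)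
    then have "mass rt L (w e) \<noteq> 0" by (simp add: ip_mass)
    then show "mass rt L (w e) > 0" by (simp add: mass_def sum_nonneg less_le)
    \<comment> \<open>Pairing with \<open>delta rt\<close> gives the value at the root and, by
      orthogonality, also the squared norm.\<close>
    have "ip (w e) (delta rt) = (\<Sum>e'\<in>S'. ip (w e) (w e'))"
      unfolding ip_def S' sum_distrib_left by (rule sum.swap)
    also have "\<dots> = (\<Sum>e'\<in>S'. if e' = e then ip (w e) (w e) else 0)"
      using S(5) by (intro sum.cong) auto
    also have "\<dots> = ip (w e) (w e)" using e S(1) by (simp add: S'_def)
    finally have "cnj (w e rt) = complex_of_real (mass rt L (w e))"
      unfolding ip_mass by (simp add: ip_def delta_def if_distrib finite_ball cong: if_cong)
    then show "w e rt = complex_of_real (mass rt L (w e))" by (metis complex_cnj_cnj complex_cnj_complex_of_real)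
  qed
  then show ?thesis by blast
qed

lemma mass_orthogonal_sum:
  assumes be: "ball_eigen rt q L S w" and S': "S' \<subseteq> S"
  shows "mass rt L (\<lambda>x. \<Sum>e\<in>S'. complex_of_real (c e) * w e x) = (\<Sum>e\<in>S'. (c e)\<^sup>2 * mass rt L (w e))"
proof -
  have fin: "finite S'" using be S' by (auto simp: ball_eigen_def intro: finite_subset)
  have "complex_of_real (mass rt L (\<lambda>x. \<Sum>e\<in>S'. complex_of_real (c e) * w e x))
     = (\<Sum>x\<in>ball rt L. \<Sum>e\<in>S'. \<Sum>e'\<in>S'. complex_of_real (c e) * complex_of_real (c e') * (cnj (w e x) * w e' x))"
    unfolding mass_def of_real_sum complex_norm_square
    by (intro sum.cong refl) (simp add: sum_product, subst sum.swap, simp add: mult_ac)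
  also have "\<dots> = (\<Sum>e\<in>S'. \<Sum>e'\<in>S'. complex_of_real (c e) * complex_of_real (c e') * (\<Sum>x\<in>ball rt L. cnj (w e x) * w e' x))"
    by (subst sum.swap, intro sum.cong refl, subst sum.swap) (simp add: sum_distrib_left)
  also have "\<dots> = (\<Sum>e\<in>S'. \<Sum>e'\<in>S'. if e' = e then complex_of_real ((c e)\<^sup>2 * mass rt L (w e)) else 0)"
  proof (intro sum.cong refl)
    fix e e'
    have "complex_of_real (mass rt L (w e)) = (\<Sum>x\<in>ball rt L. cnj (w e x) * w e x)"
      unfolding mass_def of_real_sum complex_norm_square by (simp add: mult.commute)
    then show "complex_of_real (c e) * complex_of_real (c e') * (\<Sum>x\<in>ball rt L. cnj (w e x) * w e' x)
        = (if e' = e then complex_of_real ((c e)\<^sup>2 * mass rt L (w e)) else 0)"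
      using be by (auto simp: ball_eigen_def power2_eq_square)
  qed
  also have "\<dots> = complex_of_real (\<Sum>e\<in>S'. (c e)\<^sup>2 * mass rt L (w e))" using fin by simp
  finally show ?thesis by (simp only: of_real_eq_iff)
qed

lemma ball_eigen_total_mass:
  assumes be: "ball_eigen rt q L S w" shows "(\<Sum>e\<in>S. mass rt L (w e)) = 1"
proof -
  have "complex_of_real (\<Sum>e\<in>S. mass rt L (w e)) = (\<Sum>e\<in>S. w e rt)"
    using be by (simp add: ball_eigen_def)
  also have "\<dots> = delta rt rt" using be by (simp add: ball_eigen_def)
  finally show ?thesis unfolding delta_def by (simp add: of_real_eq_1_iff del: of_real_sum)
qed

text \<open>The sum is the squared norm in the ball of the operator applied to
  \<open>delta rt\<close>, whose entries are 1 at the neighbours and \<open>q rt\<close> at the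
  root. By Chebyshev it bounds the mass at high energies independently of \<open>L\<close>.\<close>

lemma ball_eigen_energy:
  assumes be: "ball_eigen rt q L S w"
  shows "(\<Sum>e\<in>S. e\<^sup>2 * mass rt L (w e)) \<le> real Dmax + (q rt)\<^sup>2"
proof -
  have eq: "(\<Sum>e\<in>S. complex_of_real e * w e x) = hop q (delta rt) x" if "d rt x \<le> L" for x
  proof -
    have "(\<Sum>e\<in>S. complex_of_real e * w e x) = (\<Sum>e\<in>S. hop q (w e) x)"
      using be that by (auto simp: ball_eigen_def intro!: sum.cong)
    also have "\<dots> = hop q (\<lambda>x. \<Sum>e\<in>S. w e x) x"
      by (simp add: hop_def sum.distrib sum_distrib_left, subst sum.swap, simp)
    also have "(\<lambda>x. \<Sum>e\<in>S. w e x) = delta rt" using be by (auto simp: ball_eigen_def)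
    finally show ?thesis .
  qed
  have adj: "(\<Sum>y | G x y. delta rt y) = (if G x rt then 1 else 0)" for x
    using finite_adj[of x] by (simp add: delta_def)
  have pt: "(cmod (hop q (delta rt) x))\<^sup>2 = (if G rt x then 1 else 0) + (if x = rt then (q rt)\<^sup>2 else 0)" for x
    unfolding hop_def adj by (auto simp: delta_def G_sym dest: G_sym)
  have "(\<Sum>e\<in>S. e\<^sup>2 * mass rt L (w e)) = mass rt L (hop q (delta rt))"
    using mass_orthogonal_sum[OF be order_refl, of "\<lambda>e. e"] eq by (simp add: mass_def)
  also have "\<dots> = (\<Sum>x\<in>ball rt L. if G rt x then 1 else 0) + (\<Sum>x\<in>ball rt L. if x = rt then (q rt)\<^sup>2 else 0)"
    unfolding mass_def pt by (simp add: sum.distrib)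
  also have "(\<Sum>x\<in>ball rt L. if x = rt then (q rt)\<^sup>2 else 0) = (q rt)\<^sup>2"
    by (simp add: finite_ball)
  also have "(\<Sum>x\<in>ball rt L. if G rt x then 1 else 0) = real (card (ball rt L \<inter> {x. G rt x}))"
    by (simp add: finite_ball sum.If_cases)
  also have "\<dots> \<le> real (card {x. G rt x})"
    using finite_adj[of rt] by (intro of_nat_mono card_mono) auto
  also have "\<dots> \<le> real Dmax" using card_adj[of rt] by simp
  finally show ?thesis by simp
qed

text \<open>Both sides solve the same resolvent equation in the ball, so
  \<open>regular_unique\<close> identifies them. This is the link between the recursive quotients
  and the eigenvectors.\<close>

lemma green_spectral:
  assumes be: "ball_eigen rt q L S w" and reg: "regular rt q L E" and E: "E \<notin> S"
  shows "complex_of_real (green rt q L E y) = (\<Sum>e\<in>S. w e y / complex_of_real (E - e))"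
proof -
  let ?g = "\<lambda>y. complex_of_real (green rt q L E y)" and ?s = "\<lambda>y. \<Sum>e\<in>S. w e y / complex_of_real (E - e)"
  have lin: "hop q (\<lambda>y. ?g y - ?s y) z = hop q ?g z - (\<Sum>e\<in>S. hop q (w e) z / complex_of_real (E - e))" for z
  proof -
    have "(\<Sum>y | G z y. ?s y) = (\<Sum>e\<in>S. (\<Sum>y | G z y. w e y) / complex_of_real (E - e))"
      by (subst sum.swap) (simp add: sum_divide_distrib)
    then show ?thesis
      by (simp add: hop_def sum_subtractf algebra_simps sum.distrib add_divide_distrib sum_distrib_left)
  qed
  have "?g y - ?s y = 0"
  proof (rule regular_unique[OF reg])
    fix z assume z: "\<not> d rt z \<le> L"
    show "?g z - ?s z = 0" using be z by (simp add: green_def ball_eigen_def)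
  next
    fix z assume z: "d rt z \<le> L"
    have 1: "complex_of_real E * ?g z - hop q ?g z = delta rt z"
      using arg_cong[OF green_equation[OF reg z], of complex_of_real] by (simp add: hop_def delta_def)
    have "complex_of_real E * ?s z - (\<Sum>e\<in>S. hop q (w e) z / complex_of_real (E - e))
       = (\<Sum>e\<in>S. (complex_of_real E - complex_of_real e) * w e z / complex_of_real (E - e))"
      using be z by (simp add: ball_eigen_def sum_distrib_left sum_subtractf diff_divide_distrib left_diff_distrib)
    also have "\<dots> = (\<Sum>e\<in>S. w e z)"
      using E by (intro sum.cong refl) (auto simp: field_simps simp flip: of_real_diff)
    also have "\<dots> = delta rt z" using be by (simp add: ball_eigen_def)
    finally show "complex_of_real E * (?g z - ?s z) - hop q (\<lambda>y. ?g y - ?s y) z = 0"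
      using 1 unfolding lin by (simp add: algebra_simps)
  qed
  then show ?thesis by simp
qed

section \<open>Correlators as integrals over the energy\<close>

definition correlator_density :: "'v \<Rightarrow> ('v \<Rightarrow> real) \<Rightarrow> nat \<Rightarrow> ('v \<Rightarrow> real) \<Rightarrow> real \<Rightarrow> real \<Rightarrow> real" where
  "correlator_density rt q L \<omega> \<delta> E =
     (if \<bar>ratio_in rt q L E rt\<bar> < \<delta> then \<Sum>y\<in>ball rt L. \<omega> y * \<bar>path_weight rt q L E y\<bar> else 0)"

definition weighted_sum :: "'v \<Rightarrow> nat \<Rightarrow> ('v \<Rightarrow> real) \<Rightarrow> ('v \<Rightarrow> complex) \<Rightarrow> real" where
  "weighted_sum rt L \<omega> f = (\<Sum>y\<in>ball rt L. \<omega> y * cmod (f y))"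

lemma tendsto_residue:
  assumes "finite S" "e \<in> S"
  shows "((\<lambda>E. complex_of_real (E - e) * (\<Sum>e'\<in>S. w e' / complex_of_real (E - e'))) \<longlongrightarrow> w e) (at e)"
proof -
  have "((\<lambda>E. w e + complex_of_real (E - e) * (\<Sum>e'\<in>S - {e}. w e' / complex_of_real (E - e')))
      \<longlongrightarrow> w e + complex_of_real (e - e) * (\<Sum>e'\<in>S - {e}. w e' / complex_of_real (e - e'))) (at e)"
    by (intro tendsto_intros) auto
  moreover have "eventually (\<lambda>E. w e + complex_of_real (E - e) * (\<Sum>e'\<in>S - {e}. w e' / complex_of_real (E - e'))
     = complex_of_real (E - e) * (\<Sum>e'\<in>S. w e' / complex_of_real (E - e'))) (at e)"
    unfolding eventually_at_filter
    by (intro always_eventually allI impI) (use assms in \<open>simp add: sum.remove distrib_left flip: of_real_diff\<close>)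
  ultimately show ?thesis by (simp cong: Lim_cong add: Lim_transform_eventually)
qed

text \<open>The Green function has a simple pole at \<open>e\<close> with residue
  \<open>w e\<close>. Giving away a factor 2 in the width of the window and another one in the
  height turns the limits at \<open>e\<close> into inequalities on a punctured neighbourhood that
  serves all \<delta> at once.\<close>

lemma correlator_density_local:
  assumes be: "ball_eigen rt q L S w" and e: "e \<in> S" and \<omega>: "\<And>y. \<omega> y > 0"
  shows "eventually (\<lambda>E. regular rt q L E \<longrightarrow> (\<forall>\<delta>. \<bar>E - e\<bar> < \<delta> * mass rt L (w e) / 2 \<longrightarrow>
     correlator_density rt q L \<omega> \<delta> E \<ge> weighted_sum rt L \<omega> (w e) / (2 * mass rt L (w e)))) (at e)"
proof -
  have fin: "finite S" using be by (simp add: ball_eigen_def)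
  define a where "a = mass rt L (w e)"
  have a: "a > 0" "w e rt = complex_of_real a" using be e by (auto simp: ball_eigen_def a_def)
  define F where "F E y = complex_of_real (E - e) * (\<Sum>e'\<in>S. w e' y / complex_of_real (E - e'))" for E y
  have F: "((\<lambda>E. F E y) \<longlongrightarrow> w e y) (at e)" for y
    unfolding F_def using tendsto_residue[OF fin e] .
  \<comment> \<open>Positivity puts half of the limit strictly below the limit.\<close>
  have W: "weighted_sum rt L \<omega> (w e) > 0"
    unfolding weighted_sum_def
    by (rule sum_pos2[of _ rt]) (use a \<omega> finite_ball in \<open>auto simp: less_imp_le\<close>)
  have "((\<lambda>E. \<Sum>y\<in>ball rt L. \<omega> y * (cmod (F E y) / cmod (F E rt))) \<longlongrightarrow> (\<Sum>y\<in>ball rt L. \<omega> y * (cmod (w e y) / cmod (w e rt)))) (at e)"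
    using a by (intro tendsto_intros F) auto
  moreover have "(\<Sum>y\<in>ball rt L. \<omega> y * (cmod (w e y) / cmod (w e rt))) = weighted_sum rt L \<omega> (w e) / a"
    using a by (simp add: weighted_sum_def sum_divide_distrib)
  ultimately have 1: "eventually (\<lambda>E. weighted_sum rt L \<omega> (w e) / (2 * a) < (\<Sum>y\<in>ball rt L. \<omega> y * (cmod (F E y) / cmod (F E rt)))) (at e)"
    using W a by (intro order_tendstoD(1)) (auto simp: field_simps)
  have 2: "eventually (\<lambda>E. a / 2 < cmod (F E rt)) (at e)"
    using a by (intro order_tendstoD(1)[OF tendsto_norm[OF F]]) auto
  have 3: "eventually (\<lambda>E. E \<notin> S) (at e)"
    using fin islimpt_finite[of S e] unfolding islimpt_iff_eventually by auto
  have 4: "eventually (\<lambda>E. E \<noteq> e) (at e)" by (simp add: eventually_at_filter)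
  show ?thesis
    using 1 2 3 4
  proof eventually_elim
    case (elim E)
    show ?case
    proof (intro impI allI)
      fix \<delta> assume reg: "regular rt q L E" and \<delta>: "\<bar>E - e\<bar> < \<delta> * mass rt L (w e) / 2"
      have g: "F E y = complex_of_real ((E - e) * green rt q L E y)" for y
        unfolding F_def green_spectral[OF be reg elim(3), of y, symmetric] by simp
      have r0: "ratio_in rt q L E rt \<noteq> 0" using reg by (auto simp: regular_def)
      have gr: "green rt q L E rt = inverse (ratio_in rt q L E rt)" by (simp add: green_def)
      have "a / 2 < \<bar>E - e\<bar> / \<bar>ratio_in rt q L E rt\<bar>"
      proof -
        have "cmod (F E rt) = \<bar>E - e\<bar> / \<bar>ratio_in rt q L E rt\<bar>"
          by (simp only: g norm_of_real gr abs_mult abs_inverse divide_inverse)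
        then show ?thesis using elim(2) by simp
      qed
      then have "\<bar>ratio_in rt q L E rt\<bar> * a < 2 * \<bar>E - e\<bar>" using r0 by (simp add: field_simps)
      also have "\<dots> < \<delta> * a" using \<delta> by (simp add: a_def)
      finally have small: "\<bar>ratio_in rt q L E rt\<bar> < \<delta>" using a by simp
      have "(\<Sum>y\<in>ball rt L. \<omega> y * (cmod (F E y) / cmod (F E rt))) = (\<Sum>y\<in>ball rt L. \<omega> y * \<bar>path_weight rt q L E y\<bar>)"
      proof (intro sum.cong refl)
        fix y assume y: "y \<in> ball rt L"
        have "cmod (F E y) / cmod (F E rt) = \<bar>green rt q L E y\<bar> / \<bar>green rt q L E rt\<bar>"
          unfolding g norm_of_real abs_mult using elim(4) by simp
        also have "\<dots> = \<bar>path_weight rt q L E y\<bar>"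
          using y r0 by (simp add: green_def abs_mult)
        finally show "\<omega> y * (cmod (F E y) / cmod (F E rt)) = \<omega> y * \<bar>path_weight rt q L E y\<bar>" by simp
      qed
      then show "correlator_density rt q L \<omega> \<delta> E \<ge> weighted_sum rt L \<omega> (w e) / (2 * mass rt L (w e))"
        using elim(1) small by (simp add: correlator_density_def a_def)
    qed
  qed
qed

text \<open>For small \<delta> the windows around distinct eigenvalues are disjoint and stay inside
  {-R..R}. A window of length \<open>\<delta> * a\<close> on which the density is at least
  \<open>W / (2 * a)\<close> contributes \<open>\<delta> / 2 * W\<close>. The threshold \<delta>0
  depends on the ball and on the potential.\<close>

lemma correlator_lower_bound:
  assumes be: "ball_eigen rt q L S w" and \<omega>: "\<And>y. \<omega> y > 0"
    and reg: "AE E in lborel. regular rt q L E"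
  shows "\<exists>\<delta>0>0. \<forall>\<delta>. 0 < \<delta> \<and> \<delta> < \<delta>0 \<longrightarrow>
     ennreal (\<delta> / 2 * (\<Sum>e\<in>S \<inter> {-R<..<R}. weighted_sum rt L \<omega> (w e)))
       \<le> (\<integral>\<^sup>+E. ennreal (correlator_density rt q L \<omega> \<delta> E) * indicator {-R..R} E \<partial>lborel)"
proof -
  define SR where "SR = S \<inter> {-R<..<R}"
  have fin: "finite SR" using be by (simp add: ball_eigen_def SR_def)
  let ?a = "\<lambda>e. mass rt L (w e)" and ?W = "\<lambda>e. weighted_sum rt L \<omega> (w e)"
  have a: "0 < ?a e" "?a e \<le> 1" if "e \<in> SR" for e
  proof -
    show "0 < ?a e" using be that by (auto simp: ball_eigen_def SR_def)
    have "?a e \<le> (\<Sum>e\<in>S. ?a e)"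
      using be that by (intro member_le_sum) (auto simp: ball_eigen_def SR_def mass_def sum_nonneg)
    then show "?a e \<le> 1" using ball_eigen_total_mass[OF be] by simp
  qed
  have W0: "?W e \<ge> 0" for e
    unfolding weighted_sum_def using \<omega> by (auto intro!: sum_nonneg simp: less_imp_le)
  have "\<exists>\<eta>>0. \<forall>E. E \<noteq> e \<and> \<bar>E - e\<bar> < \<eta> \<longrightarrow> E \<notin> SR \<and> E \<in> {-R<..<R} \<and> (regular rt q L E \<longrightarrow> (\<forall>\<delta>. \<bar>E - e\<bar> < \<delta> * ?a e / 2 \<longrightarrow>
     correlator_density rt q L \<omega> \<delta> E \<ge> ?W e / (2 * ?a e)))" if e: "e \<in> SR" for e
  proof -
    have "eventually (\<lambda>E. E \<notin> SR) (at e)"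
      using fin islimpt_finite[of SR e] unfolding islimpt_iff_eventually by auto
    moreover have "eventually (\<lambda>E. E \<in> {-R<..<R}) (at e)"
      using e by (intro eventually_at_in_open') (auto simp: SR_def)
    moreover note correlator_density_local[OF be, of e \<omega>]
    ultimately have "eventually (\<lambda>E. E \<notin> SR \<and> E \<in> {-R<..<R} \<and> (regular rt q L E \<longrightarrow> (\<forall>\<delta>. \<bar>E - e\<bar> < \<delta> * ?a e / 2 \<longrightarrow>
     correlator_density rt q L \<omega> \<delta> E \<ge> ?W e / (2 * ?a e)))) (at e)"
      using e \<omega> by (auto simp: eventually_conj_iff SR_def)
    then show ?thesis unfolding eventually_at by (auto simp: dist_real_def)
  qed
  then obtain \<eta> where \<eta>: "\<And>e. e \<in> SR \<Longrightarrow> \<eta> e > 0"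
    "\<And>e E. e \<in> SR \<Longrightarrow> E \<noteq> e \<Longrightarrow> \<bar>E - e\<bar> < \<eta> e \<Longrightarrow> E \<notin> SR \<and> E \<in> {-R<..<R} \<and> (regular rt q L E \<longrightarrow> (\<forall>\<delta>. \<bar>E - e\<bar> < \<delta> * ?a e / 2 \<longrightarrow>
     correlator_density rt q L \<omega> \<delta> E \<ge> ?W e / (2 * ?a e)))" by metis
  define \<delta>0 where "\<delta>0 = Min (insert 1 (\<eta> ` SR))"
  have \<delta>0: "\<delta>0 > 0" "\<And>e. e \<in> SR \<Longrightarrow> \<delta>0 \<le> \<eta> e"
    using fin \<eta>(1) by (auto simp: \<delta>0_def)
  show ?thesis
  proof (intro exI[of _ \<delta>0] conjI allI impI)
    fix \<delta> assume \<delta>: "0 < \<delta> \<and> \<delta> < \<delta>0"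
    define J where "J e = {E. \<bar>E - e\<bar> < \<delta> * ?a e / 2}" for e
    have J_eq: "J e = {e - \<delta> * ?a e / 2<..<e + \<delta> * ?a e / 2}" for e
      by (auto simp only: J_def abs_diff_less_iff mem_Collect_eq greaterThanLessThan_iff)
    have half: "\<delta> * ?a e / 2 \<le> \<delta>0 / 2" if "e \<in> SR" for e
      using mult_mono[of \<delta> \<delta>0 "?a e" 1] a[OF that] \<delta> by simp
    have near: "\<bar>E - e\<bar> < \<eta> e" if "e \<in> SR" "E \<in> J e" for e E
      using half[OF that(1)] \<delta>0(2)[OF that(1)] \<delta>0(1) that(2) by (auto simp: J_def)
    have disj: "e = e'" if "e \<in> SR" "e' \<in> SR" "E \<in> J e" "E \<in> J e'" for e e' E
    proof (rule ccontr)
      assume "e \<noteq> e'"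
      moreover have "\<bar>e' - e\<bar> < \<eta> e"
        using half[OF that(1)] half[OF that(2)] \<delta>0(2)[OF that(1)] that(3,4)
        unfolding J_def mem_Collect_eq by linarith
      ultimately show False using \<eta>(2)[OF that(1), of e'] that(2) by auto
    qed
    have "AE E in lborel. E \<notin> SR"
      by (intro AE_not_in finite_imp_null_set_lborel fin)
    with reg have "AE E in lborel. (\<Sum>e\<in>SR. ennreal (?W e / (2 * ?a e)) * indicator (J e) E)
        \<le> ennreal (correlator_density rt q L \<omega> \<delta> E) * indicator {-R..R} E"
    proof eventually_elim
      case (elim E)
      show ?case
      proof (cases "\<exists>e\<in>SR. E \<in> J e")
        case True
        then obtain e where e: "e \<in> SR" "E \<in> J e" by blast
        have ne: "E \<noteq> e" using e elim by auto
        have "(\<Sum>e'\<in>SR. ennreal (?W e' / (2 * ?a e')) * indicator (J e') E)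
            = (\<Sum>e'\<in>SR. if e' = e then ennreal (?W e / (2 * ?a e)) else 0)"
          using e disj by (intro sum.cong refl) (auto simp: indicator_def)
        also have "\<dots> = ennreal (?W e / (2 * ?a e))" using e fin by simp
        also have "\<dots> \<le> ennreal (correlator_density rt q L \<omega> \<delta> E)"
          using \<eta>(2)[OF e(1) ne near[OF e]] e elim by (intro ennreal_leI) (auto simp: J_def)
        also have "\<dots> = ennreal (correlator_density rt q L \<omega> \<delta> E) * indicator {-R..R} E"
          using \<eta>(2)[OF e(1) ne near[OF e]] e elim by (auto simp: indicator_def)
        finally show ?thesis .
      qed (auto intro!: sum_nonpos simp: indicator_def)
    qed
    then have "(\<integral>\<^sup>+E. (\<Sum>e\<in>SR. ennreal (?W e / (2 * ?a e)) * indicator (J e) E) \<partial>lborel)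
        \<le> (\<integral>\<^sup>+E. ennreal (correlator_density rt q L \<omega> \<delta> E) * indicator {-R..R} E \<partial>lborel)"
      by (rule nn_integral_mono_AE)
    also have "(\<integral>\<^sup>+E. (\<Sum>e\<in>SR. ennreal (?W e / (2 * ?a e)) * indicator (J e) E) \<partial>lborel)
       = (\<Sum>e\<in>SR. ennreal (?W e / (2 * ?a e)) * emeasure lborel (J e))"
      by (subst nn_integral_sum) (auto simp: J_eq nn_integral_cmult_indicator)
    also have "\<dots> = (\<Sum>e\<in>SR. ennreal (\<delta> / 2 * ?W e))"
    proof (intro sum.cong refl)
      fix e assume e: "e \<in> SR"
      have "emeasure lborel (J e) = ennreal (\<delta> * ?a e)"
        unfolding J_eq using a[OF e] \<delta> by (subst emeasure_lborel_Ioo) auto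
      then have "ennreal (?W e / (2 * ?a e)) * emeasure lborel (J e) = ennreal (?W e / (2 * ?a e) * (\<delta> * ?a e))"
        using W0 a[OF e] \<delta> by (subst ennreal_mult) auto
      also have "?W e / (2 * ?a e) * (\<delta> * ?a e) = \<delta> / 2 * ?W e" using a[OF e] by (simp add: field_simps)
      finally show "ennreal (?W e / (2 * ?a e)) * emeasure lborel (J e) = ennreal (\<delta> / 2 * ?W e)" .
    qed
    also have "\<dots> = ennreal (\<delta> / 2 * (\<Sum>e\<in>SR. ?W e))"
      using W0 \<delta> by (subst sum_ennreal) (auto simp: sum_distrib_left)
    finally show "ennreal (\<delta> / 2 * (\<Sum>e\<in>S \<inter> {-R<..<R}. ?W e))
       \<le> (\<integral>\<^sup>+E. ennreal (correlator_density rt q L \<omega> \<delta> E) * indicator {-R..R} E \<partial>lborel)"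
      by (simp add: SR_def)
  qed (use \<delta>0 in auto)
qed

end

section \<open>The random potential\<close>

lemma ennreal_le_if_square_le:
  assumes "x\<^sup>2 \<le> (ennreal r)\<^sup>2" "0 \<le> r"
  shows "x \<le> ennreal r"
proof (cases x)
  case (real s)
  then have "ennreal (s\<^sup>2) \<le> ennreal (r\<^sup>2)" using assms by (simp add: ennreal_power)
  then have "s\<^sup>2 \<le> r\<^sup>2" by (subst (asm) ennreal_le_iff) auto
  then have "s \<le> r" by (rule power2_le_imp_le) (rule assms)
  then show ?thesis using real by (simp add: ennreal_leI)
qed (use assms in \<open>auto simp: ennreal_power top_unique power2_eq_square ennreal_mult_eq_top_iff\<close>)

text \<open>\<open>shift\<close> is a deterministic diagonal term; in the application it is zero or
  minus the degree, so both Laplacians are covered at once. The coupling constant is absorbed into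
  the law.\<close>

locale anderson_tree = subexponential_tree G Dmax + bounded_law \<nu> b
  for G :: "'v \<Rightarrow> 'v \<Rightarrow> bool" and Dmax :: nat and \<nu> :: "real measure" and b :: real +
  fixes shift :: "'v \<Rightarrow> real"
begin

definition P :: "('v \<Rightarrow> real) measure" where "P = PiM UNIV (\<lambda>_. \<nu>)"

definition pot :: "('v \<Rightarrow> real) \<Rightarrow> 'v \<Rightarrow> real" where "pot v x = v x + shift x"

lemma prob_space_P: "prob_space P"
  unfolding P_def by (intro prob_space_PiM) (rule prob_space_axioms)

lemma space_P [simp]: "space P = UNIV"
  by (simp add: P_def space_PiM PiE_UNIV_domain)

lemma measurable_coord: "(\<lambda>v. v x) \<in> borel_measurable P"
proof -
  have "(\<lambda>v. v x) \<in> P \<rightarrow>\<^sub>M \<nu>" unfolding P_def by (rule measurable_component_singleton) simp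
  then show ?thesis by (simp cong: measurable_cong_sets)
qed

lemma measurable_upd: "(\<lambda>(v, t). v(z := t)) \<in> P \<Otimes>\<^sub>M \<nu> \<rightarrow>\<^sub>M P"
  using measurable_add_dim[of z UNIV "\<lambda>_. \<nu>"] by (simp add: P_def)

text \<open>Fubini in one coordinate, phrased as resampling: the integrand stays a function on the
  full configuration space, so sites can be integrated out one after another without changing the
  space.\<close>

lemma integral_out:
  assumes [measurable]: "f \<in> borel_measurable P"
  shows "(\<integral>\<^sup>+v. f v \<partial>P) = (\<integral>\<^sup>+v. (\<integral>\<^sup>+t. f (v(z := t)) \<partial>\<nu>) \<partial>P)"
proof -
  have m: "(\<lambda>v. \<integral>\<^sup>+t. f (v(z := t)) \<partial>\<nu>) \<in> borel_measurable P"
    using measurable_compose[OF measurable_upd assms, of z]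
    by (intro borel_measurable_nn_integral[of "\<lambda>v t. f (v(z := t))"]) (simp add: case_prod_beta')
  let ?N = "PiM (UNIV - {z}) (\<lambda>_. \<nu>)"
  interpret N: prob_space ?N by (intro prob_space_PiM) (rule prob_space_axioms)
  interpret pair_sigma_finite \<nu> ?N by standard
  have D: "distr (\<nu> \<Otimes>\<^sub>M ?N) P (\<lambda>(x, X). X(z := x)) = P"
    using distr_pair_PiM_eq_PiM[of "UNIV - {z}" "\<lambda>_. \<nu>" z] prob_space_axioms by (simp add: P_def insert_absorb)
  have upd [measurable]: "(\<lambda>(x, X). X(z := x)) \<in> \<nu> \<Otimes>\<^sub>M ?N \<rightarrow>\<^sub>M P"
  proof -
    have 1: "(\<lambda>p. (snd p, fst p)) \<in> \<nu> \<Otimes>\<^sub>M ?N \<rightarrow>\<^sub>M ?N \<Otimes>\<^sub>M \<nu>" by measurable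
    have 2: "(\<lambda>(X, x). X(z := x)) \<in> ?N \<Otimes>\<^sub>M \<nu> \<rightarrow>\<^sub>M P"
      using measurable_add_dim[of z "UNIV - {z}" "\<lambda>_. \<nu>"] by (simp add: P_def insert_absorb)
    show ?thesis using measurable_compose[OF 1 2] by (simp add: case_prod_beta')
  qed
  have key: "(\<integral>\<^sup>+v. g v \<partial>P) = (\<integral>\<^sup>+X. (\<integral>\<^sup>+x. g (X(z := x)) \<partial>\<nu>) \<partial>?N)" if [measurable]: "g \<in> borel_measurable P" for g
  proof -
    have "(\<integral>\<^sup>+v. g v \<partial>P) = (\<integral>\<^sup>+v. g v \<partial>distr (\<nu> \<Otimes>\<^sub>M ?N) P (\<lambda>(x, X). X(z := x)))" by (simp only: D)
    also have "\<dots> = (\<integral>\<^sup>+p. g (case p of (x, X) \<Rightarrow> X(z := x)) \<partial>(\<nu> \<Otimes>\<^sub>M ?N))"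
      by (rule nn_integral_distr) measurable
    also have "\<dots> = (\<integral>\<^sup>+X. (\<integral>\<^sup>+x. g (X(z := x)) \<partial>\<nu>) \<partial>?N)"
      using nn_integral_snd[of "\<lambda>p. g (case p of (x, X) \<Rightarrow> X(z := x))"] by simp
    finally show ?thesis .
  qed
  show ?thesis
    unfolding key[OF assms] key[OF m] by simp
qed

subsection \<open>The ratios as random variables\<close>

definition below :: "'v \<Rightarrow> 'v \<Rightarrow> 'v set" where
  "below rt x = {w. \<exists>i. (par rt ^^ i) w = x \<and> d rt w = d rt x + i}"

lemma below_self: "x \<in> below rt x"
  by (auto simp: below_def intro!: exI[of _ 0])

lemma below_child:
  assumes "c \<in> children rt x" shows "below rt c \<subseteq> below rt x"
proof
  fix w assume "w \<in> below rt c"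
  then obtain i where "(par rt ^^ i) w = c" "d rt w = d rt c + i" by (auto simp: below_def)
  then show "w \<in> below rt x" using assms
    by (auto simp: below_def gdist_children children_iff intro!: exI[of _ "Suc i"])
qed

lemma ratio_cong: "(\<And>w. w \<in> below rt x \<Longrightarrow> q w = q' w) \<Longrightarrow> ratio rt q E n x = ratio rt q' E n x"
proof (induction n arbitrary: x)
  case 0 then show ?case using below_self by simp
next
  case (Suc n)
  have "ratio rt q E n c = ratio rt q' E n c" if "c \<in> children rt x" for c
    using Suc.prems below_child[OF that] by (intro Suc.IH) auto
  then show ?case using Suc.prems[OF below_self] by simp
qed

lemma pot_measurable [measurable]:
  "(\<lambda>v. pot v x) \<in> borel_measurable P"
  "(\<lambda>p. pot (snd p) x) \<in> borel_measurable (N \<Otimes>\<^sub>M P)"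
proof -
  show *: "(\<lambda>v. pot v x) \<in> borel_measurable P" unfolding pot_def by (intro borel_measurable_add measurable_coord borel_measurable_const)
  show "(\<lambda>p. pot (snd p) x) \<in> borel_measurable (N \<Otimes>\<^sub>M P)"
    by (rule measurable_compose[OF measurable_snd *])
qed

lemma ratio_measurable [measurable]:
  "(\<lambda>p. ratio rt (pot (snd p)) (fst p) n z) \<in> borel_measurable (borel \<Otimes>\<^sub>M P)"
proof (induction n arbitrary: z)
  case 0 show ?case unfolding ratio.simps by measurable
next
  case (Suc n)
  note [measurable] = Suc.IH
  show ?case unfolding ratio.simps by measurable
qed

lemma ratio_in_measurable [measurable]:
  "(\<lambda>p. ratio_in rt (pot (snd p)) L (fst p) z) \<in> borel_measurable (borel \<Otimes>\<^sub>M P)"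
  unfolding ratio_in_def by measurable

lemma ratio_in_measurable_swap [measurable]:
  "(\<lambda>p. ratio_in rt (pot (fst p)) L (snd p) z) \<in> borel_measurable (P \<Otimes>\<^sub>M borel)"
  using measurable_compose[OF measurable_pair_swap' ratio_in_measurable, of rt L z] by (simp add: case_prod_beta')

lemma ratio_in_measurable' [measurable]:
  "(\<lambda>v. ratio_in rt (pot v) L E z) \<in> borel_measurable P"
  using measurable_compose[OF _ ratio_in_measurable, of "\<lambda>v. (E, v)" P rt L z] by simp

lemma ratio_in_upd:
  assumes "x \<notin> below rt z"
  shows "ratio_in rt (pot (v(x := t))) L E z = ratio_in rt (pot v) L E z"
  unfolding ratio_in_def using assms by (intro ratio_cong) (auto simp: pot_def)

lemma parent_notin_below_child: "c \<in> children rt x \<Longrightarrow> x \<notin> below rt c"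
  by (auto simp: below_def gdist_children)

text \<open>What remains of the recursion at \<open>z\<close> when the random potential at
  \<open>z\<close> and the children in \<open>C\<close> are set aside.\<close>

definition side :: "'v \<Rightarrow> nat \<Rightarrow> real \<Rightarrow> 'v set \<Rightarrow> 'v \<Rightarrow> ('v \<Rightarrow> real) \<Rightarrow> real" where
  "side rt L E C z v = E - shift z - (\<Sum>c\<in>children rt z - C. if d rt c \<le> L then inverse (ratio_in rt (pot v) L E c) else 0)"

lemma side_measurable [measurable]: "side rt L E C z \<in> borel_measurable P"
  unfolding side_def by measurable

lemma side_upd:
  assumes "\<And>c. c \<in> children rt z - C \<Longrightarrow> x \<notin> below rt c"
  shows "side rt L E C z (v(x := t)) = side rt L E C z v"
  unfolding side_def using assms
  by (intro arg_cong2[where f = minus] refl sum.cong) (auto simp: ratio_in_upd)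

lemma ratio_in_upd_self:
  assumes "d rt z \<le> L"
  shows "ratio_in rt (pot (v(z := t))) L E z = side rt L E {} z v - t"
proof -
  have "(\<Sum>c\<in>children rt z. if d rt c \<le> L then inverse (ratio_in rt (pot (v(z := t))) L E c) else 0)
      = (\<Sum>c\<in>children rt z. if d rt c \<le> L then inverse (ratio_in rt (pot v) L E c) else 0)"
    by (intro sum.cong refl) (auto simp: ratio_in_upd parent_notin_below_child)
  then show ?thesis
    unfolding ratio_in_expand[OF assms, of "pot (v(z := t))" E] side_def by (simp add: pot_def)
qed

lemma ratio_in_upd_self_child:
  assumes "d rt c \<le> L" "c \<in> children rt z"
  shows "ratio_in rt (pot (v(z := t))) L E z = side rt L E {c} z v - t - inverse (ratio_in rt (pot v) L E c)"
proof -
  have "d rt z \<le> L" using assms by (simp add: gdist_children)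
  then have "ratio_in rt (pot (v(z := t))) L E z = side rt L E {} z v - t" by (rule ratio_in_upd_self)
  also have "side rt L E {} z v = side rt L E {c} z v - inverse (ratio_in rt (pot v) L E c)"
    using assms by (simp add: side_def sum.remove)
  finally show ?thesis by linarith
qed

text \<open>At a fixed energy, a quotient equals a term independent of the potential
  \<open>t\<close> at its own vertex minus \<open>t\<close>, and the law has no atoms. Fubini
  exchanges the order, giving almost every energy for almost every potential, as
  \<open>correlator_lower_bound\<close> needs it.\<close>

lemma AE_regular: "AE v in P. AE E in lborel. regular rt (pot v) L E"
proof -
  interpret P: prob_space P by (rule prob_space_P)
  interpret pair_sigma_finite lborel P by standard
  have "AE v in P. AE E in lborel. ratio_in rt (pot v) L E z \<noteq> 0" if z: "d rt z \<le> L" for z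
  proof -
    let ?i = "\<lambda>E v. indicator {0} (ratio_in rt (pot v) L E z) :: ennreal"
    have "(\<integral>\<^sup>+v. ?i E v \<partial>P) = 0" for E
    proof -
      have "(\<integral>\<^sup>+t. ?i E (v(z := t)) \<partial>\<nu>) = 0" for v
      proof -
        have "(\<integral>\<^sup>+t. ?i E (v(z := t)) \<partial>\<nu>) = (\<integral>\<^sup>+t. indicator {side rt L E {} z v} t \<partial>\<nu>)"
          unfolding ratio_in_upd_self[OF z] by (intro nn_integral_cong) (auto simp: indicator_def)
        also have "\<dots> \<le> ennreal b * (\<integral>\<^sup>+t. indicator {side rt L E {} z v} t \<partial>lborel)"
          by (rule dominated) simp
        finally show ?thesis by simp
      qed
      then show ?thesis by (subst integral_out[where z = z]) simp_all
    qed
    then have "(\<integral>\<^sup>+v. (\<integral>\<^sup>+E. ?i E v \<partial>lborel) \<partial>P) = 0"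
      by (subst Fubini') simp_all
    moreover have "(\<lambda>v. \<integral>\<^sup>+E. ?i E v \<partial>lborel) \<in> borel_measurable P"
    proof (rule lborel.borel_measurable_nn_integral)
      have "(\<lambda>p. indicator {0} (ratio_in rt (pot (fst p)) L (snd p) z) :: ennreal) \<in> borel_measurable (P \<Otimes>\<^sub>M borel)"
        by (rule measurable_compose[OF ratio_in_measurable_swap]) simp
      then show "(\<lambda>(v, E). ?i E v) \<in> borel_measurable (P \<Otimes>\<^sub>M lborel)"
        by (simp add: case_prod_beta' cong: measurable_cong_sets)
    qed
    ultimately have "AE v in P. (\<integral>\<^sup>+E. ?i E v \<partial>lborel) = 0"
      by (subst (asm) nn_integral_0_iff_AE)
    then show ?thesis
    proof eventually_elim
      case (elim v)
      have "(\<lambda>E. ratio_in rt (pot v) L E z) \<in> borel_measurable borel"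
        using measurable_compose[OF _ ratio_in_measurable, of "\<lambda>E. (E, v)" borel rt L z] by simp
      then have "AE E in lborel. ?i E v = 0"
        using elim by (subst (asm) nn_integral_0_iff_AE) auto
      then show ?case by eventually_elim (auto simp: indicator_def split: if_splits)
    qed
  qed
  then have "AE v in P. \<forall>z\<in>ball rt L. AE E in lborel. ratio_in rt (pot v) L E z \<noteq> 0"
    using finite_ball by (intro AE_finite_allI) auto
  then show ?thesis
    unfolding regular_def by (rule eventually_mono) (intro AE_finite_allI finite_ball, blast)
qed

subsection \<open>Integrating out a path\<close>

definition chain :: "'v \<Rightarrow> nat \<Rightarrow> (nat \<Rightarrow> 'v) \<Rightarrow> bool" where
  "chain rt n z \<longleftrightarrow> (\<forall>i<n. z (Suc i) \<in> children rt (z i))"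

lemma chain_level: "chain rt n z \<Longrightarrow> j \<le> n \<Longrightarrow> d rt (z j) = d rt (z 0) + j"
proof (induction j)
  case (Suc j)
  then have "z (Suc j) \<in> children rt (z j)" by (auto simp: chain_def)
  then show ?case using Suc by (simp add: gdist_children)
qed simp

lemma chain_anc: "chain rt n z \<Longrightarrow> a + k \<le> n \<Longrightarrow> (par rt ^^ k) (z (a + k)) = z a"
proof (induction k)
  case (Suc k)
  have "par rt (z (Suc (a + k))) = z (a + k)" using Suc.prems by (auto simp: chain_def children_iff)
  then show ?case using Suc by (simp add: funpow_swap1)
qed simp

lemma chain_notin_below:
  assumes ch: "chain rt n z" and i: "i < n" and c: "c \<in> children rt (z i)" "c \<noteq> z (Suc i)" and j: "j \<le> n"
  shows "z j \<notin> below rt c"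
proof
  assume "z j \<in> below rt c"
  then obtain k where k: "(par rt ^^ k) (z j) = c" "d rt (z j) = d rt c + k" by (auto simp: below_def)
  have "d rt (z 0) + j = Suc (d rt (z 0) + i) + k"
    using k(2) chain_level[OF ch j] chain_level[OF ch, of i] i c by (simp add: gdist_children)
  then have "j = Suc i + k" by simp
  then have "(par rt ^^ k) (z j) = z (Suc i)" using chain_anc[OF ch, of "Suc i" k] j by simp
  then show False using k c by simp
qed

lemma chain_notin_below_later:
  assumes ch: "chain rt n z" and "i < j" "j \<le> n"
  shows "z i \<notin> below rt (z j)"
  using chain_level[OF ch, of i] chain_level[OF ch, of j] assms by (auto simp: below_def)

lemma chain_Suc: "chain rt (Suc n) z \<Longrightarrow> chain rt n (z \<circ> Suc)"
  by (auto simp: chain_def)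

definition off_path :: "nat \<Rightarrow> (nat \<Rightarrow> 'v) \<Rightarrow> (('v \<Rightarrow> real) \<Rightarrow> 'b) \<Rightarrow> bool" where
  "off_path n z F \<longleftrightarrow> (\<forall>j\<le>n. \<forall>v t. F (v(z j := t)) = F v)"

lemma off_path_side_child:
  assumes "chain rt (Suc n) z"
  shows "off_path (Suc n) z (side rt L E {z 1} (z 0))"
  unfolding off_path_def using chain_notin_below[OF assms, of 0] by (auto intro!: side_upd)

lemma measurable_F_comp:
  assumes F: "(\<lambda>p. F (fst p) (snd p)) \<in> borel_measurable (P \<Otimes>\<^sub>M borel)" and g: "g \<in> borel_measurable P"
  shows "(\<lambda>v. F v (g v) :: ennreal) \<in> borel_measurable P"
proof -
  have "(\<lambda>v. (v, g v)) \<in> P \<rightarrow>\<^sub>M P \<Otimes>\<^sub>M borel" using g by measurable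
  from measurable_compose[OF this F] show ?thesis by simp
qed

lemma measurable_section:
  assumes F: "(\<lambda>p. F (fst p) (snd p)) \<in> borel_measurable (P \<Otimes>\<^sub>M borel)"
  shows "(F v :: real \<Rightarrow> ennreal) \<in> borel_measurable borel"
proof -
  have "(\<lambda>s. (v, s)) \<in> borel \<rightarrow>\<^sub>M P \<Otimes>\<^sub>M borel" by measurable
  from measurable_compose[OF this F] show ?thesis by simp
qed

definition tail_prod :: "'v \<Rightarrow> nat \<Rightarrow> real \<Rightarrow> nat \<Rightarrow> (nat \<Rightarrow> 'v) \<Rightarrow> ('v \<Rightarrow> real) \<Rightarrow> ennreal" where
  "tail_prod rt L E n z v = (\<Prod>j<n. ennreal \<bar>inverse (ratio_in rt (pot v) L E (z (Suc j)))\<bar>)"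

lemma tail_prod_measurable [measurable]: "tail_prod rt L E n z \<in> borel_measurable P"
  unfolding tail_prod_def by measurable

text \<open>The topmost vertex is integrated out: its potential enters no quotient further down, and
  its child on the path acts only through the inverse quotient. The factor of that child is taken
  from the tail product and turns \<open>smear\<close> into \<open>transfer\<close>. The new
  function depends on further sites only through \<open>side\<close>, hence again only off the
  remaining path.\<close>

lemma path_step:
  fixes E :: real
  assumes ch: "chain rt (Suc n) z" and L: "d rt (z (Suc n)) \<le> L"
    and F: "(\<lambda>p. F (fst p) (snd p)) \<in> borel_measurable (P \<Otimes>\<^sub>M borel)"
    and off: "off_path (Suc n) z F"
  defines "F' \<equiv> \<lambda>v. transfer (side rt L E {z 1} (z 0) v) (F v)"
  shows "(\<integral>\<^sup>+v. F v (ratio_in rt (pot v) L E (z 0)) * tail_prod rt L E (Suc n) z v \<partial>P)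
      = (\<integral>\<^sup>+v. F' v (ratio_in rt (pot v) L E ((z \<circ> Suc) 0)) * tail_prod rt L E n (z \<circ> Suc) v \<partial>P)"
    and "(\<lambda>p. F' (fst p) (snd p)) \<in> borel_measurable (P \<Otimes>\<^sub>M borel)"
    and "off_path n (z \<circ> Suc) F'"
proof -
  let ?u = "\<lambda>j v. ratio_in rt (pot v) L E (z j)" and ?a = "side rt L E {z 1} (z 0)"
  have z1: "z 1 \<in> children rt (z 0)" using ch by (auto simp: chain_def)
  have L1: "d rt (z 1) \<le> L" using chain_level[OF ch, of 1] chain_level[OF ch, of "Suc n"] L by simp
  have F_upd: "F (v(z 0 := t)) = F v" for v t using off by (simp add: off_path_def)
  have u_upd: "?u (Suc j) (v(z 0 := t)) = ?u (Suc j) v" if "j \<le> n" for j v t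
    using chain_notin_below_later[OF ch, of 0 "Suc j"] that by (intro ratio_in_upd) auto
  have tp_upd: "tail_prod rt L E (Suc n) z (v(z 0 := t)) = tail_prod rt L E (Suc n) z v" for v t
    unfolding tail_prod_def by (intro prod.cong refl) (simp add: u_upd)
  have tp: "tail_prod rt L E (Suc n) z v = ennreal \<bar>inverse (?u 1 v)\<bar> * tail_prod rt L E n (z \<circ> Suc) v" for v
    unfolding tail_prod_def by (simp add: prod.lessThan_Suc_shift del: prod.lessThan_Suc)
  have meas: "(\<lambda>v. F v (?u 0 v) * tail_prod rt L E (Suc n) z v) \<in> borel_measurable P"
    by (intro borel_measurable_times_ennreal measurable_F_comp[OF F]) measurable
  have "(\<integral>\<^sup>+v. F v (?u 0 v) * tail_prod rt L E (Suc n) z v \<partial>P)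
     = (\<integral>\<^sup>+v. (\<integral>\<^sup>+t. F v (?a v - t - inverse (?u 1 v)) * tail_prod rt L E (Suc n) z v \<partial>\<nu>) \<partial>P)"
    unfolding integral_out[OF meas, of "z 0"] F_upd tp_upd ratio_in_upd_self_child[OF L1 z1] ..
  also have "\<dots> = (\<integral>\<^sup>+v. F' v (?u 1 v) * tail_prod rt L E n (z \<circ> Suc) v \<partial>P)"
  proof (intro nn_integral_cong)
    fix v
    have "(\<lambda>t. F v (?a v - t - inverse (?u 1 v))) \<in> borel_measurable \<nu>"
      using measurable_section[OF F, of v] by measurable
    then have "(\<integral>\<^sup>+t. F v (?a v - t - inverse (?u 1 v)) * tail_prod rt L E (Suc n) z v \<partial>\<nu>)
       = smear (?a v) (F v) (inverse (?u 1 v)) * tail_prod rt L E (Suc n) z v"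
      by (simp add: nn_integral_multc smear_def)
    also have "\<dots> = F' v (?u 1 v) * tail_prod rt L E n (z \<circ> Suc) v"
      unfolding tp F'_def transfer_def by (simp add: mult_ac abs_inverse)
    finally show "(\<integral>\<^sup>+t. F v (?a v - t - inverse (?u 1 v)) * tail_prod rt L E (Suc n) z v \<partial>\<nu>)
       = F' v (?u 1 v) * tail_prod rt L E n (z \<circ> Suc) v" .
  qed
  finally show "(\<integral>\<^sup>+v. F v (ratio_in rt (pot v) L E (z 0)) * tail_prod rt L E (Suc n) z v \<partial>P)
      = (\<integral>\<^sup>+v. F' v (ratio_in rt (pot v) L E ((z \<circ> Suc) 0)) * tail_prod rt L E n (z \<circ> Suc) v \<partial>P)" by simp
  show "(\<lambda>p. F' (fst p) (snd p)) \<in> borel_measurable (P \<Otimes>\<^sub>M borel)"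
    unfolding F'_def transfer_def smear_def
  proof (intro borel_measurable_times_ennreal)
    have "(\<lambda>r. (fst (fst r), ?a (fst (fst r)) - snd r - inverse (snd (fst r)))) \<in> (P \<Otimes>\<^sub>M borel) \<Otimes>\<^sub>M \<nu> \<rightarrow>\<^sub>M P \<Otimes>\<^sub>M borel"
      by measurable
    from measurable_compose[OF this F]
    show "(\<lambda>p. \<integral>\<^sup>+t. F (fst p) (?a (fst p) - t - inverse (snd p)) \<partial>\<nu>) \<in> borel_measurable (P \<Otimes>\<^sub>M borel)"
      by (intro borel_measurable_nn_integral[of "\<lambda>p t. F (fst p) (?a (fst p) - t - inverse (snd p))"]) (simp add: case_prod_beta')
  qed measurable
  show "off_path n (z \<circ> Suc) F'"
    using off off_path_side_child[OF ch, of L E] by (auto simp: off_path_def F'_def)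
qed

lemma path_estimate:
  assumes "chain rt n z" "d rt (z n) \<le> L"
    and "(\<lambda>p. F (fst p) (snd p)) \<in> borel_measurable (P \<Otimes>\<^sub>M borel)"
    and "off_path n z F" "\<And>v. wnorm (F v) \<le> ennreal (\<beta>\<^sup>2)" "\<beta> \<ge> 0"
  shows "(\<integral>\<^sup>+v. F v (ratio_in rt (pot v) L E (z 0)) * tail_prod rt L E n z v \<partial>P) \<le> ennreal (sqrt b * \<beta> * rate ^ n)"
  using assms
proof (induction n arbitrary: z F \<beta>)
  case 0
  interpret P: prob_space P by (rule prob_space_P)
  note F = 0(3)
  have meas: "(\<lambda>v. F v (ratio_in rt (pot v) L E (z 0))) \<in> borel_measurable P"
    by (intro measurable_F_comp[OF F]) measurable
  have F_upd: "F (v(z 0 := t)) = F v" for v t using 0(4) by (simp add: off_path_def)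
  have z0: "d rt (z 0) \<le> L" using 0 by simp
  have "smear (side rt L E {} (z 0) v) (F v) 0 \<le> ennreal (sqrt b * \<beta>)" for v
  proof -
    have "(smear (side rt L E {} (z 0) v) (F v) 0)\<^sup>2 \<le> ennreal b * sqnorm (F v)"
      by (rule smear_le_sqnorm) (rule measurable_section[OF F])
    also have "\<dots> \<le> ennreal b * ennreal (\<beta>\<^sup>2)"
      by (intro mult_left_mono order_trans[OF sqnorm_le_wnorm 0(5)]) simp
    also have "\<dots> = ennreal ((sqrt b * \<beta>)\<^sup>2)" using b_pos by (simp add: power_mult_distrib ennreal_mult)
    also have "\<dots> = ennreal (sqrt b * \<beta>) ^ 2" using b_pos 0(6) by (simp add: ennreal_power)
    finally show ?thesis by (rule ennreal_le_if_square_le) (use b_pos 0(6) in simp)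
  qed
  then have "(\<integral>\<^sup>+v. F v (ratio_in rt (pot v) L E (z 0)) \<partial>P) \<le> (\<integral>\<^sup>+v. ennreal (sqrt b * \<beta>) \<partial>P)"
    unfolding integral_out[OF meas, of "z 0"] F_upd ratio_in_upd_self[OF z0] smear_def
    by (intro nn_integral_mono) simp
  then show ?case by (simp add: tail_prod_def P.emeasure_space_1[simplified])
next
  case (Suc n)
  let ?F' = "\<lambda>v. transfer (side rt L E {z 1} (z 0) v) (F v)"
  note step = path_step[OF Suc.prems(1-4), of E]
  have "(\<integral>\<^sup>+v. ?F' v (ratio_in rt (pot v) L E ((z \<circ> Suc) 0)) * tail_prod rt L E n (z \<circ> Suc) v \<partial>P)
      \<le> ennreal (sqrt b * (rate * \<beta>) * rate ^ n)"
  proof (rule Suc.IH[OF chain_Suc[OF Suc.prems(1)] _ step(2,3)])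
    fix v
    have "wnorm (?F' v) \<le> ennreal (rate\<^sup>2) * wnorm (F v)"
      using Suc.prems(5)[of v] measurable_section[OF Suc.prems(3)]
      by (intro wnorm_transfer) (auto intro: order.strict_trans1)
    also have "\<dots> \<le> ennreal (rate\<^sup>2) * ennreal (\<beta>\<^sup>2)" by (intro mult_left_mono Suc.prems) simp
    also have "\<dots> = ennreal ((rate * \<beta>)\<^sup>2)" by (simp add: power_mult_distrib ennreal_mult)
    finally show "wnorm (?F' v) \<le> ennreal ((rate * \<beta>)\<^sup>2)" .
  qed (use Suc.prems rate_bounds in auto)
  then show ?case unfolding step(1) by (simp add: mult_ac)
qed

text \<open>The first step starts from the indicator of a small interval, whose \<open>L\<^sup>2\<close> norm relative to its
  mass blows up; smearing it out restores a bound proportional to \<open>\<delta>\<close>.\<close>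

lemma transfer_indicator_bound:
  assumes "\<delta> > 0"
  shows "wnorm (transfer a (indicator {-\<delta><..<\<delta>})) \<le> ennreal ((3 * \<delta> * sqrt b)\<^sup>2)"
proof -
  let ?f = "indicator {-\<delta><..<\<delta>} :: real \<Rightarrow> ennreal"
  have le: "smear a ?f s \<le> ennreal (2 * \<delta> * b)" for s
  proof -
    have "smear a ?f s \<le> ennreal b * (\<integral>\<^sup>+t. ?f (a - t - s) \<partial>lborel)"
      unfolding smear_def by (rule dominated) measurable
    also have "(\<integral>\<^sup>+t. ?f (a - t - s) \<partial>lborel) = (\<integral>\<^sup>+t. ?f ((a - s) - t) \<partial>lborel)"
      by (simp add: algebra_simps)
    also have "\<dots> = (\<integral>\<^sup>+t. ?f t \<partial>lborel)" by (rule nn_integral_reflect) simp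
    also have "\<dots> = ennreal (2 * \<delta>)" using assms by simp
    also have "ennreal b * \<dots> = ennreal (2 * \<delta> * b)" using assms b_pos by (simp add: ennreal_mult[symmetric] mult_ac)
    finally show ?thesis .
  qed
  have tot: "(\<integral>\<^sup>+s. smear a ?f s \<partial>lborel) = ennreal (2 * \<delta>)"
  proof -
    interpret pair_sigma_finite lborel \<nu> by standard
    have "(\<integral>\<^sup>+s. smear a ?f s \<partial>lborel) = (\<integral>\<^sup>+t. (\<integral>\<^sup>+s. ?f ((a - t) - s) \<partial>lborel) \<partial>\<nu>)"
      unfolding smear_def by (rule Fubini'[symmetric]) measurable
    also have "\<dots> = (\<integral>\<^sup>+t. (\<integral>\<^sup>+s. ?f s \<partial>lborel) \<partial>\<nu>)"
      by (intro nn_integral_cong nn_integral_reflect) simp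
    also have "\<dots> = ennreal (2 * \<delta>)" using assms by simp
    finally show ?thesis .
  qed
  have "sqnorm (smear a ?f) \<le> (\<integral>\<^sup>+s. ennreal (2 * \<delta> * b) * smear a ?f s \<partial>lborel)"
    unfolding sqnorm_def power2_eq_square by (intro nn_integral_mono mult_right_mono le) simp
  also have "\<dots> = ennreal (2 * \<delta> * b) * ennreal (2 * \<delta>)" by (simp add: nn_integral_cmult tot)
  finally have "sqnorm (smear a ?f) \<le> ennreal (2 * \<delta> * b) * ennreal (2 * \<delta>)" .
  then have "wnorm (transfer a ?f) \<le> 2 * (ennreal (2 * \<delta> * b) * ennreal (2 * \<delta>))"
    by (intro order_trans[OF wnorm_le_sqnorm] mult_left_mono) (simp_all add: sqnorm_transfer)
  also have "\<dots> = ennreal (8 * \<delta>\<^sup>2 * b)"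
    using assms b_pos by (simp add: ennreal_mult[symmetric] power2_eq_square flip: ennreal_numeral)
  also have "\<dots> \<le> ennreal ((3 * \<delta> * sqrt b)\<^sup>2)"
    using assms b_pos by (intro ennreal_leI) (simp add: power_mult_distrib)
  finally show ?thesis .
qed

text \<open>The first transfer is spent on the indicator, which leaves \<open>n - 1\<close>
  contractions; dividing by \<open>rate\<close> compensates for the missing one and also covers the
  path that consists of the root alone.\<close>

lemma path_probability:
  assumes ch: "chain rt n z" and L: "d rt (z n) \<le> L" and \<delta>: "\<delta> > 0"
  shows "(\<integral>\<^sup>+v. indicator {-\<delta><..<\<delta>} (ratio_in rt (pot v) L E (z 0)) * tail_prod rt L E n z v \<partial>P)
      \<le> ennreal (3 * b * \<delta> / rate * rate ^ n)"
proof (cases n)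
  case 0
  interpret P: prob_space P by (rule prob_space_P)
  have z0: "d rt (z 0) \<le> L" using 0 L by simp
  have meas: "(\<lambda>v. indicator {-\<delta><..<\<delta>} (ratio_in rt (pot v) L E (z 0)) :: ennreal) \<in> borel_measurable P"
    by (rule measurable_compose[OF ratio_in_measurable']) simp
  have "(\<integral>\<^sup>+t. indicator {-\<delta><..<\<delta>} (side rt L E {} (z 0) v - t) \<partial>\<nu>) \<le> ennreal (2 * b * \<delta>)" for v
  proof -
    let ?a = "side rt L E {} (z 0) v"
    have "(\<integral>\<^sup>+t. indicator {-\<delta><..<\<delta>} (?a - t) \<partial>\<nu>) \<le> ennreal b * (\<integral>\<^sup>+t. indicator {-\<delta><..<\<delta>} (?a - t) \<partial>lborel)"
      by (rule dominated) measurable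
    also have "(\<integral>\<^sup>+t. indicator {-\<delta><..<\<delta>} (?a - t) \<partial>lborel) = (\<integral>\<^sup>+t. indicator {-\<delta><..<\<delta>} t \<partial>lborel)"
      by (rule nn_integral_reflect) simp
    also have "\<dots> = ennreal (2 * \<delta>)" using \<delta> by simp
    also have "ennreal b * \<dots> = ennreal (2 * b * \<delta>)" using \<delta> b_pos by (simp add: ennreal_mult[symmetric] mult_ac)
    finally show ?thesis .
  qed
  then have "(\<integral>\<^sup>+v. indicator {-\<delta><..<\<delta>} (ratio_in rt (pot v) L E (z 0)) \<partial>P) \<le> (\<integral>\<^sup>+v. ennreal (2 * b * \<delta>) \<partial>P)"
    unfolding integral_out[OF meas, of "z 0"] ratio_in_upd_self[OF z0] by (intro nn_integral_mono)
  also have "\<dots> = ennreal (2 * b * \<delta>)" using P.emeasure_space_1 by simp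
  also have "\<dots> \<le> ennreal (3 * b * \<delta> / rate * rate ^ n)"
  proof (rule ennreal_leI)
    have "2 * (b * \<delta>) * rate \<le> 3 * (b * \<delta>) * 1"
      using rate_bounds b_pos \<delta> by (intro mult_mono) auto
    then show "2 * b * \<delta> \<le> 3 * b * \<delta> / rate * rate ^ n" using 0 rate_bounds by (simp add: field_simps)
  qed
  finally show ?thesis using 0 by (simp add: tail_prod_def)
next
  case (Suc m)
  let ?F = "\<lambda>v :: 'v \<Rightarrow> real. indicator {-\<delta><..<\<delta>} :: real \<Rightarrow> ennreal"
  have F: "(\<lambda>p. ?F (fst p) (snd p)) \<in> borel_measurable (P \<Otimes>\<^sub>M borel)"
    by (rule measurable_compose[OF measurable_snd]) simp
  have off: "off_path (Suc m) z ?F" by (simp add: off_path_def)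
  note step = path_step[OF ch[unfolded Suc] L[unfolded Suc] F off, of E]
  have "(\<integral>\<^sup>+v. ?F v (ratio_in rt (pot v) L E (z 0)) * tail_prod rt L E (Suc m) z v \<partial>P)
     \<le> ennreal (sqrt b * (3 * \<delta> * sqrt b) * rate ^ m)"
    unfolding step(1)
    using chain_Suc[OF ch[unfolded Suc]] L Suc \<delta> b_pos
    by (intro path_estimate step(2,3) transfer_indicator_bound) (auto simp: comp_def)
  also have "sqrt b * (3 * \<delta> * sqrt b) * rate ^ m = 3 * b * \<delta> / rate * rate ^ n"
    using b_pos rate_bounds Suc by (simp add: mult_ac)
  finally show ?thesis using Suc by simp
qed

section \<open>Expected eigenfunction correlators\<close>

definition decay :: real where "decay = sqrt rate"

lemma decay_bounds: "0 < decay" "decay < 1" and decay_square: "decay\<^sup>2 = rate"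
  using rate_bounds by (auto simp: decay_def)

text \<open>The bound \<open>rate ^ n\<close> is \<open>decay ^ n\<close> squared. One factor
  cancels the weight, which later yields the decay of eigenfunctions; the other is kept to sum over
  all vertices.\<close>

definition weight :: "'v \<Rightarrow> 'v \<Rightarrow> real" where "weight rt y = (1 / decay) ^ d rt y"

lemma weight_pos: "weight rt y > 0"
  using decay_bounds by (simp add: weight_def)

lemma path_weight_bound:
  assumes y: "d rt y \<le> L" and \<delta>: "\<delta> > 0"
  shows "(\<integral>\<^sup>+v. indicator {-\<delta><..<\<delta>} (ratio_in rt (pot v) L E rt) * ennreal (weight rt y * \<bar>path_weight rt (pot v) L E y\<bar>) \<partial>P)
     \<le> ennreal (3 * b * \<delta> / rate * decay ^ d rt y)"
proof -
  define n where "n = d rt y"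
  \<comment> \<open>\<open>path_weight\<close> counts from \<open>y\<close> upwards, a chain from
    the root downwards.\<close>
  define z where "z j = (par rt ^^ (n - j)) y" for j
  have ch: "chain rt n z"
    unfolding chain_def
  proof (intro allI impI)
    fix i assume i: "i < n"
    have "d rt (z (Suc i)) = Suc i" unfolding z_def using gdist_anc[of "n - Suc i" rt y] i by (simp add: n_def)
    then have "z (Suc i) \<noteq> rt" by auto
    moreover have "par rt (z (Suc i)) = z i"
    proof -
      have "n - i = Suc (n - Suc i)" using i by simp
      then show ?thesis by (simp add: z_def)
    qed
    ultimately show "z (Suc i) \<in> children rt (z i)" by (simp add: children_iff)
  qed
  have z0: "z 0 = rt" using anc_eq_root[of rt y] by (simp add: z_def n_def)
  have pw: "ennreal \<bar>path_weight rt (pot v) L E y\<bar> = tail_prod rt L E n z v" for v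
  proof -
    have "\<bar>path_weight rt (pot v) L E y\<bar> = (\<Prod>i<n. \<bar>inverse (ratio_in rt (pot v) L E ((par rt ^^ i) y))\<bar>)"
      by (simp add: path_weight_def abs_prod n_def)
    also have "\<dots> = (\<Prod>i<n. \<bar>inverse (ratio_in rt (pot v) L E ((par rt ^^ (n - Suc i)) y))\<bar>)"
      by (rule prod.nat_diff_reindex[symmetric])
    also have "ennreal \<dots> = tail_prod rt L E n z v"
      by (simp add: tail_prod_def z_def prod_ennreal)
    finally show ?thesis .
  qed
  have meas: "(\<lambda>v. indicator {-\<delta><..<\<delta>} (ratio_in rt (pot v) L E rt) * tail_prod rt L E n z v) \<in> borel_measurable P"
    by (intro borel_measurable_times_ennreal tail_prod_measurable measurable_compose[OF ratio_in_measurable']) simp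
  have "(\<integral>\<^sup>+v. indicator {-\<delta><..<\<delta>} (ratio_in rt (pot v) L E rt) * ennreal (weight rt y * \<bar>path_weight rt (pot v) L E y\<bar>) \<partial>P)
     = (\<integral>\<^sup>+v. ennreal (weight rt y) * (indicator {-\<delta><..<\<delta>} (ratio_in rt (pot v) L E rt) * tail_prod rt L E n z v) \<partial>P)"
    using weight_pos[of rt y] by (intro nn_integral_cong) (simp add: ennreal_mult pw mult_ac less_imp_le)
  also have "\<dots> = ennreal (weight rt y) * (\<integral>\<^sup>+v. indicator {-\<delta><..<\<delta>} (ratio_in rt (pot v) L E rt) * tail_prod rt L E n z v \<partial>P)"
    by (rule nn_integral_cmult[OF meas])
  also have "\<dots> \<le> ennreal (weight rt y) * ennreal (3 * b * \<delta> / rate * rate ^ n)"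
    using path_probability[OF ch _ \<delta>, of L E] y by (intro mult_left_mono) (auto simp: z0 z_def n_def anc_eq_root)
  also have "\<dots> = ennreal (weight rt y * (3 * b * \<delta> / rate * rate ^ n))"
    using weight_pos[of rt y] b_pos \<delta> rate_bounds by (intro ennreal_mult[symmetric]) (auto simp: less_imp_le)
  also have "weight rt y * (3 * b * \<delta> / rate * rate ^ n) = 3 * b * \<delta> / rate * ((1 / decay) ^ n * rate ^ n)"
    by (simp add: weight_def n_def)
  also have "(1 / decay) ^ n * rate ^ n = decay ^ n"
    using decay_bounds by (simp add: decay_square[symmetric] power_mult_distrib[symmetric] power2_eq_square)
  finally show ?thesis by (simp add: n_def)
qed

lemma correlator_density_measurable [measurable]:
  "(\<lambda>p. correlator_density rt (pot (snd p)) L \<omega> \<delta> (fst p)) \<in> borel_measurable (borel \<Otimes>\<^sub>M P)"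
  unfolding correlator_density_def path_weight_def by measurable

definition correlator :: "'v \<Rightarrow> nat \<Rightarrow> real \<Rightarrow> real \<Rightarrow> ('v \<Rightarrow> real) \<Rightarrow> ennreal" where
  "correlator rt L R \<delta> v =
     (\<integral>\<^sup>+E. ennreal (correlator_density rt (pot v) L (weight rt) \<delta> E) * indicator {-R..R} E \<partial>lborel)"

lemma correlator_measurable [measurable]: "correlator rt L R \<delta> \<in> borel_measurable P"
  unfolding correlator_def
proof (rule lborel.borel_measurable_nn_integral)
  have "(\<lambda>p. correlator_density rt (pot (fst p)) L (weight rt) \<delta> (snd p)) \<in> borel_measurable (P \<Otimes>\<^sub>M borel)"
    using measurable_compose[OF measurable_pair_swap' correlator_density_measurable, of rt L "weight rt" \<delta>]
    by (simp add: case_prod_beta')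
  then show "(\<lambda>(v, E). ennreal (correlator_density rt (pot v) L (weight rt) \<delta> E) * indicator {-R..R} E) \<in> borel_measurable (P \<Otimes>\<^sub>M lborel)"
    by (simp add: case_prod_beta' cong: measurable_cong_sets)
qed

definition corr_bound :: "'v \<Rightarrow> real \<Rightarrow> real" where
  "corr_bound rt R = 6 * b * R / rate * (\<Sum>\<^sub>\<infinity>y. decay ^ d rt y)"

text \<open>Linear in \<delta>, to match the lower bound of \<open>correlator_lower_bound\<close>,
  and uniform in the ball: the bound at fixed energy is integrated over an interval of length
  \<open>2 * R\<close>.\<close>

lemma expectation_correlator:
  assumes \<delta>: "\<delta> > 0" and R: "R > 0"
  shows "(\<integral>\<^sup>+v. correlator rt L R \<delta> v \<partial>P) \<le> ennreal (corr_bound rt R * \<delta>)"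
proof -
  interpret P: prob_space P by (rule prob_space_P)
  interpret pair_sigma_finite lborel P by standard
  let ?S = "\<Sum>\<^sub>\<infinity>y. decay ^ d rt y"
  have S: "(\<Sum>y\<in>ball rt L. decay ^ d rt y) \<le> ?S"
    using summable_exp[OF decay_bounds] decay_bounds finite_ball by (intro finite_sum_le_infsum) auto
  have S0: "?S \<ge> 0" using decay_bounds by (intro infsum_nonneg) auto
  have inner: "(\<integral>\<^sup>+v. ennreal (correlator_density rt (pot v) L (weight rt) \<delta> E) \<partial>P) \<le> ennreal (3 * b * \<delta> / rate * ?S)" for E
  proof -
    have "(\<integral>\<^sup>+v. ennreal (correlator_density rt (pot v) L (weight rt) \<delta> E) \<partial>P)
       = (\<integral>\<^sup>+v. (\<Sum>y\<in>ball rt L. indicator {-\<delta><..<\<delta>} (ratio_in rt (pot v) L E rt) * ennreal (weight rt y * \<bar>path_weight rt (pot v) L E y\<bar>)) \<partial>P)"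
      using weight_pos
      by (intro nn_integral_cong) (auto simp: correlator_density_def indicator_def abs_less_iff less_imp_le)
    also have "\<dots> = (\<Sum>y\<in>ball rt L. (\<integral>\<^sup>+v. indicator {-\<delta><..<\<delta>} (ratio_in rt (pot v) L E rt) * ennreal (weight rt y * \<bar>path_weight rt (pot v) L E y\<bar>) \<partial>P))"
    proof (rule nn_integral_sum)
      fix y
      have "(\<lambda>v. path_weight rt (pot v) L E y) \<in> borel_measurable P" unfolding path_weight_def by measurable
      then show "(\<lambda>v. indicator {-\<delta><..<\<delta>} (ratio_in rt (pot v) L E rt) * ennreal (weight rt y * \<bar>path_weight rt (pot v) L E y\<bar>)) \<in> borel_measurable P"
        by (intro borel_measurable_times_ennreal measurable_compose[OF ratio_in_measurable']) simp_all
    qed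
    also have "\<dots> \<le> (\<Sum>y\<in>ball rt L. ennreal (3 * b * \<delta> / rate * decay ^ d rt y))"
      using \<delta> by (intro sum_mono path_weight_bound) auto
    also have "\<dots> = ennreal (3 * b * \<delta> / rate * (\<Sum>y\<in>ball rt L. decay ^ d rt y))"
      using \<delta> b_pos rate_bounds decay_bounds by (subst sum_ennreal) (auto simp: sum_distrib_left)
    also have "\<dots> \<le> ennreal (3 * b * \<delta> / rate * ?S)"
      using \<delta> b_pos rate_bounds by (intro ennreal_leI mult_left_mono S) auto
    finally show ?thesis .
  qed
  have "(\<integral>\<^sup>+v. correlator rt L R \<delta> v \<partial>P)
     = (\<integral>\<^sup>+E. (\<integral>\<^sup>+v. ennreal (correlator_density rt (pot v) L (weight rt) \<delta> E) * indicator {-R..R} E \<partial>P) \<partial>lborel)"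
    unfolding correlator_def
  proof (rule Fubini')
    show "(\<lambda>(E, v). ennreal (correlator_density rt (pot v) L (weight rt) \<delta> E) * indicator {-R..R} E) \<in> borel_measurable (lborel \<Otimes>\<^sub>M P)"
      using correlator_density_measurable[of rt L "weight rt" \<delta>] by (simp add: case_prod_beta' cong: measurable_cong_sets)
  qed
  also have "\<dots> \<le> (\<integral>\<^sup>+E. ennreal (3 * b * \<delta> / rate * ?S) * indicator {-R..R} E \<partial>lborel)"
    by (intro nn_integral_mono) (use inner in \<open>auto simp: indicator_def\<close>)
  also have "\<dots> = ennreal (3 * b * \<delta> / rate * ?S) * ennreal (2 * R)"
    using R by (subst nn_integral_cmult_indicator) auto
  also have "\<dots> = ennreal (corr_bound rt R * \<delta>)"
    using \<delta> b_pos rate_bounds S0 R by (subst ennreal_mult[symmetric]) (auto simp: corr_bound_def mult_ac)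
  finally show ?thesis .
qed

text \<open>The two limits are separate because the threshold for \<delta> depends on the ball and
  the potential: the window shrinks in a fixed ball before the ball grows. Fatou's lemma applies to
  each.\<close>

definition correlator_limit :: "'v \<Rightarrow> real \<Rightarrow> ('v \<Rightarrow> real) \<Rightarrow> ennreal" where
  "correlator_limit rt R v =
     liminf (\<lambda>L. liminf (\<lambda>m. ennreal (real (Suc m)) * correlator rt L R (1 / real (Suc m)) v))"

lemma AE_correlator_limit_finite:
  assumes R: "R > 0"
  shows "AE v in P. correlator_limit rt R v < \<infinity>"
proof -
  let ?X = "\<lambda>L m v. ennreal (real (Suc m)) * correlator rt L R (1 / real (Suc m)) v"
  have 1: "(\<integral>\<^sup>+v. ?X L m v \<partial>P) \<le> ennreal (corr_bound rt R)" for L m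
  proof -
    have "(\<integral>\<^sup>+v. ?X L m v \<partial>P) = ennreal (real (Suc m)) * (\<integral>\<^sup>+v. correlator rt L R (1 / real (Suc m)) v \<partial>P)"
      by (rule nn_integral_cmult) measurable
    also have "\<dots> \<le> ennreal (real (Suc m)) * ennreal (corr_bound rt R * (1 / real (Suc m)))"
      using R by (intro mult_left_mono expectation_correlator) auto
    also have "\<dots> = ennreal (real (Suc m) * (corr_bound rt R * (1 / real (Suc m))))"
      by (rule ennreal_mult'[symmetric]) simp
    also have "real (Suc m) * (corr_bound rt R * (1 / real (Suc m))) = corr_bound rt R" by simp
    finally show ?thesis .
  qed
  have 2: "(\<integral>\<^sup>+v. liminf (\<lambda>m. ?X L m v) \<partial>P) \<le> ennreal (corr_bound rt R)" for L
  proof -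
    have "(\<integral>\<^sup>+v. liminf (\<lambda>m. ?X L m v) \<partial>P) \<le> liminf (\<lambda>m. \<integral>\<^sup>+v. ?X L m v \<partial>P)"
      by (rule nn_integral_liminf) measurable
    also have "\<dots> \<le> liminf (\<lambda>m::nat. ennreal (corr_bound rt R))"
      by (intro Liminf_mono always_eventually allI 1)
    finally show ?thesis by (simp add: Liminf_const)
  qed
  have "(\<integral>\<^sup>+v. correlator_limit rt R v \<partial>P) \<le> liminf (\<lambda>L. \<integral>\<^sup>+v. liminf (\<lambda>m. ?X L m v) \<partial>P)"
    unfolding correlator_limit_def by (rule nn_integral_liminf) measurable
  also have "\<dots> \<le> liminf (\<lambda>L::nat. ennreal (corr_bound rt R))"
    by (intro Liminf_mono always_eventually allI 2)
  finally have "(\<integral>\<^sup>+v. correlator_limit rt R v \<partial>P) \<le> ennreal (corr_bound rt R)" by (simp add: Liminf_const)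
  then have "(\<integral>\<^sup>+v. correlator_limit rt R v \<partial>P) \<noteq> \<infinity>" by (auto simp: top_unique)
  then have "AE v in P. correlator_limit rt R v \<noteq> \<infinity>"
    unfolding correlator_limit_def by (intro nn_integral_PInf_AE) measurable
  then show ?thesis by eventually_elim (simp add: less_top)
qed

text \<open>A finite limes inferior gives a bound along infinitely many radii, which is what a
  compactness argument uses. The bound holds for every decomposition \<open>S\<close>,
  \<open>w\<close>, so eigenvectors never have to be chosen measurably.\<close>

lemma AE_correlator_bound:
  assumes R: "R > 0"
  shows "AE v in P. \<exists>K. \<forall>L0. \<exists>L\<ge>L0. \<forall>S w. ball_eigen rt (pot v) L S w \<longrightarrow>
    (\<Sum>e\<in>S \<inter> {-R<..<R}. weighted_sum rt L (weight rt) (w e)) \<le> K"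
proof -
  have "AE v in P. \<forall>L. AE E in lborel. regular rt (pot v) L E"
    unfolding AE_all_countable using AE_regular by blast
  with AE_correlator_limit_finite[OF R, of rt] show ?thesis
  proof eventually_elim
    case (elim v)
    let ?Y = "\<lambda>L. liminf (\<lambda>m. ennreal (real (Suc m)) * correlator rt L R (1 / real (Suc m)) v)"
    obtain K where K: "K \<ge> 0" "correlator_limit rt R v < ennreal K"
      proof (cases "correlator_limit rt R v")
      case (real r)
      then show thesis by (intro that[of "r + 1"]) (auto simp: ennreal_less_iff)
    qed (use elim(1) in auto)
    have lower: "ennreal ((\<Sum>e\<in>S \<inter> {-R<..<R}. weighted_sum rt L (weight rt) (w e)) / 2) \<le> ?Y L"
      if be: "ball_eigen rt (pot v) L S w" for L S w
    proof -
      let ?W = "\<Sum>e\<in>S \<inter> {-R<..<R}. weighted_sum rt L (weight rt) (w e)"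
      have "\<exists>\<delta>0>0. \<forall>\<delta>. 0 < \<delta> \<and> \<delta> < \<delta>0 \<longrightarrow> ennreal (\<delta> / 2 * ?W) \<le> correlator rt L R \<delta> v"
        unfolding correlator_def by (rule correlator_lower_bound[OF be weight_pos spec[OF elim(2)]])
      then obtain \<delta>0 where \<delta>0: "\<delta>0 > 0" "\<And>\<delta>. 0 < \<delta> \<Longrightarrow> \<delta> < \<delta>0 \<Longrightarrow> ennreal (\<delta> / 2 * ?W) \<le> correlator rt L R \<delta> v"
        by blast
      obtain m0 where m0: "1 / real (Suc m0) < \<delta>0" by (rule nat_approx_posE[OF \<delta>0(1)])
      have "eventually (\<lambda>m. ennreal (?W / 2) \<le> ennreal (real (Suc m)) * correlator rt L R (1 / real (Suc m)) v) sequentially"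
        unfolding eventually_sequentially
      proof (intro exI[of _ m0] allI impI)
        fix m assume "m0 \<le> m"
        then have "1 / real (Suc m) \<le> 1 / real (Suc m0)" by (intro divide_left_mono) auto
        then have "1 / real (Suc m) < \<delta>0" using m0 by linarith
        from \<delta>0(2)[OF _ this] have "ennreal (real (Suc m)) * ennreal (1 / real (Suc m) / 2 * ?W) \<le> ennreal (real (Suc m)) * correlator rt L R (1 / real (Suc m)) v"
          by (intro mult_left_mono) auto
        moreover have "ennreal (real (Suc m)) * ennreal (1 / real (Suc m) / 2 * ?W) = ennreal (real (Suc m) * (1 / real (Suc m) / 2 * ?W))"
          by (rule ennreal_mult'[symmetric]) simp
        moreover have "real (Suc m) * (1 / real (Suc m) / 2 * ?W) = ?W / 2" by (simp del: of_nat_Suc)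
        ultimately show "ennreal (?W / 2) \<le> ennreal (real (Suc m)) * correlator rt L R (1 / real (Suc m)) v"
          by (simp only:)
      qed
      then show ?thesis by (rule Liminf_bounded)
    qed
    show ?case
    proof (intro exI[of _ "2 * K"] allI)
      fix L0
      have "\<exists>L\<ge>L0. ?Y L < ennreal K"
      proof (rule ccontr)
        assume "\<not> ?thesis"
        then have "eventually (\<lambda>L. ennreal K \<le> ?Y L) sequentially"
          unfolding eventually_sequentially by (auto simp: not_less intro!: exI[of _ L0])
        then have "ennreal K \<le> correlator_limit rt R v" unfolding correlator_limit_def by (rule Liminf_bounded)
        then show False using K by simp
      qed
      then obtain L where L: "L \<ge> L0" "?Y L < ennreal K" by blast
      show "\<exists>L\<ge>L0. \<forall>S w. ball_eigen rt (pot v) L S w \<longrightarrow>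
         (\<Sum>e\<in>S \<inter> {-R<..<R}. weighted_sum rt L (weight rt) (w e)) \<le> 2 * K"
      proof (intro exI[of _ L] conjI allI impI L(1))
        fix S w assume "ball_eigen rt (pot v) L S w"
        from order.strict_trans1[OF lower[OF this] L(2)]
        have "ennreal ((\<Sum>e\<in>S \<inter> {-R<..<R}. weighted_sum rt L (weight rt) (w e)) / 2) \<le> ennreal K" by simp
        then show "(\<Sum>e\<in>S \<inter> {-R<..<R}. weighted_sum rt L (weight rt) (w e)) \<le> 2 * K"
          using K(1) by (subst (asm) ennreal_le_iff) auto
      qed
    qed
  qed
qed

end

section \<open>The infinite-volume limit\<close>

context anderson_tree
begin

definition correlators_bounded :: "'v \<Rightarrow> ('v \<Rightarrow> real) \<Rightarrow> bool" where
  "correlators_bounded rt q \<longleftrightarrow> (\<forall>R>0. \<exists>K. \<forall>L0. \<exists>L\<ge>L0. \<forall>S w. ball_eigen rt q L S w \<longrightarrow>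
    (\<Sum>e\<in>S \<inter> {-R<..<R}. weighted_sum rt L (weight rt) (w e)) \<le> K)"

lemma AE_correlators_bounded: "AE v in P. correlators_bounded rt (pot v)"
proof -
  have "AE v in P. \<forall>n::nat. \<exists>K. \<forall>L0. \<exists>L\<ge>L0. \<forall>S w. ball_eigen rt (pot v) L S w \<longrightarrow>
    (\<Sum>e\<in>S \<inter> {-real (Suc n)<..<real (Suc n)}. weighted_sum rt L (weight rt) (w e)) \<le> K"
    unfolding AE_all_countable by (intro allI AE_correlator_bound) simp
  then show ?thesis
  proof eventually_elim
    case (elim v)
    show ?case
      unfolding correlators_bounded_def
    proof (intro allI impI)
      fix R :: real
      obtain n where n: "R \<le> real (Suc n)" by (meson le_SucI of_nat_mono order_trans real_arch_simple lessI less_imp_le)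
      obtain K where K: "\<forall>L0. \<exists>L\<ge>L0. \<forall>S w. ball_eigen rt (pot v) L S w \<longrightarrow>
        (\<Sum>e\<in>S \<inter> {-real (Suc n)<..<real (Suc n)}. weighted_sum rt L (weight rt) (w e)) \<le> K" using elim by blast
      have mono: "(\<Sum>e\<in>S \<inter> {-R<..<R}. weighted_sum rt L (weight rt) (w e))
         \<le> (\<Sum>e\<in>S \<inter> {-real (Suc n)<..<real (Suc n)}. weighted_sum rt L (weight rt) (w e))"
        if "ball_eigen rt (pot v) L S w" for L S w
        using that n weight_pos
        by (intro sum_mono2) (auto simp: ball_eigen_def weighted_sum_def less_imp_le intro!: sum_nonneg)
      show "\<exists>K. \<forall>L0. \<exists>L\<ge>L0. \<forall>S w. ball_eigen rt (pot v) L S w \<longrightarrow>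
         (\<Sum>e\<in>S \<inter> {-R<..<R}. weighted_sum rt L (weight rt) (w e)) \<le> K"
      proof (intro exI[of _ K] allI)
        fix L0
        obtain L where "L \<ge> L0" "\<forall>S w. ball_eigen rt (pot v) L S w \<longrightarrow>
          (\<Sum>e\<in>S \<inter> {-real (Suc n)<..<real (Suc n)}. weighted_sum rt L (weight rt) (w e)) \<le> K" using K by blast
        then show "\<exists>L\<ge>L0. \<forall>S w. ball_eigen rt (pot v) L S w \<longrightarrow>
          (\<Sum>e\<in>S \<inter> {-R<..<R}. weighted_sum rt L (weight rt) (w e)) \<le> K"
          using order_trans[OF mono] by blast
      qed
    qed
  qed
qed

lemma weight_ge_1: "weight rt y \<ge> 1"
  unfolding weight_def using decay_bounds by (intro one_le_power) simp

lemma sqrt_mass_le_weighted_sum: "sqrt (mass rt L f) \<le> weighted_sum rt L (weight rt) f"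
proof -
  have "sqrt (mass rt L f) \<le> (\<Sum>x\<in>ball rt L. cmod (f x))"
    using L2_set_le_sum[of "ball rt L" "\<lambda>x. cmod (f x)"] by (simp add: L2_set_def mass_def)
  also have "\<dots> \<le> weighted_sum rt L (weight rt) f"
    unfolding weighted_sum_def
    by (intro sum_mono) (use mult_right_mono[OF weight_ge_1 norm_ge_zero] in simp)
  finally show ?thesis .
qed

definition localized_eigenvector :: "'v \<Rightarrow> ('v \<Rightarrow> real) \<Rightarrow> real \<Rightarrow> ('v \<Rightarrow> complex) \<Rightarrow> bool" where
  "localized_eigenvector rt q e f \<longleftrightarrow>
     hop q f = (\<lambda>x. complex_of_real e * f x) \<and> (\<exists>A. \<forall>x. cmod (f x) \<le> A * decay ^ d rt x)"

text \<open>Only eigenvectors whose squared overlap with \<open>delta rt\<close> is at least \<open>\<epsilon>\<close> are kept: there are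
  boundedly many of them, and the correlator bound makes the total mass of the others at most
  \<open>K * sqrt \<epsilon>\<close>.\<close>

lemma ball_approximation:
  assumes be: "ball_eigen rt q L S w" and R: "R > 0" and \<epsilon>: "\<epsilon> > 0"
    and K: "(\<Sum>e\<in>S \<inter> {-R<..<R}. weighted_sum rt L (weight rt) (w e)) \<le> K"
    and N: "1 / \<epsilon> \<le> real N"
  obtains W \<kappa> where
    "\<And>i x. d rt x \<le> L \<Longrightarrow> hop q (W i) x = complex_of_real (\<kappa> i) * W i x"
    "\<And>i. \<bar>\<kappa> i\<bar> \<le> R" "\<And>i x. cmod (W i x) \<le> K * decay ^ d rt x"
    "\<And>X. finite X \<Longrightarrow> (\<Sum>x\<in>X. (cmod (delta rt x - (\<Sum>i<N. W i x)))\<^sup>2) \<le> (real Dmax + (q rt)\<^sup>2) / R\<^sup>2 + K * sqrt \<epsilon>"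
proof -
  let ?a = "\<lambda>e. mass rt L (w e)" and ?ws = "\<lambda>e. weighted_sum rt L (weight rt) (w e)"
  have fin: "finite S" and pos: "\<And>e. e \<in> S \<Longrightarrow> ?a e > 0" using be by (auto simp: ball_eigen_def)
  have ws0: "?ws e \<ge> 0" for e
    using weight_pos unfolding weighted_sum_def by (auto intro!: sum_nonneg simp: less_imp_le)
  define B where "B = {e \<in> S. \<bar>e\<bar> < R \<and> ?a e \<ge> \<epsilon>}"
  have B: "B \<subseteq> S" "finite B" using fin by (auto simp: B_def)
  have "real (card B) * \<epsilon> \<le> (\<Sum>e\<in>B. ?a e)" using sum_mono[of B "\<lambda>_. \<epsilon>" ?a] by (simp add: B_def)
  also have "\<dots> \<le> (\<Sum>e\<in>S. ?a e)" using fin B pos by (intro sum_mono2) (auto simp: less_imp_le)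
  also have "\<dots> = 1" by (rule ball_eigen_total_mass[OF be])
  finally have "real (card B) \<le> 1 / \<epsilon>" using \<epsilon> by (simp add: field_simps)
  then have cardB: "card B \<le> N" using N by linarith
  obtain h where h: "bij_betw h {0..<card B} B" using ex_bij_betw_nat_finite[OF B(2)] by blast
  define W where "W i = (if i < card B then w (h i) else (\<lambda>x. 0))" for i
  define \<kappa> where "\<kappa> i = (if i < card B then h i else 0)" for i
  have hB: "h i \<in> B" if "i < card B" for i using bij_betwE[OF h] that by auto
  have sumW: "(\<Sum>i<N. W i x) = (\<Sum>e\<in>B. w e x)" for x
  proof -
    have "(\<Sum>i<N. W i x) = (\<Sum>i\<in>{0..<card B}. w (h i) x)"
      using cardB by (intro sum.mono_neutral_cong_right) (auto simp: W_def)
    also have "\<dots> = (\<Sum>e\<in>B. w e x)" by (rule sum.reindex_bij_betw[OF h])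
    finally show ?thesis .
  qed
  show thesis
  proof (rule that)
    show "hop q (W i) x = complex_of_real (\<kappa> i) * W i x" if "d rt x \<le> L" for i x
      using be that by (auto simp: W_def \<kappa>_def ball_eigen_def hop_def)
    show "\<bar>\<kappa> i\<bar> \<le> R" for i using hB[of i] R by (auto simp: \<kappa>_def B_def)
    show "cmod (W i x) \<le> K * decay ^ d rt x" for i x
    proof -
      have K0: "K \<ge> 0" using sum_nonneg[of "S \<inter> {-R<..<R}" ?ws] ws0 K by auto
      show ?thesis
      proof (cases "i < card B \<and> d rt x \<le> L")
        case True
        have "weight rt x * cmod (w (h i) x) \<le> ?ws (h i)"
          unfolding weighted_sum_def using True weight_pos finite_ball
          by (intro member_le_sum) (auto simp: less_imp_le)
        also have "\<dots> \<le> (\<Sum>e\<in>S \<inter> {-R<..<R}. ?ws e)"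
          using hB[of i] True fin ws0 by (intro member_le_sum) (auto simp: B_def)
        also have "\<dots> \<le> K" by (rule K)
        finally show ?thesis using True decay_bounds by (simp add: W_def weight_def power_divide field_simps)
      next
        case False
        then have "W i x = 0" using be by (auto simp: W_def ball_eigen_def)
        then show ?thesis using K0 decay_bounds by simp
      qed
    qed
    fix X :: "'v set" assume X: "finite X"
    have rest: "delta rt x - (\<Sum>i<N. W i x) = (\<Sum>e\<in>S - B. w e x)" for x
      using be B fin by (simp add: sumW ball_eigen_def sum_diff)
    have "(\<Sum>x\<in>X. (cmod (delta rt x - (\<Sum>i<N. W i x)))\<^sup>2) \<le> (\<Sum>x\<in>X \<union> ball rt L. (cmod (\<Sum>e\<in>S - B. w e x))\<^sup>2)"
      unfolding rest using X finite_ball by (intro sum_mono2) auto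
    also have "\<dots> = mass rt L (\<lambda>x. \<Sum>e\<in>S - B. w e x)"
      unfolding mass_def using X finite_ball be by (intro sum.mono_neutral_right) (auto simp: ball_eigen_def)
    also have "\<dots> = (\<Sum>e\<in>S - B. ?a e)"
      using mass_orthogonal_sum[OF be, of "S - B" "\<lambda>_. 1"] by simp
    also have "\<dots> \<le> (\<Sum>e\<in>S. e\<^sup>2 * ?a e / R\<^sup>2) + (\<Sum>e\<in>S \<inter> {-R<..<R}. ?ws e * sqrt \<epsilon>)"
    proof -
      have "(\<Sum>e\<in>S - B. ?a e) = (\<Sum>e\<in>{e\<in>S. \<bar>e\<bar> \<ge> R}. ?a e) + (\<Sum>e\<in>{e\<in>S. \<bar>e\<bar> < R \<and> ?a e < \<epsilon>}. ?a e)"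
        using fin by (subst sum.union_disjoint[symmetric]) (auto simp: B_def intro!: sum.cong)
      also have "(\<Sum>e\<in>{e\<in>S. \<bar>e\<bar> \<ge> R}. ?a e) \<le> (\<Sum>e\<in>{e\<in>S. \<bar>e\<bar> \<ge> R}. e\<^sup>2 * ?a e / R\<^sup>2)"
      proof (intro sum_mono)
        fix e assume e: "e \<in> {e\<in>S. \<bar>e\<bar> \<ge> R}"
        then have "R\<^sup>2 \<le> e\<^sup>2" using R by (metis abs_le_square_iff abs_of_pos mem_Collect_eq)
        then have "R\<^sup>2 * ?a e \<le> e\<^sup>2 * ?a e" using pos[of e] e by (intro mult_right_mono) auto
        then show "?a e \<le> e\<^sup>2 * ?a e / R\<^sup>2" using R by (simp add: field_simps)
      qed
      also have "\<dots> \<le> (\<Sum>e\<in>S. e\<^sup>2 * ?a e / R\<^sup>2)"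
        using fin pos by (intro sum_mono2) (auto simp: less_imp_le)
      also have "(\<Sum>e\<in>{e\<in>S. \<bar>e\<bar> < R \<and> ?a e < \<epsilon>}. ?a e) \<le> (\<Sum>e\<in>{e\<in>S. \<bar>e\<bar> < R \<and> ?a e < \<epsilon>}. ?ws e * sqrt \<epsilon>)"
      proof (intro sum_mono)
        fix e assume e: "e \<in> {e\<in>S. \<bar>e\<bar> < R \<and> ?a e < \<epsilon>}"
        have "?a e = sqrt (?a e) * sqrt (?a e)" using pos[of e] e by simp
        also have "\<dots> \<le> ?ws e * sqrt \<epsilon>"
          using e pos[of e] ws0 by (intro mult_mono sqrt_mass_le_weighted_sum real_sqrt_le_mono) auto
        finally show "?a e \<le> ?ws e * sqrt \<epsilon>" .
      qed
      also have "\<dots> \<le> (\<Sum>e\<in>S \<inter> {-R<..<R}. ?ws e * sqrt \<epsilon>)"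
        using fin ws0 \<epsilon> by (intro sum_mono2) auto
      finally show ?thesis by simp
    qed
    also have "(\<Sum>e\<in>S. e\<^sup>2 * ?a e / R\<^sup>2) \<le> (real Dmax + (q rt)\<^sup>2) / R\<^sup>2"
      unfolding sum_divide_distrib[symmetric] by (intro divide_right_mono ball_eigen_energy[OF be]) simp
    also have "(\<Sum>e\<in>S \<inter> {-R<..<R}. ?ws e * sqrt \<epsilon>) \<le> K * sqrt \<epsilon>"
      unfolding sum_distrib_right[symmetric] using K \<epsilon> by (intro mult_right_mono) auto
    finally show "(\<Sum>x\<in>X. (cmod (delta rt x - (\<Sum>i<N. W i x)))\<^sup>2) \<le> (real Dmax + (q rt)\<^sup>2) / R\<^sup>2 + K * sqrt \<epsilon>"
      by simp
  qed
qed

text \<open>The number \<open>N\<close> of vectors and their decay bound do not depend on the ball,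
  so along a diagonal subsequence energies and values converge. The eigenvalue equation at a vertex
  involves finitely many values and the bounds are closed conditions, hence both survive the
  limit.\<close>

lemma localized_approximation:
  assumes bd: "correlators_bounded rt q" and \<eta>: "\<eta> > 0"
  shows "\<exists>N \<psi> \<kappa>. (\<forall>i. localized_eigenvector rt q (\<kappa> i) (\<psi> i)) \<and>
    ell2_norm (\<lambda>x. delta rt x - (\<Sum>i<N::nat. \<psi> i x)) \<le> \<eta>"
proof -
  \<comment> \<open>Makes the high-energy error in \<open>ball_approximation\<close> at most
    \<open>\<eta>^2 / 2\<close>.\<close>
  define R where "R = sqrt (2 * (real Dmax + (q rt)\<^sup>2 + 1)) / \<eta>"
  have R: "R > 0" unfolding R_def using \<eta> by (intro divide_pos_pos) (auto intro!: add_nonneg_pos)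
  have R2: "(real Dmax + (q rt)\<^sup>2) / R\<^sup>2 \<le> \<eta>\<^sup>2 / 2"
  proof -
    have "R\<^sup>2 = 2 * (real Dmax + (q rt)\<^sup>2 + 1) / \<eta>\<^sup>2"
      by (simp add: R_def power_divide)
    then have "R\<^sup>2 * (\<eta>\<^sup>2 / 2) = real Dmax + (q rt)\<^sup>2 + 1" using \<eta> by simp
    then have "real Dmax + (q rt)\<^sup>2 \<le> \<eta>\<^sup>2 / 2 * R\<^sup>2" by (simp add: mult.commute)
    then show ?thesis using R by (subst pos_divide_le_eq) auto
  qed
  obtain K0 where K0: "\<And>L0. \<exists>L\<ge>L0. \<forall>S w. ball_eigen rt q L S w \<longrightarrow>
    (\<Sum>e\<in>S \<inter> {-R<..<R}. weighted_sum rt L (weight rt) (w e)) \<le> K0"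
    using bd R unfolding correlators_bounded_def by blast
  define K where "K = max K0 1"
  have K: "K \<ge> 1" by (simp add: K_def)
  \<comment> \<open>Makes the error \<open>K * sqrt \<epsilon>\<close> from the discarded small
    components equal to \<open>\<eta>^2 / 2\<close>.\<close>
  define \<epsilon> where "\<epsilon> = (\<eta>\<^sup>2 / (2 * K))\<^sup>2"
  have \<epsilon>: "\<epsilon> > 0" using \<eta> K by (simp add: \<epsilon>_def)
  have Ke: "K * sqrt \<epsilon> = \<eta>\<^sup>2 / 2" using \<eta> K by (simp add: \<epsilon>_def)
  obtain N where N: "1 / \<epsilon> \<le> real N" using real_arch_simple by blast
  define good where "good n L W \<kappa> \<longleftrightarrow> L \<ge> n \<and> (\<forall>i x. d rt x \<le> L \<longrightarrow> hop q (W i) x = complex_of_real (\<kappa> i) * W i x) \<and>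
    (\<forall>i. \<bar>\<kappa> i\<bar> \<le> R) \<and> (\<forall>i x. cmod (W i x) \<le> K * decay ^ d rt x) \<and>
    (\<forall>X. finite X \<longrightarrow> (\<Sum>x\<in>X. (cmod (delta rt x - (\<Sum>i<N. W i x)))\<^sup>2) \<le> \<eta>\<^sup>2)"
    for n L :: nat and W :: "nat \<Rightarrow> 'v \<Rightarrow> complex" and \<kappa> :: "nat \<Rightarrow> real"
  have "\<exists>L W \<kappa>. good n L W \<kappa>" for n :: nat
  proof -
    obtain L where L: "L \<ge> n" "\<And>S w. ball_eigen rt q L S w \<Longrightarrow>
       (\<Sum>e\<in>S \<inter> {-R<..<R}. weighted_sum rt L (weight rt) (w e)) \<le> K0" using K0 by blast
    obtain S w where be: "ball_eigen rt q L S w" using ball_eigen_exists by blast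
    have "(\<Sum>e\<in>S \<inter> {-R<..<R}. weighted_sum rt L (weight rt) (w e)) \<le> K" using L(2)[OF be] by (simp add: K_def)
    from ball_approximation[OF be R \<epsilon> this N] obtain W \<kappa> where W:
      "\<And>i x. d rt x \<le> L \<Longrightarrow> hop q (W i) x = complex_of_real (\<kappa> i) * W i x"
      "\<And>i. \<bar>\<kappa> i\<bar> \<le> R" "\<And>i x. cmod (W i x) \<le> K * decay ^ d rt x"
      "\<And>X. finite X \<Longrightarrow> (\<Sum>x\<in>X. (cmod (delta rt x - (\<Sum>i<N. W i x)))\<^sup>2) \<le> (real Dmax + (q rt)\<^sup>2) / R\<^sup>2 + K * sqrt \<epsilon>"
      by blast
    have "(real Dmax + (q rt)\<^sup>2) / R\<^sup>2 + K * sqrt \<epsilon> \<le> \<eta>\<^sup>2" using R2 Ke by linarith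
    then have "good n L W \<kappa>" unfolding good_def using L(1) W(1-3) order_trans[OF W(4)] by blast
    then show ?thesis by blast
  qed
  then obtain Ln Wn \<kappa>n where "\<And>n. good n (Ln n) (Wn n) (\<kappa>n n)" by metis
  then have seq: "\<And>n. Ln n \<ge> n"
    "\<And>n i x. d rt x \<le> Ln n \<Longrightarrow> hop q (Wn n i) x = complex_of_real (\<kappa>n n i) * Wn n i x"
    "\<And>n i. \<bar>\<kappa>n n i\<bar> \<le> R" "\<And>n i x. cmod (Wn n i x) \<le> K * decay ^ d rt x"
    "\<And>n X. finite X \<Longrightarrow> (\<Sum>x\<in>X. (cmod (delta rt x - (\<Sum>i<N. Wn n i x)))\<^sup>2) \<le> \<eta>\<^sup>2"
    unfolding good_def by auto
  \<comment> \<open>Energies (\<open>None\<close>) and values at vertices (\<open>Some x\<close>)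
    share one countable index set, so that a single subsequence serves all of them.\<close>
  define f where "f n p = (case snd p of None \<Rightarrow> complex_of_real (\<kappa>n n (fst p)) | Some x \<Rightarrow> Wn n (fst p) x)"
    for n and p :: "nat \<times> 'v option"
  have cnt: "countable (UNIV :: (nat \<times> 'v option) set)"
  proof -
    have "countable (insert None (Some ` (UNIV :: 'v set)))"
      by (intro countable_insert countable_image countable_vertices)
    then have "countable (UNIV :: 'v option set)" unfolding UNIV_option_conv .
    then have "countable ((UNIV :: nat set) \<times> (UNIV :: 'v option set))" by (intro countable_SIGMA) auto
    then show ?thesis by simp
  qed
  have bound: "norm (f n p) \<le> max R K" for n p
  proof -
    have "cmod (Wn n i x) \<le> K" for i x
      using order_trans[OF seq(4)[of n i x], of K] K decay_bounds
      by (simp add: mult_left_le power_le_one)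
    then show ?thesis using seq(3)[of n "fst p"] by (auto simp: f_def split: option.splits intro: le_max_iff_disj[THEN iffD2])
  qed
  obtain k where k: "strict_mono (k :: nat \<Rightarrow> nat)" "\<And>p. p \<in> UNIV \<Longrightarrow> \<exists>l. (\<lambda>n. f (k n) p) \<longlonglongrightarrow> l"
    by (rule function_convergent_subsequence[of UNIV f "max R K", OF cnt bound]) auto
  then have "\<exists>l. (\<lambda>n. f (k n) p) \<longlonglongrightarrow> l" for p by blast
  then obtain l where l: "\<And>p. (\<lambda>n. f (k n) p) \<longlonglongrightarrow> l p" by metis
  define \<psi> where "\<psi> i x = l (i, Some x)" for i x
  define \<kappa> where "\<kappa> i = Re (l (i, None))" for i
  have W: "(\<lambda>n. Wn (k n) i x) \<longlonglongrightarrow> \<psi> i x" for i x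
    using l[of "(i, Some x)"] by (simp add: f_def \<psi>_def)
  have \<kappa>: "(\<lambda>n. \<kappa>n (k n) i) \<longlonglongrightarrow> \<kappa> i" for i
    using tendsto_Re[OF l[of "(i, None)"]] by (simp add: f_def \<kappa>_def)
  have loc: "localized_eigenvector rt q (\<kappa> i) (\<psi> i)" for i
    unfolding localized_eigenvector_def
  proof
    show "hop q (\<psi> i) = (\<lambda>x. complex_of_real (\<kappa> i) * \<psi> i x)"
    proof
      fix x
      have "(\<lambda>n. hop q (Wn (k n) i) x) \<longlonglongrightarrow> hop q (\<psi> i) x"
        unfolding hop_def by (intro tendsto_intros W)
      moreover have "(\<lambda>n. hop q (Wn (k n) i) x) \<longlonglongrightarrow> complex_of_real (\<kappa> i) * \<psi> i x"
      proof (rule Lim_transform_eventually)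
        show "(\<lambda>n. complex_of_real (\<kappa>n (k n) i) * Wn (k n) i x) \<longlonglongrightarrow> complex_of_real (\<kappa> i) * \<psi> i x"
          by (intro tendsto_intros W \<kappa>)
        show "eventually (\<lambda>n. complex_of_real (\<kappa>n (k n) i) * Wn (k n) i x = hop q (Wn (k n) i) x) sequentially"
          unfolding eventually_sequentially
        proof (intro exI[of _ "d rt x"] allI impI)
          fix n assume "d rt x \<le> n"
          then have "d rt x \<le> Ln (k n)" using seq(1)[of "k n"] seq_suble[OF k(1), of n] by linarith
          then show "complex_of_real (\<kappa>n (k n) i) * Wn (k n) i x = hop q (Wn (k n) i) x" by (simp add: seq(2))
        qed
      qed
      ultimately show "hop q (\<psi> i) x = complex_of_real (\<kappa> i) * \<psi> i x" by (rule LIMSEQ_unique)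
    qed
    have "cmod (\<psi> i x) \<le> K * decay ^ d rt x" for x
      by (rule LIMSEQ_le_const2[OF tendsto_norm[OF W]]) (use seq(4) in auto)
    then show "\<exists>A. \<forall>x. cmod (\<psi> i x) \<le> A * decay ^ d rt x" by blast
  qed
  have "ell2_norm (\<lambda>x. delta rt x - (\<Sum>i<N. \<psi> i x)) \<le> \<eta>"
  proof (rule ell2_boundedI(2))
    fix X :: "'v set" assume X: "finite X"
    have "(\<lambda>n. \<Sum>x\<in>X. (cmod (delta rt x - (\<Sum>i<N. Wn (k n) i x)))\<^sup>2) \<longlonglongrightarrow> (\<Sum>x\<in>X. (cmod (delta rt x - (\<Sum>i<N. \<psi> i x)))\<^sup>2)"
      by (intro tendsto_intros W)
    then show "(\<Sum>x\<in>X. (cmod (delta rt x - (\<Sum>i<N. \<psi> i x)))\<^sup>2) \<le> \<eta>\<^sup>2"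
      by (rule LIMSEQ_le_const2) (use seq(5)[OF X] in auto)
  qed (use \<eta> in simp)
  then show ?thesis using loc by blast
qed

end

section \<open>Zeros of eigenfunctions\<close>

context subexponential_tree
begin

definition adj_sum :: "('v \<Rightarrow> complex) \<Rightarrow> 'v \<Rightarrow> complex" where
  "adj_sum f x = (\<Sum>y | G x y. f y)"

lemma hop_eq: "hop q f x = adj_sum f x + complex_of_real (q x) * f x"
  by (simp add: hop_def adj_sum_def)

text \<open>Schur's test: the degree bound is used once for the rows, by Cauchy-Schwarz, and once
  for the columns after exchanging the sums.\<close>

lemma adj_sum_bounded:
  assumes f: "f \<in> ell2"
  shows "adj_sum f \<in> ell2" "ell2_norm (adj_sum f) \<le> real Dmax * ell2_norm f"
proof -
  have main: "(\<Sum>x\<in>X. (cmod (adj_sum f x))\<^sup>2) \<le> (real Dmax * ell2_norm f)\<^sup>2" if X: "finite X" for X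
  proof -
    let ?Y = "\<Union>x\<in>X. {y. G x y}"
    have Y: "finite ?Y" using X finite_adj by auto
    have "(cmod (adj_sum f x))\<^sup>2 \<le> real Dmax * (\<Sum>y | G x y. (cmod (f y))\<^sup>2)" for x
    proof -
      have "(cmod (adj_sum f x))\<^sup>2 \<le> (\<Sum>y | G x y. cmod (f y))\<^sup>2"
        unfolding adj_sum_def by (intro power_mono norm_sum) auto
      also have "\<dots> \<le> real (card {y. G x y}) * (\<Sum>y | G x y. (cmod (f y))\<^sup>2)"
        using Cauchy_Schwarz_ineq_sum[of "\<lambda>_. 1" "\<lambda>y. cmod (f y)" "{y. G x y}"] by simp
      also have "\<dots> \<le> real Dmax * (\<Sum>y | G x y. (cmod (f y))\<^sup>2)"
        using card_adj[of x] by (intro mult_right_mono sum_nonneg) auto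
      finally show ?thesis .
    qed
    then have "(\<Sum>x\<in>X. (cmod (adj_sum f x))\<^sup>2) \<le> (\<Sum>x\<in>X. real Dmax * (\<Sum>y | G x y. (cmod (f y))\<^sup>2))"
      by (intro sum_mono)
    also have "\<dots> = real Dmax * (\<Sum>x\<in>X. \<Sum>y\<in>?Y. if G x y then (cmod (f y))\<^sup>2 else 0)"
      unfolding sum_distrib_left[symmetric]
      by (intro arg_cong[of _ _ "(*) _"] sum.cong refl sum.mono_neutral_cong_left) (use Y in auto)
    also have "\<dots> \<le> real Dmax * (real Dmax * (ell2_norm f)\<^sup>2)"
    proof (rule mult_left_mono)
      have "(\<Sum>x\<in>X. \<Sum>y\<in>?Y. if G x y then (cmod (f y))\<^sup>2 else 0) = (\<Sum>y\<in>?Y. \<Sum>x\<in>X. if G x y then (cmod (f y))\<^sup>2 else 0)"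
        by (rule sum.swap)
      also have "\<dots> \<le> (\<Sum>y\<in>?Y. real Dmax * (cmod (f y))\<^sup>2)"
      proof (intro sum_mono)
        fix y
        have "(\<Sum>x\<in>X. if G x y then (cmod (f y))\<^sup>2 else 0) = real (card (X \<inter> {x. G x y})) * (cmod (f y))\<^sup>2"
          using X by (simp add: sum.If_cases)
        also have "\<dots> \<le> real Dmax * (cmod (f y))\<^sup>2"
        proof (intro mult_right_mono of_nat_mono)
          have "card (X \<inter> {x. G x y}) \<le> card {x. G y x}"
            using finite_adj[of y] by (intro card_mono) (auto dest: G_sym)
          then show "card (X \<inter> {x. G x y}) \<le> Dmax" using card_adj[of y] by simp
        qed simp
        finally show "(\<Sum>x\<in>X. if G x y then (cmod (f y))\<^sup>2 else 0) \<le> real Dmax * (cmod (f y))\<^sup>2" .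
      qed
      also have "\<dots> \<le> real Dmax * (ell2_norm f)\<^sup>2"
        unfolding sum_distrib_left[symmetric] using f Y by (intro mult_left_mono ell2_sum_le_norm) auto
      finally show "(\<Sum>x\<in>X. \<Sum>y\<in>?Y. if G x y then (cmod (f y))\<^sup>2 else 0) \<le> real Dmax * (ell2_norm f)\<^sup>2" .
    qed simp
    finally show ?thesis by (simp add: power2_eq_square mult_ac)
  qed
  show "adj_sum f \<in> ell2" "ell2_norm (adj_sum f) \<le> real Dmax * ell2_norm f"
    using ell2_boundedI[of "adj_sum f" "real Dmax * ell2_norm f"] main by auto
qed

lemma adj_sum_diff: "adj_sum (\<lambda>x. f x - g x) = (\<lambda>x. adj_sum f x - adj_sum g x)"
  by (simp add: adj_sum_def sum_subtractf fun_eq_iff)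

lemma adj_sum_symmetric:
  assumes f: "f \<in> ell2" and g: "g \<in> ell2"
  shows "ell2_inner f (adj_sum g) = ell2_inner (adj_sum f) g"
proof -
  have fin: "ell2_inner h (adj_sum g) = ell2_inner (adj_sum h) g" if X: "finite X" "\<And>x. x \<notin> X \<Longrightarrow> h x = 0" for h X
  proof -
    let ?Y = "\<Union>x\<in>X. {y. G x y}"
    have Y: "finite ?Y" using X finite_adj by auto
    have "adj_sum h y = 0" if "y \<notin> ?Y" for y
      unfolding adj_sum_def using that X(2) G_sym by (intro sum.neutral) blast
    then have "ell2_inner (adj_sum h) g = (\<Sum>y\<in>?Y. cnj (adj_sum h y) * g y)"
      by (rule ell2_inner_finite_left[OF Y])
    also have "\<dots> = (\<Sum>y\<in>?Y. \<Sum>x\<in>X. if G x y then cnj (h x) * g y else 0)"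
    proof (intro sum.cong refl)
      fix y
      have "cnj (adj_sum h y) * g y = (\<Sum>x | G y x. cnj (h x) * g y)"
        by (simp add: adj_sum_def sum_distrib_right)
      also have "\<dots> = (\<Sum>x\<in>X \<inter> {x. G x y}. cnj (h x) * g y)"
        using X finite_adj[of y] by (intro sum.mono_neutral_right) (auto dest: G_sym)
      also have "\<dots> = (\<Sum>x\<in>X. if G x y then cnj (h x) * g y else 0)"
        using X(1) by (simp add: sum.If_cases)
      finally show "cnj (adj_sum h y) * g y = (\<Sum>x\<in>X. if G x y then cnj (h x) * g y else 0)" .
    qed
    also have "\<dots> = (\<Sum>x\<in>X. \<Sum>y\<in>?Y. if G x y then cnj (h x) * g y else 0)" by (rule sum.swap)
    also have "\<dots> = (\<Sum>x\<in>X. cnj (h x) * adj_sum g x)"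
      unfolding adj_sum_def sum_distrib_left
      by (intro sum.cong refl sum.mono_neutral_cong_right) (use Y in auto)
    also have "\<dots> = ell2_inner h (adj_sum g)" by (rule ell2_inner_finite_left[OF X, symmetric])
    finally show ?thesis ..
  qed
  have "ell2_inner f (adj_sum g) - ell2_inner (adj_sum f) g = 0"
  proof (rule eq_0_if_le_epsilon)
    fix \<epsilon> :: real assume "\<epsilon> > 0"
    from ell2_truncate[OF f this] obtain X where X: "finite X"
      "ell2_norm (\<lambda>x. f x - (if x \<in> X then f x else 0)) \<le> \<epsilon>" by blast
    let ?h = "\<lambda>x. if x \<in> X then f x else 0"
    define k where "k = (\<lambda>x. f x - ?h x)"
    have h: "?h \<in> ell2" and k: "k \<in> ell2" using f by (auto simp: k_def intro!: ell2_restrict ell2_diff)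
    have "ell2_inner ?h (adj_sum g) = ell2_inner (adj_sum ?h) g" using X by (intro fin) auto
    moreover have "ell2_inner k (adj_sum g) = ell2_inner f (adj_sum g) - ell2_inner ?h (adj_sum g)"
      unfolding k_def using f h adj_sum_bounded[OF g] by (intro ell2_inner_diff_left) auto
    moreover have "ell2_inner (adj_sum k) g = ell2_inner (adj_sum f) g - ell2_inner (adj_sum ?h) g"
      unfolding k_def adj_sum_diff using g adj_sum_bounded[OF f] adj_sum_bounded[OF h] by (intro ell2_inner_diff_left) auto
    ultimately have "cmod (ell2_inner f (adj_sum g) - ell2_inner (adj_sum f) g) = cmod (ell2_inner k (adj_sum g) - ell2_inner (adj_sum k) g)"
      by simp
    also have "\<dots> \<le> cmod (ell2_inner k (adj_sum g)) + cmod (ell2_inner (adj_sum k) g)"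
      by (rule norm_triangle_ineq4)
    also have "\<dots> \<le> ell2_norm k * ell2_norm (adj_sum g) + ell2_norm (adj_sum k) * ell2_norm g"
      using k g adj_sum_bounded[OF k] adj_sum_bounded[OF g] by (intro add_mono ell2_Cauchy_Schwarz) auto
    also have "\<dots> \<le> ell2_norm k * (real Dmax * ell2_norm g) + real Dmax * ell2_norm k * ell2_norm g"
      using adj_sum_bounded(2)[OF k] adj_sum_bounded(2)[OF g] by (intro add_mono mult_left_mono mult_right_mono) auto
    also have "\<dots> = ell2_norm k * (2 * real Dmax * ell2_norm g)" by simp
    also have "\<dots> \<le> \<epsilon> * (2 * real Dmax * ell2_norm g)"
      using X(2) by (intro mult_right_mono) (auto simp: k_def)
    finally show "cmod (ell2_inner f (adj_sum g) - ell2_inner (adj_sum f) g) \<le> \<epsilon> * (2 * real Dmax * ell2_norm g)" .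
  qed
  then show ?thesis by simp
qed

definition eigen :: "('v \<Rightarrow> real) \<Rightarrow> real \<Rightarrow> ('v \<Rightarrow> complex) \<Rightarrow> bool" where
  "eigen q e f \<longleftrightarrow> f \<in> ell2 \<and> hop q f = (\<lambda>x. complex_of_real e * f x)"

lemma eigen_adj_sum: "eigen q e f \<Longrightarrow> adj_sum f x = complex_of_real (e - q x) * f x"
  unfolding eigen_def hop_eq by (auto simp: fun_eq_iff algebra_simps)

text \<open>Symmetry of the adjacency operator, applied to two eigenfunctions restricted to a set whose
  only exit is a common zero.\<close>

lemma eigen_cut_identity:
  assumes f: "eigen q e f" "f x = 0" and f': "eigen q' e' f'" "f' x = 0"
    and T: "\<And>a b. a \<in> T \<Longrightarrow> G a b \<Longrightarrow> b \<notin> T \<Longrightarrow> b = x"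
  shows "(\<Sum>\<^sub>\<infinity>a. cnj (if a \<in> T then f' a else 0) * (if a \<in> T then complex_of_real ((e - q a) - (e' - q' a)) * f a else 0)) = 0"
proof -
  let ?g = "\<lambda>a. if a \<in> T then f a else 0" and ?g' = "\<lambda>a. if a \<in> T then f' a else 0"
  have ell: "f \<in> ell2" "f' \<in> ell2" using f f' by (auto simp: eigen_def)
  have g: "?g \<in> ell2" "?g' \<in> ell2" using ell by (auto intro: ell2_restrict)
  have restrict: "adj_sum (\<lambda>a. if a \<in> T then h a else 0) a = adj_sum h a" if "h x = 0" "a \<in> T" for h a
    unfolding adj_sum_def using that T by (intro sum.cong) auto
  have 1: "cnj (?g' a) * adj_sum ?g a = cnj (?g' a) * (complex_of_real (e - q a) * ?g a)" for a
    using restrict[where h = f, OF f(2)] eigen_adj_sum[OF f(1)] by simp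
  have 2: "cnj (adj_sum ?g' a) * ?g a = cnj (?g' a) * (complex_of_real (e' - q' a) * ?g a)" for a
    using restrict[where h = f', OF f'(2)] eigen_adj_sum[OF f'(1)] by simp
  have s1: "(\<lambda>a. cnj (?g' a) * adj_sum ?g a) summable_on UNIV"
    and s2: "(\<lambda>a. cnj (adj_sum ?g' a) * ?g a) summable_on UNIV"
    using g adj_sum_bounded(1)[OF g(1)] adj_sum_bounded(1)[OF g(2)] by (auto intro!: ell2_inner_summable)
  have "(\<Sum>\<^sub>\<infinity>a. cnj (?g' a) * (if a \<in> T then complex_of_real ((e - q a) - (e' - q' a)) * f a else 0))
     = (\<Sum>\<^sub>\<infinity>a. cnj (?g' a) * adj_sum ?g a + - (cnj (adj_sum ?g' a) * ?g a))"
    by (intro infsum_cong) (simp only: 1 2, simp add: algebra_simps)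
  also have "\<dots> = ell2_inner ?g' (adj_sum ?g) - ell2_inner (adj_sum ?g') ?g"
    unfolding ell2_inner_def using s1 s2 by (subst infsum_add) (auto simp: infsum_uminus summable_on_uminus)
  also have "\<dots> = 0" using adj_sum_symmetric[OF g(2,1)] by simp
  finally show ?thesis .
qed

text \<open>By Bessel for \<open>delta z\<close>, only countably many of the functions are nonzero
  at \<open>z\<close>, and there are countably many vertices. This is the separability of the
  space.\<close>

lemma countable_orthogonal_index:
  fixes h :: "'i \<Rightarrow> 'v \<Rightarrow> complex"
  assumes h: "\<And>t. t \<in> Z \<Longrightarrow> h t \<in> ell2" "\<And>t. t \<in> Z \<Longrightarrow> h t \<noteq> (\<lambda>x. 0)"
    and orth: "\<And>t t'. t \<in> Z \<Longrightarrow> t' \<in> Z \<Longrightarrow> t \<noteq> t' \<Longrightarrow> ell2_inner (h t) (h t') = 0"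
  shows "countable Z"
proof -
  define \<phi> where "\<phi> t = (if t \<in> Z then (\<lambda>x. complex_of_real (1 / ell2_norm (h t)) * h t x) else (\<lambda>x. 0))" for t
  have norm: "ell2_norm (h t) \<noteq> 0" if "t \<in> Z" for t
  proof
    assume "ell2_norm (h t) = 0"
    then have "h t = (\<lambda>x. 0)" using h(1)[OF that] by (intro ext ell2_norm_eq_0)
    then show False using h(2)[OF that] by simp
  qed
  interpret orthonormal_family \<phi> Z
  proof
    show "\<phi> e \<in> ell2" for e
      using h(1)[of e] unfolding \<phi>_def by (cases "e \<in> Z") (simp_all only: if_True if_False ell2_scale ell2_zero)
    show "ell2_inner (\<phi> e) (\<phi> e') = (if e = e' then 1 else 0)" if e: "e \<in> Z" "e' \<in> Z" for e e'
    proof -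
      have "ell2_inner (\<phi> e) (\<phi> e') = cnj (complex_of_real (1 / ell2_norm (h e))) * (complex_of_real (1 / ell2_norm (h e')) * ell2_inner (h e) (h e'))"
        unfolding \<phi>_def using e by (simp only: if_True ell2_inner_scale_left ell2_inner_scale_right mult.left_commute)
      then show ?thesis
        using orth[OF e] norm[OF e(1)] h(1)[OF e(1)] by (auto simp: ell2_inner_self power2_eq_square)
    qed
  qed (auto simp: \<phi>_def)
  have "countable {t. cmod (coef (delta z) t) ^ 2 \<noteq> 0}" for z
    using coef_ell2[OF ell2_delta[of z]] summable_countable_real[of "\<lambda>t. cmod (coef (delta z) t) ^ 2" UNIV]
    by (simp add: ell2_def)
  then have "countable (\<Union>z\<in>UNIV. {t. cmod (coef (delta z) t) ^ 2 \<noteq> 0})"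
    by (intro countable_UN countable_vertices)
  moreover have "Z \<subseteq> (\<Union>z\<in>UNIV. {t. cmod (coef (delta z) t) ^ 2 \<noteq> 0})"
  proof
    fix t assume t: "t \<in> Z"
    then obtain z where "h t z \<noteq> 0" using h(2) by blast
    then show "t \<in> (\<Union>z\<in>UNIV. {t. cmod (coef (delta z) t) ^ 2 \<noteq> 0})"
      using t norm[OF t] by (auto simp: coef_delta \<phi>_def intro!: exI[of _ z])
  qed
  ultimately show ?thesis by (rule countable_subset[rotated])
qed

text \<open>For adjacent \<open>x\<close> and \<open>y\<close>, the component of \<open>y\<close>
  after removal of \<open>x\<close>.\<close>

definition branch :: "'v \<Rightarrow> 'v \<Rightarrow> 'v set" where
  "branch x y = {w. \<exists>i. (par x ^^ i) w = y \<and> d x w = Suc i}"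

lemma branch_exit:
  assumes y: "G x y" and a: "a \<in> branch x y" "G a b" "b \<notin> branch x y"
  shows "a = y \<and> b = x"
proof -
  obtain i where i: "(par x ^^ i) a = y" "d x a = Suc i" using a by (auto simp: branch_def)
  have ax: "a \<noteq> x" using i by auto
  have "b \<notin> children x a"
  proof
    assume b: "b \<in> children x a"
    then have "(par x ^^ Suc i) b = y" "d x b = Suc (Suc i)" using i by (auto simp: children_iff gdist_children funpow_swap1)
    then show False using a(3) unfolding branch_def by blast
  qed
  then have b: "b = par x a" using adjacent_iff[of a b x] a(2) by auto
  show ?thesis
  proof (cases i)
    case 0
    then have "a = y" "d x a = 1" using i by auto
    moreover have "d x b = 0" using par(2)[OF ax] b i 0 by simp
    ultimately show ?thesis by simp
  next
    case (Suc j)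
    then have "(par x ^^ j) b = y" "d x b = Suc j" using i b par(2)[OF ax] by (auto simp: funpow_swap1)
    then show ?thesis using a(3) unfolding branch_def by blast
  qed
qed

lemma branch_self: "G x y \<Longrightarrow> y \<in> branch x y"
  by (auto simp: branch_def intro!: exI[of _ 0])

lemma neighbor_notin_branch:
  assumes "G x y" "G x y'" "y \<noteq> y'" shows "y' \<notin> branch x y"
proof
  have d: "d x y' = Suc 0" using assms(2) by simp
  assume "y' \<in> branch x y"
  then obtain i where i: "(par x ^^ i) y' = y" "d x y' = Suc i" unfolding branch_def by blast
  have "i = 0" using i(2) d by linarith
  then show False using i(1) assms(3) by simp
qed

text \<open>An eigenfunction vanishing at \<open>x\<close> splits into eigenfunctions on the branch through \<open>y\<close> and on
  its complement.  On the branch, two values of \<open>q y\<close> cannot give the same eigenvalue; on the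
  complement the potential does not depend on \<open>q y\<close>, so distinct values give orthogonal functions.\<close>

lemma countable_zero_section:
  assumes xy: "G x y"
  shows "countable {t. \<exists>e f. eigen (q(y := t)) e f \<and> f x = 0 \<and> f y \<noteq> 0}" (is "countable ?Z")
proof -
  let ?T = "branch x y"
  have "\<forall>t\<in>?Z. \<exists>ef. eigen (q(y := t)) (fst ef) (snd ef) \<and> snd ef x = 0 \<and> snd ef y \<noteq> 0" by auto
  from bchoice[OF this] obtain ef where ef: "\<forall>t\<in>?Z. eigen (q(y := t)) (fst (ef t)) (snd (ef t)) \<and> snd (ef t) x = 0 \<and> snd (ef t) y \<noteq> 0"
    by (rule exE)
  define e where "e t = fst (ef t)" for t
  define f where "f t = snd (ef t)" for t
  have f: "eigen (q(y := t)) (e t) (f t)" "f t x = 0" "f t y \<noteq> 0" if "t \<in> ?Z" for t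
    using bspec[OF ef that] by (auto simp: e_def f_def)
  have exit: "b = x" if "a \<in> ?T" "G a b" "b \<notin> ?T" for a b using branch_exit[OF xy that] by simp
  have exit': "b = x" if "a \<in> - (insert x ?T)" "G a b" "b \<notin> - (insert x ?T)" for a b
    using that branch_exit[OF xy, of b a] G_sym[of a b] by auto
  have inj: "t = t'" if t: "t \<in> ?Z" "t' \<in> ?Z" "e t = e t'" for t t'
  proof (rule ccontr)
    assume ne: "t \<noteq> t'"
    let ?s = "\<lambda>a. cnj (if a \<in> ?T then f t' a else 0) * (if a \<in> ?T then complex_of_real ((e t - (q(y := t)) a) - (e t' - (q(y := t')) a)) * f t a else 0)"
    have "(\<Sum>\<^sub>\<infinity>a. ?s a) = (\<Sum>\<^sub>\<infinity>a\<in>{y}. ?s a)"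
      using t(3) by (intro infsum_cong_neutral) auto
    then have "?s y = 0"
      using eigen_cut_identity[OF f(1,2)[OF t(1)] f(1,2)[OF t(2)] exit] by simp
    then show False using f(3)[OF t(1)] f(3)[OF t(2)] ne t(3) branch_self[OF xy] by (simp flip: of_real_diff)
  qed
  define h where "h t a = (if a \<in> - (insert x ?T) then f t a else 0)" for t a
  show ?thesis
  proof (rule countable_orthogonal_index)
    show "h t \<in> ell2" if "t \<in> ?Z" for t
      using f(1)[OF that] unfolding h_def eigen_def by (intro ell2_restrict) simp
    show "h t \<noteq> (\<lambda>x. 0)" if "t \<in> ?Z" for t
    proof
      assume z: "h t = (\<lambda>x. 0)"
      have "adj_sum (f t) x = 0" using eigen_adj_sum[OF f(1)[OF that], of x] f(2)[OF that] by simp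
      moreover have "adj_sum (f t) x = f t y"
      proof -
        have "f t b = 0" if b: "G x b" "b \<noteq> y" for b
          using fun_cong[OF z, of b] neighbor_notin_branch[OF xy b(1)] b by (auto simp: h_def split: if_splits)
        then have "adj_sum (f t) x = (\<Sum>b\<in>{y}. f t b)"
          unfolding adj_sum_def using xy finite_adj[of x] by (intro sum.mono_neutral_right) auto
        then show ?thesis by simp
      qed
      ultimately show False using f(3)[OF that] by simp
    qed
    show "ell2_inner (h t) (h t') = 0" if t: "t \<in> ?Z" "t' \<in> ?Z" "t \<noteq> t'" for t t'
    proof -
      have ne: "e t \<noteq> e t'" using inj t by blast
      let ?C = "- (insert x ?T)"
      have "0 = (\<Sum>\<^sub>\<infinity>a. cnj (if a \<in> ?C then f t a else 0) * (if a \<in> ?C then complex_of_real ((e t' - (q(y := t')) a) - (e t - (q(y := t)) a)) * f t' a else 0))"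
        by (rule eigen_cut_identity[where T = ?C, OF f(1,2)[OF t(2)] f(1,2)[OF t(1)] exit', symmetric])
      also have "\<dots> = (\<Sum>\<^sub>\<infinity>a. complex_of_real (e t' - e t) * (cnj (h t a) * h t' a))"
        using branch_self[OF xy] by (intro infsum_cong) (auto simp: h_def)
      also have "\<dots> = complex_of_real (e t' - e t) * ell2_inner (h t) (h t')"
        unfolding ell2_inner_def by (rule infsum_cmult_right')
      finally show ?thesis using ne by simp
    qed
  qed
qed

end

context anderson_tree
begin

section \<open>Measurable events for zeros of eigenfunctions\<close>

definition rational_trials :: "'v \<Rightarrow> nat \<Rightarrow> (real \<times> ('v \<Rightarrow> real)) set" where
  "rational_trials x m = \<rat> \<times> PiE (ball x (Suc m)) (\<lambda>_. \<rat>)"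

definition residual :: "('v \<Rightarrow> real) \<Rightarrow> real \<Rightarrow> ('v \<Rightarrow> real) \<Rightarrow> 'v \<Rightarrow> real" where
  "residual q e f z = (\<Sum>y | G z y. f y) + q z * f z - e * f z"

text \<open>Restricting to rational trial vectors makes the event measurable, and a limit of trial vectors is
  an eigenfunction vanishing at \<open>x\<close> but not at \<open>y\<close>.\<close>

definition zero_event :: "'v \<Rightarrow> 'v \<Rightarrow> nat \<Rightarrow> ('v \<Rightarrow> real) set" where
  "zero_event x y K = {v. \<forall>m. \<exists>(e, f)\<in>rational_trials x m.
     \<bar>e\<bar> \<le> real K + 1 \<and> (\<Sum>z\<in>ball x (Suc m). (f z)\<^sup>2) \<le> (real K + 1)\<^sup>2 \<and> \<bar>f x\<bar> < 1 / real (Suc m) \<and>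
     \<bar>f y - 1\<bar> < 1 / real (Suc m) \<and> (\<forall>z\<in>ball x m. \<bar>residual (pot v) e f z\<bar> < 1 / real (Suc m))}"

lemma countable_rational_trials: "countable (rational_trials x m)"
  unfolding rational_trials_def
  by (intro countable_SIGMA countable_PiE finite_ball countable_rat)

lemma zero_event_measurable: "zero_event x y K \<in> sets P"
proof -
  have "zero_event x y K = (\<Inter>m. \<Union>p\<in>rational_trials x m.
     {v \<in> space P. \<bar>fst p\<bar> \<le> real K + 1 \<and> (\<Sum>z\<in>ball x (Suc m). (snd p z)\<^sup>2) \<le> (real K + 1)\<^sup>2 \<and> \<bar>snd p x\<bar> < 1 / real (Suc m) \<and>
     \<bar>snd p y - 1\<bar> < 1 / real (Suc m) \<and> (\<forall>z\<in>ball x m. \<bar>residual (pot v) (fst p) (snd p) z\<bar> < 1 / real (Suc m))})"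
    by (auto simp: zero_event_def case_prod_beta)
  also have "\<dots> \<in> sets P"
  proof (intro sets.countable_INT sets.countable_UN' countable_rational_trials image_subsetI)
    fix m p
    have [measurable]: "(\<lambda>v. residual (pot v) e f z) \<in> borel_measurable P" for e f z
      unfolding residual_def by measurable
    have "finite (ball x m)" by (rule finite_ball)
    then show "{v \<in> space P. \<bar>fst p\<bar> \<le> real K + 1 \<and> (\<Sum>z\<in>ball x (Suc m). (snd p z)\<^sup>2) \<le> (real K + 1)\<^sup>2 \<and> \<bar>snd p x\<bar> < 1 / real (Suc m) \<and>
      \<bar>snd p y - 1\<bar> < 1 / real (Suc m) \<and> (\<forall>z\<in>ball x m. \<bar>residual (pot v) (fst p) (snd p) z\<bar> < 1 / real (Suc m))} \<in> sets P"
      by measurable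
  qed auto
  finally show ?thesis .
qed

lemma hop_of_real: "hop q (\<lambda>x. complex_of_real (f x)) z = complex_of_real ((\<Sum>y | G z y. f y) + q z * f z)"
  by (simp add: hop_def)

text \<open>Compactness: bounded trials converge at every vertex along a subsequence, the norm bound
  passes to the limit through finite sums, and the residuals vanish. The value at \<open>y\<close>
  tends to 1, so the limit is not zero.\<close>

lemma zero_event_sound:
  assumes "v \<in> zero_event x y K"
  shows "\<exists>e f. eigen (pot v) e f \<and> f x = 0 \<and> f y \<noteq> 0"
proof -
  have "\<exists>p. \<bar>fst p\<bar> \<le> real K + 1 \<and> (\<Sum>z\<in>ball x (Suc m). (snd p z)\<^sup>2) \<le> (real K + 1)\<^sup>2 \<and> \<bar>snd p x\<bar> < 1 / real (Suc m) \<and>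
     \<bar>snd p y - 1\<bar> < 1 / real (Suc m) \<and> (\<forall>z\<in>ball x m. \<bar>residual (pot v) (fst p) (snd p) z\<bar> < 1 / real (Suc m))" for m
    using assms by (fastforce simp: zero_event_def case_prod_beta)
  then obtain p where p: "\<And>m. \<bar>fst (p m)\<bar> \<le> real K + 1" "\<And>m. (\<Sum>z\<in>ball x (Suc m). (snd (p m) z)\<^sup>2) \<le> (real K + 1)\<^sup>2"
    "\<And>m. \<bar>snd (p m) x\<bar> < 1 / real (Suc m)" "\<And>m. \<bar>snd (p m) y - 1\<bar> < 1 / real (Suc m)"
    "\<And>m z. z \<in> ball x m \<Longrightarrow> \<bar>residual (pot v) (fst (p m)) (snd (p m)) z\<bar> < 1 / real (Suc m)"
    by metis
  define g where "g m i = (case i of None \<Rightarrow> fst (p m) | Some z \<Rightarrow> if d x z \<le> Suc m then snd (p m) z else 0)"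
    for m and i :: "'v option"
  have "countable (insert None (Some ` (UNIV :: 'v set)))"
    by (intro countable_insert countable_image countable_vertices)
  then have cnt: "countable (UNIV :: 'v option set)" unfolding UNIV_option_conv .
  have bound: "norm (g m i) \<le> real K + 1" for m i
  proof (cases i)
    case None then show ?thesis using p(1)[of m] by (simp add: g_def)
  next
    case (Some z)
    have "\<bar>snd (p m) z\<bar> \<le> real K + 1" if "d x z \<le> Suc m"
    proof -
      have "(snd (p m) z)\<^sup>2 \<le> (\<Sum>z\<in>ball x (Suc m). (snd (p m) z)\<^sup>2)"
        using that finite_ball by (intro member_le_sum) auto
      then have "\<bar>snd (p m) z\<bar>\<^sup>2 \<le> (real K + 1)\<^sup>2" using p(2)[of m] by simp
      then show ?thesis by (rule power2_le_imp_le) simp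
    qed
    then show ?thesis using Some by (simp add: g_def)
  qed
  obtain k where k: "strict_mono (k :: nat \<Rightarrow> nat)" "\<And>i. i \<in> UNIV \<Longrightarrow> \<exists>l. (\<lambda>n. g (k n) i) \<longlonglongrightarrow> l"
    by (rule function_convergent_subsequence[of UNIV g "real K + 1", OF cnt bound]) auto
  then have "\<exists>l. (\<lambda>n. g (k n) i) \<longlonglongrightarrow> l" for i by blast
  then obtain l where l: "\<And>i. (\<lambda>n. g (k n) i) \<longlonglongrightarrow> l i" by metis
  define e where "e = l None"
  define f where "f z = l (Some z)" for z
  have ke: "k n \<ge> n" for n using seq_suble[OF k(1)] .
  have e_lim: "(\<lambda>n. fst (p (k n))) \<longlonglongrightarrow> e" using l[of None] by (simp add: g_def e_def)
  have f_lim: "(\<lambda>n. snd (p (k n)) z) \<longlonglongrightarrow> f z" for z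
  proof (rule Lim_transform_eventually[OF l[of "Some z", folded f_def]])
    show "eventually (\<lambda>n. g (k n) (Some z) = snd (p (k n)) z) sequentially"
      unfolding eventually_sequentially
    proof (intro exI[of _ "d x z"] allI impI)
      fix n assume "d x z \<le> n"
      then show "g (k n) (Some z) = snd (p (k n)) z" using ke[of n] by (simp add: g_def)
    qed
  qed
  have inv: "(\<lambda>n. 1 / real (Suc (k n))) \<longlonglongrightarrow> 0"
  proof (rule Lim_null_comparison[OF _ LIMSEQ_inverse_real_of_nat])
    show "eventually (\<lambda>n. norm (1 / real (Suc (k n))) \<le> inverse (real (Suc n))) sequentially"
      using ke by (intro always_eventually allI) (simp add: inverse_eq_divide frac_le)
  qed
  have fx: "f x = 0"
  proof (rule LIMSEQ_unique[OF f_lim])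
    show "(\<lambda>n. snd (p (k n)) x) \<longlonglongrightarrow> 0"
      by (rule Lim_null_comparison[OF _ inv]) (use p(3) in \<open>auto intro!: always_eventually less_imp_le\<close>)
  qed
  have fy: "f y = 1"
  proof -
    have "(\<lambda>n. snd (p (k n)) y - 1) \<longlonglongrightarrow> 0"
      by (rule Lim_null_comparison[OF _ inv]) (use p(4) in \<open>auto intro!: always_eventually less_imp_le\<close>)
    then have "(\<lambda>n. snd (p (k n)) y) \<longlonglongrightarrow> 1" by (rule LIM_zero_cancel)
    then show ?thesis using f_lim LIMSEQ_unique by blast
  qed
  have res: "residual (pot v) e f z = 0" for z
  proof (rule LIMSEQ_unique)
    show "(\<lambda>n. residual (pot v) (fst (p (k n))) (snd (p (k n))) z) \<longlonglongrightarrow> residual (pot v) e f z"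
      unfolding residual_def by (intro tendsto_intros f_lim e_lim)
    show "(\<lambda>n. residual (pot v) (fst (p (k n))) (snd (p (k n))) z) \<longlonglongrightarrow> 0"
    proof (rule Lim_null_comparison[OF _ inv])
      show "eventually (\<lambda>n. norm (residual (pot v) (fst (p (k n))) (snd (p (k n))) z) \<le> 1 / real (Suc (k n))) sequentially"
        unfolding eventually_sequentially
      proof (intro exI[of _ "d x z"] allI impI)
        fix n assume "d x z \<le> n"
        then have "z \<in> ball x (k n)" using ke[of n] by simp
        from p(5)[OF this] show "norm (residual (pot v) (fst (p (k n))) (snd (p (k n))) z) \<le> 1 / real (Suc (k n))" by simp
      qed
    qed
  qed
  let ?F = "\<lambda>z. complex_of_real (f z)"
  have "?F \<in> ell2"
  proof (rule ell2_boundedI(1)[of _ "real K + 1"])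
    fix X :: "'v set" assume X: "finite X"
    have "(\<lambda>n. \<Sum>z\<in>X. (g (k n) (Some z))\<^sup>2) \<longlonglongrightarrow> (\<Sum>z\<in>X. (f z)\<^sup>2)"
      unfolding f_def by (intro tendsto_intros l)
    moreover have "(\<Sum>z\<in>X. (g (k n) (Some z))\<^sup>2) \<le> (real K + 1)\<^sup>2" for n
    proof -
      have "(\<Sum>z\<in>X. (g (k n) (Some z))\<^sup>2) \<le> (\<Sum>z\<in>X \<union> ball x (Suc (k n)). (g (k n) (Some z))\<^sup>2)"
        using X finite_ball by (intro sum_mono2) auto
      also have "\<dots> = (\<Sum>z\<in>ball x (Suc (k n)). (snd (p (k n)) z)\<^sup>2)"
        using X finite_ball by (intro sum.mono_neutral_cong_right) (auto simp: g_def)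
      finally show ?thesis using p(2)[of "k n"] by simp
    qed
    ultimately have "(\<Sum>z\<in>X. (f z)\<^sup>2) \<le> (real K + 1)\<^sup>2" by (intro LIMSEQ_le_const2) auto
    then show "(\<Sum>z\<in>X. (cmod (?F z))\<^sup>2) \<le> (real K + 1)\<^sup>2" by simp
  qed simp
  moreover have "hop (pot v) ?F = (\<lambda>z. complex_of_real e * ?F z)"
  proof
    fix z show "hop (pot v) ?F z = complex_of_real e * ?F z"
      using res[of z] unfolding hop_of_real residual_def by (simp flip: of_real_mult)
  qed
  ultimately have "eigen (pot v) e ?F" by (simp add: eigen_def)
  then show ?thesis using fx fy by (intro exI[of _ e] exI[of _ ?F]) auto
qed

text \<open>After scaling to the value 1 at \<open>y\<close>, the real part still solves the
  equation since energy and potential are real. \<open>K\<close> bounds energy and norm; the slack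
  up to \<open>K + 1\<close> leaves room for rational approximation.\<close>

lemma zero_event_complete:
  assumes xy: "G x y" and f: "eigen (pot v) e f" "f x = 0" "f y \<noteq> 0"
  shows "\<exists>K. v \<in> zero_event x y K"
proof -
  define g where "g = (\<lambda>z. f z / f y)"
  have g: "eigen (pot v) e g"
  proof -
    have "g = (\<lambda>z. (1 / f y) * f z)" by (simp add: g_def)
    moreover have "hop (pot v) (\<lambda>z. (1 / f y) * f z) = (\<lambda>z. (1 / f y) * hop (pot v) f z)"
      unfolding hop_def distrib_left sum_distrib_left by (simp add: mult_ac)
    moreover have "(\<lambda>z. (1 / f y) * f z) \<in> ell2" using f(1) by (intro ell2_scale) (simp add: eigen_def)
    ultimately show ?thesis using f(1) by (auto simp: eigen_def)
  qed
  define h where "h z = Re (g z)" for z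
  have hx: "h x = 0" and hy: "h y = 1" using f by (auto simp: h_def g_def)
  have res: "residual (pot v) e h z = 0" for z
  proof -
    have "Re (hop (pot v) g z) = Re (complex_of_real e * g z)" using g by (simp add: eigen_def)
    then show ?thesis by (simp add: residual_def hop_def h_def)
  qed
  obtain K where K: "max \<bar>e\<bar> (ell2_norm g) \<le> real K" using real_arch_simple by blast
  have "v \<in> zero_event x y K"
    unfolding zero_event_def
  proof (rule CollectI, rule allI)
    fix m
    let ?B = "ball x (Suc m)"
    have B: "finite ?B" by (rule finite_ball)
    have "\<exists>r\<in>\<rat>. \<bar>r - a\<bar> < 1 / real (Suc n)" for a :: real and n
    proof -
      obtain r where "r \<in> \<rat>" "a < r" "r < a + 1 / real (Suc n)" using Rats_dense_in_real[of a "a + 1 / real (Suc n)"] by auto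
      then show ?thesis by (intro bexI[of _ r]) auto
    qed
    then obtain rat where rat: "\<And>a n. rat a n \<in> \<rat>" "\<And>a n. \<bar>rat a n - a\<bar> < 1 / real (Suc n)" by metis
    have lim: "(\<lambda>n. rat a n) \<longlonglongrightarrow> a" for a
    proof -
      have "(\<lambda>n. rat a n - a) \<longlonglongrightarrow> 0"
        by (rule Lim_null_comparison[OF _ LIMSEQ_inverse_real_of_nat])
          (use rat(2) in \<open>auto intro!: always_eventually less_imp_le simp: inverse_eq_divide\<close>)
      then show ?thesis by (rule LIM_zero_cancel)
    qed
    define F where "F n = restrict (\<lambda>z. rat (h z) n) ?B" for n
    have F_lim: "(\<lambda>n. F n z) \<longlonglongrightarrow> h z" if "z \<in> ?B" for z using lim[of "h z"] that by (simp add: F_def)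
    have pos: "1 / real (Suc m) > 0" by simp
    have sq: "(\<Sum>z\<in>?B. (h z)\<^sup>2) \<le> (real K)\<^sup>2"
    proof -
      have "(\<Sum>z\<in>?B. (h z)\<^sup>2) \<le> (\<Sum>z\<in>?B. (cmod (g z))\<^sup>2)"
        by (intro sum_mono) (simp add: h_def cmod_power2)
      also have "\<dots> \<le> (ell2_norm g)\<^sup>2" using g B by (intro ell2_sum_le_norm) (simp_all add: eigen_def)
      also have "\<dots> \<le> (real K)\<^sup>2" using K by (intro power_mono) auto
      finally show ?thesis .
    qed
    have 1: "eventually (\<lambda>n. \<bar>rat e n\<bar> < real K + 1) sequentially"
      using K by (intro order_tendstoD(2)[OF tendsto_rabs[OF lim]]) auto
    have 2: "eventually (\<lambda>n. (\<Sum>z\<in>?B. (F n z)\<^sup>2) < (real K + 1)\<^sup>2) sequentially"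
    proof (rule order_tendstoD(2))
      show "(\<lambda>n. \<Sum>z\<in>?B. (F n z)\<^sup>2) \<longlonglongrightarrow> (\<Sum>z\<in>?B. (h z)\<^sup>2)" by (intro tendsto_intros F_lim)
      show "(\<Sum>z\<in>?B. (h z)\<^sup>2) < (real K + 1)\<^sup>2" using sq by (simp add: power2_eq_square algebra_simps)
    qed
    have 3: "eventually (\<lambda>n. \<bar>F n x\<bar> < 1 / real (Suc m)) sequentially"
      using F_lim[of x] hx pos by (intro order_tendstoD(2)[OF tendsto_rabs]) auto
    have 4: "eventually (\<lambda>n. \<bar>F n y - 1\<bar> < 1 / real (Suc m)) sequentially" if "y \<in> ?B"
      using tendsto_diff[OF F_lim[OF that] tendsto_const[of 1]] hy pos
      by (intro order_tendstoD(2)[OF tendsto_rabs]) auto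
    have 5: "eventually (\<lambda>n. \<forall>z\<in>ball x m. \<bar>residual (pot v) (rat e n) (F n) z\<bar> < 1 / real (Suc m)) sequentially"
    proof (intro eventually_ball_finite finite_ball ballI)
      fix z assume z: "z \<in> ball x m"
      \<comment> \<open>Residuals in the ball of radius \<open>m\<close> involve values at distance
        \<open>m + 1\<close>, which is why trials live on the ball of radius
        \<open>Suc m\<close>.\<close>
      have nb: "y \<in> ?B" if "G z y" for y using gdist_adj[OF that, of x] z by auto
      have "(\<lambda>n. residual (pot v) (rat e n) (F n) z) \<longlonglongrightarrow> residual (pot v) e h z"
        unfolding residual_def by (intro tendsto_intros F_lim lim) (use nb z in auto)
      then have "(\<lambda>n. \<bar>residual (pot v) (rat e n) (F n) z\<bar>) \<longlonglongrightarrow> 0"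
        using res[of z] by (intro tendsto_rabs_zero) simp
      then show "eventually (\<lambda>n. \<bar>residual (pot v) (rat e n) (F n) z\<bar> < 1 / real (Suc m)) sequentially"
        using pos by (rule order_tendstoD(2))
    qed
    show "\<exists>(e, f)\<in>rational_trials x m. \<bar>e\<bar> \<le> real K + 1 \<and> (\<Sum>z\<in>?B. (f z)\<^sup>2) \<le> (real K + 1)\<^sup>2 \<and> \<bar>f x\<bar> < 1 / real (Suc m) \<and>
       \<bar>f y - 1\<bar> < 1 / real (Suc m) \<and> (\<forall>z\<in>ball x m. \<bar>residual (pot v) e f z\<bar> < 1 / real (Suc m))"
    proof -
      have xB: "x \<in> ?B" and yB: "y \<in> ?B" using gdist_adj[OF xy, of x] xy by auto
      have "eventually (\<lambda>n. \<bar>rat e n\<bar> < real K + 1 \<and> (\<Sum>z\<in>?B. (F n z)\<^sup>2) < (real K + 1)\<^sup>2 \<and> \<bar>F n x\<bar> < 1 / real (Suc m) \<and>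
         \<bar>F n y - 1\<bar> < 1 / real (Suc m) \<and> (\<forall>z\<in>ball x m. \<bar>residual (pot v) (rat e n) (F n) z\<bar> < 1 / real (Suc m))) sequentially"
        by (intro eventually_conj 1 2 3 4 5 yB)
      then obtain n where n: "\<bar>rat e n\<bar> < real K + 1 \<and> (\<Sum>z\<in>?B. (F n z)\<^sup>2) < (real K + 1)\<^sup>2 \<and> \<bar>F n x\<bar> < 1 / real (Suc m) \<and>
         \<bar>F n y - 1\<bar> < 1 / real (Suc m) \<and> (\<forall>z\<in>ball x m. \<bar>residual (pot v) (rat e n) (F n) z\<bar> < 1 / real (Suc m))"
        by (auto dest: eventually_happens)
      show ?thesis
      proof (rule bexI[of _ "(rat e n, F n)"])
        show "(rat e n, F n) \<in> rational_trials x m"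
          using rat(1) by (auto simp: rational_trials_def F_def)
      qed (use n in auto)
    qed
  qed
  then show ?thesis by blast
qed

end

section \<open>Localization\<close>

context anderson_tree
begin

text \<open>Only the potential at \<open>y\<close> is resampled: for every configuration elsewhere
  the bad values are countable, hence null for the law. \<open>zero_event\<close> supplies the
  measurability that Fubini requires.\<close>

lemma AE_no_zero:
  assumes xy: "G x y"
  shows "AE v in P. \<forall>e f. eigen (pot v) e f \<longrightarrow> f x = 0 \<longrightarrow> f y = 0"
proof -
  have null: "AE v in P. v \<notin> zero_event x y K" for K
  proof -
    note zero_event_measurable [measurable]
    have "(\<integral>\<^sup>+v. indicator (zero_event x y K) v \<partial>P) = (\<integral>\<^sup>+v. (\<integral>\<^sup>+t. indicator (zero_event x y K) (v(y := t)) \<partial>\<nu>) \<partial>P)"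
      by (rule integral_out) measurable
    also have "\<dots> = (\<integral>\<^sup>+v. 0 \<partial>P)"
    proof (intro nn_integral_cong)
      fix v
      let ?C = "{t. \<exists>e f. eigen ((pot v)(y := t)) e f \<and> f x = 0 \<and> f y \<noteq> 0}"
      have "countable ((\<lambda>t. t - shift y) ` ?C)"
        by (intro countable_image countable_zero_section xy)
      then have "AE t in lborel. t \<notin> (\<lambda>t. t - shift y) ` ?C"
        by (intro AE_not_in countable_imp_null_set_lborel)
      then have "AE t in \<nu>. t \<notin> (\<lambda>t. t - shift y) ` ?C" by (rule AE_lborel_law)
      then have "AE t in \<nu>. indicator (zero_event x y K) (v(y := t)) = (0 :: ennreal)"
      proof (rule AE_mp, intro AE_I2 impI)
        fix t assume t: "t \<notin> (\<lambda>t. t - shift y) ` ?C"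
        have "pot (v(y := t)) = (pot v)(y := t + shift y)" by (auto simp: pot_def)
        moreover have "t + shift y \<notin> ?C"
        proof
          assume "t + shift y \<in> ?C"
          then have "(t + shift y) - shift y \<in> (\<lambda>t. t - shift y) ` ?C" by (rule imageI)
          then show False using t by simp
        qed
        ultimately have "v(y := t) \<notin> zero_event x y K"
          using zero_event_sound[of "v(y := t)" x y K] by auto
        then show "indicator (zero_event x y K) (v(y := t)) = (0 :: ennreal)" by simp
      qed
      then have "(\<integral>\<^sup>+t. indicator (zero_event x y K) (v(y := t)) \<partial>\<nu>) = (\<integral>\<^sup>+t. 0 \<partial>\<nu>)"
        by (rule nn_integral_cong_AE)
      then show "(\<integral>\<^sup>+t. indicator (zero_event x y K) (v(y := t)) \<partial>\<nu>) = 0" by simp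
    qed
    finally have "emeasure P (zero_event x y K) = 0" by simp
    then have "zero_event x y K \<in> null_sets P" by (intro null_setsI zero_event_measurable)
    then show ?thesis by (rule AE_not_in)
  qed
  have "AE v in P. \<forall>K. v \<notin> zero_event x y K"
    unfolding AE_all_countable using null by blast
  then show ?thesis
    by (rule AE_mp) (use zero_event_complete[OF xy] in \<open>auto intro!: AE_I2\<close>)
qed

end

text \<open>From here on the potential is fixed, and these two assumptions are all that is kept of
  its randomness.\<close>

locale localized_potential = anderson_tree G Dmax \<nu> b shift
  for G :: "'v \<Rightarrow> 'v \<Rightarrow> bool" and Dmax \<nu> b shift +
  fixes q :: "'v \<Rightarrow> real"
  assumes correlators: "\<And>rt. correlators_bounded rt q"
    and no_zero: "\<And>x y e f. G x y \<Longrightarrow> eigen q e f \<Longrightarrow> f x = 0 \<Longrightarrow> f y = 0"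

context anderson_tree
begin

lemma AE_localized_potential: "AE v in P. localized_potential G Dmax \<nu> b (pot v)"
proof -
  have cnt: "countable (UNIV :: 'v set)" by (rule countable_vertices)
  have 1: "AE v in P. \<forall>rt\<in>UNIV. correlators_bounded rt (pot v)"
    unfolding AE_ball_countable[OF cnt] using AE_correlators_bounded by blast
  have "AE v in P. G x y \<longrightarrow> (\<forall>e f. eigen (pot v) e f \<longrightarrow> f x = 0 \<longrightarrow> f y = 0)" for x y
    using AE_no_zero[of x y] by (cases "G x y") auto
  then have 2: "AE v in P. \<forall>x\<in>UNIV. \<forall>y\<in>UNIV. G x y \<longrightarrow> (\<forall>e f. eigen (pot v) e f \<longrightarrow> f x = 0 \<longrightarrow> f y = 0)"
    unfolding AE_ball_countable[OF cnt] by blast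
  from 1 2 show ?thesis
  proof eventually_elim
    case (elim v)
    show ?case by unfold_locales (use elim in blast)+
  qed
qed

end

section \<open>Domain and symmetry of the operator on the whole tree\<close>

context subexponential_tree
begin

lemma mult_domain_ell2: "f \<in> mult_domain q \<Longrightarrow> f \<in> ell2"
  by (simp add: mult_domain_def)

lemma mult_domain_mult: "f \<in> mult_domain q \<Longrightarrow> (\<lambda>x. complex_of_real (q x) * f x) \<in> ell2"
  by (simp add: mult_domain_def)

lemma hop_ell2: "f \<in> mult_domain q \<Longrightarrow> hop q f \<in> ell2"
  unfolding hop_eq[abs_def]
  by (intro ell2_add adj_sum_bounded mult_domain_ell2 mult_domain_mult)

text \<open>The adjacency part is bounded, so the multiplication part alone decides the domain. This
  is what makes the domain maximal in the sense of \<open>eigen_operator\<close>.\<close>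

lemma mult_domain_if_hop_ell2:
  assumes "f \<in> ell2" "hop q f \<in> ell2"
  shows "f \<in> mult_domain q"
proof -
  have "(\<lambda>x. hop q f x - adj_sum f x) \<in> ell2" using assms by (intro ell2_diff adj_sum_bounded)
  then show ?thesis using assms by (simp add: hop_eq mult_domain_def)
qed

lemma hop_scale: "hop q (\<lambda>x. c * f x) = (\<lambda>x. c * hop q f x)"
  by (simp add: hop_def algebra_simps sum_distrib_left fun_eq_iff)

lemma hop_diff: "hop q (\<lambda>x. f x - g x) = (\<lambda>x. hop q f x - hop q g x)"
  by (simp add: hop_def sum_subtractf algebra_simps fun_eq_iff)

lemma hop_symmetric:
  assumes f: "f \<in> mult_domain q" and g: "g \<in> mult_domain q"
  shows "ell2_inner f (hop q g) = ell2_inner (hop q f) g"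
proof -
  note ell = mult_domain_ell2[OF f] mult_domain_ell2[OF g]
  have "ell2_inner f (hop q g) = ell2_inner f (adj_sum g) + ell2_inner f (\<lambda>x. complex_of_real (q x) * g x)"
    unfolding hop_eq[abs_def] using ell by (intro ell2_inner_add_right adj_sum_bounded mult_domain_mult g)
  also have "ell2_inner f (\<lambda>x. complex_of_real (q x) * g x) = ell2_inner (\<lambda>x. complex_of_real (q x) * f x) g"
    by (simp add: ell2_inner_def mult_ac)
  also have "ell2_inner f (adj_sum g) + \<dots> = ell2_inner (hop q f) g"
    unfolding hop_eq[abs_def] adj_sum_symmetric[OF ell]
    using ell by (intro ell2_inner_add_left[symmetric] adj_sum_bounded mult_domain_mult f)
  finally show ?thesis .
qed

lemma delta_mult_domain: "delta x \<in> mult_domain q"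
  unfolding mult_domain_def by (auto intro!: ell2_finite_support[of "{x}"] simp: delta_def split: if_splits)

lemma hop_delta_inner:
  assumes f: "f \<in> ell2" shows "ell2_inner (hop q (delta x)) f = hop q f x"
proof -
  have "ell2_inner (hop q (delta x)) f = ell2_inner (adj_sum (delta x)) f + ell2_inner (\<lambda>y. complex_of_real (q y) * delta x y) f"
    unfolding hop_eq[abs_def] using f by (intro ell2_inner_add_left adj_sum_bounded mult_domain_mult delta_mult_domain) simp
  also have "ell2_inner (adj_sum (delta x)) f = adj_sum f x"
    using adj_sum_symmetric[OF ell2_delta f] by simp
  also have "(\<lambda>y. complex_of_real (q y) * delta x y) = (\<lambda>y. complex_of_real (q x) * delta x y)"
    by (auto simp: delta_def)
  finally show ?thesis by (simp add: hop_eq[abs_def] ell2_inner_scale_left)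
qed

lemma eigen_mult_domain: "eigen q e f \<Longrightarrow> f \<in> mult_domain q"
  by (intro mult_domain_if_hop_ell2) (auto simp: eigen_def intro: ell2_scale)

lemma eigen_scale: "eigen q e f \<Longrightarrow> eigen q e (\<lambda>x. c * f x)"
  by (auto simp: eigen_def hop_scale intro: ell2_scale)

lemma eigen_diff: "eigen q e f \<Longrightarrow> eigen q e g \<Longrightarrow> eigen q e (\<lambda>x. f x - g x)"
  by (auto simp: eigen_def hop_diff right_diff_distrib intro: ell2_diff)

lemma eigen_orthogonal:
  assumes f: "eigen q e f" and g: "eigen q e' g" and ne: "e \<noteq> e'"
  shows "ell2_inner f g = 0"
proof -
  have "complex_of_real e' * ell2_inner f g = ell2_inner f (hop q g)"
    using g by (simp add: eigen_def ell2_inner_scale_right)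
  also have "\<dots> = ell2_inner (hop q f) g" by (intro hop_symmetric eigen_mult_domain[OF f] eigen_mult_domain[OF g])
  also have "\<dots> = complex_of_real e * ell2_inner f g"
    using f by (simp add: eigen_def ell2_inner_scale_left)
  finally show ?thesis using ne by simp
qed

lemma eigenfunction_eigen:
  assumes "eigenfunction (mult_domain q) (hop q) f"
  shows "\<exists>e. eigen q e f"
proof -
  obtain e :: complex where f: "f \<in> mult_domain q" "f \<noteq> (\<lambda>x. 0)" "hop q f = (\<lambda>x. e * f x)"
    using assms by (auto simp: eigenfunction_def)
  note ell = mult_domain_ell2[OF f(1)]
  have "e * ell2_inner f f = cnj e * ell2_inner f f"
    using hop_symmetric[OF f(1) f(1)] by (simp add: f(3) ell2_inner_scale_right ell2_inner_scale_left)
  moreover have "ell2_norm f \<noteq> 0" using f(2) ell2_norm_eq_0[OF ell] by blast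
  then have "ell2_inner f f \<noteq> 0" by (simp add: ell2_inner_self[OF ell])
  ultimately have "cnj e = e" by simp
  then have "e = complex_of_real (Re e)" by (simp add: complex_eq_iff)
  then have "eigen q (Re e) f" using f(3) ell by (simp add: eigen_def)
  then show ?thesis ..
qed

end

context anderson_tree
begin

lemma localized_eigenvector_eigen:
  assumes "localized_eigenvector rt q e f" shows "eigen q e f"
proof -
  obtain A where A: "\<And>x. cmod (f x) \<le> A * decay ^ d rt x" and h: "hop q f = (\<lambda>x. complex_of_real e * f x)"
    using assms by (auto simp: localized_eigenvector_def)
  have "(\<lambda>x. (cmod (f x))\<^sup>2) summable_on UNIV"
  proof (rule summable_on_comparison_test)
    show "(\<lambda>x. A\<^sup>2 * (decay\<^sup>2) ^ d rt x) summable_on UNIV"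
      using decay_bounds by (intro summable_on_cmult_right summable_exp) (auto simp: power_less_one_iff)
    show "(cmod (f x))\<^sup>2 \<le> A\<^sup>2 * (decay\<^sup>2) ^ d rt x" for x
      using power_mono[OF A[of x] norm_ge_zero, of 2] by (simp add: power_mult_distrib flip: power_mult) (simp add: mult.commute)
  qed simp
  then show ?thesis using h by (simp add: eigen_def ell2_def)
qed

end

section \<open>Simple spectrum and the basis of eigenvectors\<close>

context localized_potential
begin

text \<open>A zero spreads along edges, and the tree is connected.\<close>

lemma eigen_nonvanishing:
  assumes f: "eigen q e f" and 0: "f x = 0" shows "f = (\<lambda>x. 0)"
proof
  fix y
  show "f y = 0" using G_connected[of x y]
    by (induction rule: rtranclp_induct) (use 0 no_zero[OF _ f] in auto)
qed

text \<open>A combination of the two eigenfunctions that vanishes at one vertex vanishes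
  identically.\<close>

lemma eigen_proportional:
  assumes f: "eigen q e f" and g: "eigen q e g" "g \<noteq> (\<lambda>x. 0)"
  shows "\<exists>c. f = (\<lambda>x. c * g x)"
proof -
  have nz: "g r \<noteq> 0" for r using eigen_nonvanishing[OF g(1)] g(2) by blast
  let ?c = "f undefined / g undefined"
  have "eigen q e (\<lambda>x. f x - ?c * g x)" by (intro eigen_diff eigen_scale f g)
  from eigen_nonvanishing[OF this, of undefined] nz
  have eq: "(\<lambda>x. f x - ?c * g x) = (\<lambda>x. 0)" by simp
  have "f = (\<lambda>x. ?c * g x)"
  proof
    fix x show "f x = ?c * g x" using fun_cong[OF eq, of x] by (simp only: right_minus_eq)
  qed
  then show ?thesis by (rule exI)
qed

definition eigenvalues :: "real set" where
  "eigenvalues = {e. \<exists>f. eigen q e f \<and> f \<noteq> (\<lambda>x. 0)}"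

text \<open>Since eigenvalues are simple, one vector for each is enough, and the basis can be
  indexed by the eigenvalues themselves as \<open>eigen_operator\<close> expects.\<close>

definition unit_eigenvector :: "real \<Rightarrow> 'v \<Rightarrow> complex" where
  "unit_eigenvector e = (if e \<in> eigenvalues then SOME f. eigen q e f \<and> ell2_norm f = 1 else (\<lambda>x. 0))"

lemma unit_eigenvector:
  assumes "e \<in> eigenvalues"
  shows "eigen q e (unit_eigenvector e)" "ell2_norm (unit_eigenvector e) = 1"
proof -
  obtain f where f: "eigen q e f" "f \<noteq> (\<lambda>x. 0)" using assms by (auto simp: eigenvalues_def)
  have nz: "ell2_norm f \<noteq> 0" using f ell2_norm_eq_0[of f] by (auto simp: eigen_def)
  have "eigen q e (\<lambda>x. complex_of_real (1 / ell2_norm f) * f x) \<and> ell2_norm (\<lambda>x. complex_of_real (1 / ell2_norm f) * f x) = 1"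
    by (intro conjI eigen_scale f(1)) (use nz in \<open>simp only: ell2_norm_scale norm_of_real, simp\<close>)
  then have "\<exists>f. eigen q e f \<and> ell2_norm f = 1" by (rule exI[where P = "\<lambda>f. eigen q e f \<and> ell2_norm f = 1"])
  from someI_ex[OF this] assms show "eigen q e (unit_eigenvector e)" "ell2_norm (unit_eigenvector e) = 1"
    by (auto simp: unit_eigenvector_def)
qed

lemma unit_eigenvector_nonzero: "e \<in> eigenvalues \<Longrightarrow> unit_eigenvector e \<noteq> (\<lambda>x. 0)"
  using unit_eigenvector(2)[of e] by (auto simp: ell2_norm_def)

lemma eigen_unit: "eigen q e f \<Longrightarrow> \<exists>c. f = (\<lambda>x. c * unit_eigenvector e x)"
proof (cases "e \<in> eigenvalues")
  case True
  assume f: "eigen q e f"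
  show ?thesis by (rule eigen_proportional[OF f unit_eigenvector(1)[OF True] unit_eigenvector_nonzero[OF True]])
next
  case False
  assume "eigen q e f"
  then have "f = (\<lambda>x. 0)" using False by (auto simp: eigenvalues_def)
  then show ?thesis by (intro exI[of _ 0]) simp
qed

sublocale eigenbasis: orthonormal_family unit_eigenvector eigenvalues
proof
  show "unit_eigenvector e \<in> ell2" for e
    by (cases "e \<in> eigenvalues") (use unit_eigenvector(1)[of e] in \<open>auto simp: eigen_def, simp add: unit_eigenvector_def\<close>)
  show "ell2_inner (unit_eigenvector e) (unit_eigenvector e') = (if e = e' then 1 else 0)"
    if "e \<in> eigenvalues" "e' \<in> eigenvalues" for e e'
    using eigen_orthogonal[OF unit_eigenvector(1)[OF that(1)] unit_eigenvector(1)[OF that(2)]] unit_eigenvector[OF that(1)]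
    by (auto simp: ell2_inner_self eigen_def)
qed (simp add: unit_eigenvector_def)

lemma unit_eigenvectors_total:
  assumes "\<epsilon> > 0"
  shows "\<exists>F c. finite F \<and> ell2_norm (\<lambda>y. delta x y - (\<Sum>e\<in>F. c e * unit_eigenvector e y)) \<le> \<epsilon>"
proof -
  obtain N \<psi> \<kappa> where \<psi>: "\<And>i. localized_eigenvector x q (\<kappa> i) (\<psi> i)"
    and le: "ell2_norm (\<lambda>y. delta x y - (\<Sum>i<N::nat. \<psi> i y)) \<le> \<epsilon>"
    using localized_approximation[OF correlators assms] by blast
  have "\<exists>c. \<psi> i = (\<lambda>y. c * unit_eigenvector (\<kappa> i) y)" for i
    by (intro eigen_unit localized_eigenvector_eigen[OF \<psi>])
  then obtain c where c: "\<And>i. \<psi> i = (\<lambda>y. c i * unit_eigenvector (\<kappa> i) y)" by metis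
  \<comment> \<open>Several of the limit vectors may belong to the same eigenvalue, so their
    coefficients are collected.\<close>
  have "(\<Sum>i<N. \<psi> i y) = (\<Sum>e\<in>\<kappa> ` {..<N}. (\<Sum>i | i \<in> {..<N} \<and> \<kappa> i = e. c i) * unit_eigenvector e y)" for y
  proof -
    have "(\<Sum>i<N. \<psi> i y) = (\<Sum>e\<in>\<kappa> ` {..<N}. \<Sum>i | i \<in> {..<N} \<and> \<kappa> i = e. \<psi> i y)"
      by (rule sum.image_gen) simp
    also have "\<dots> = (\<Sum>e\<in>\<kappa> ` {..<N}. (\<Sum>i | i \<in> {..<N} \<and> \<kappa> i = e. c i) * unit_eigenvector e y)"
      unfolding sum_distrib_right by (intro sum.cong refl) (auto simp: c)
    finally show ?thesis .
  qed
  then show ?thesis using le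
    by (intro exI[of _ "\<kappa> ` {..<N}"] exI[of _ "\<lambda>e. \<Sum>i | i \<in> {..<N} \<and> \<kappa> i = e. c i"]) simp
qed

sublocale eigenbasis: eigen_operator unit_eigenvector eigenvalues "mult_domain q" "hop q"
proof
  show "\<exists>F c. finite F \<and> ell2_norm (\<lambda>y. delta x y - (\<Sum>e\<in>F. c e * unit_eigenvector e y)) \<le> \<epsilon>" if "\<epsilon> > 0" for x \<epsilon>
    using that by (rule unit_eigenvectors_total)
  show "(\<lambda>x. f x - g x) \<in> mult_domain q" if "f \<in> mult_domain q" "g \<in> mult_domain q" for f g
    using that by (auto simp: mult_domain_def right_diff_distrib intro: ell2_diff)
  show "f \<in> mult_domain q" if "f \<in> ell2" "g \<in> ell2" "\<And>x. ell2_inner (hop q (delta x)) f = g x" for f g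
  proof -
    have "hop q f = g" using that by (simp add: hop_delta_inner fun_eq_iff)
    then show ?thesis using that by (intro mult_domain_if_hop_ell2) auto
  qed
  show "countable eigenvalues"
    by (rule countable_orthogonal_index[where h = unit_eigenvector])
      (simp_all add: eigenbasis.orthonormal unit_eigenvector_nonzero)
  show "hop q (unit_eigenvector e) = (\<lambda>x. complex_of_real e * unit_eigenvector e x)" if "e \<in> eigenvalues" for e
    using unit_eigenvector(1)[OF that] by (simp add: eigen_def)
qed (auto intro: mult_domain_ell2 hop_ell2 hop_symmetric delta_mult_domain eigen_mult_domain unit_eigenvector simp: hop_diff)

text \<open>Vectors localized at \<open>r\<close> approximate \<open>delta r\<close>, and
  \<open>f r\<close> is nonzero, so one of them is not orthogonal to \<open>f\<close>. It then
  belongs to the same eigenvalue, and simplicity makes \<open>f\<close> a multiple of it.\<close>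

lemma eigenfunction_decays:
  assumes "eigenfunction (mult_domain q) (hop q) f"
  shows "decays_exponentially G r f"
proof -
  obtain e where f: "eigen q e f" using eigenfunction_eigen[OF assms] by blast
  then have ell: "f \<in> ell2" by (simp add: eigen_def)
  have "f \<noteq> (\<lambda>x. 0)" using assms by (simp add: eigenfunction_def)
  then have fr: "f r \<noteq> 0" using eigen_nonvanishing[OF f] by blast
  have "\<exists>\<kappa> \<psi>. localized_eigenvector r q \<kappa> \<psi> \<and> ell2_inner \<psi> f \<noteq> 0"
  proof (rule ccontr)
    assume "\<not> ?thesis"
    then have orth: "ell2_inner \<psi> f = 0" if "localized_eigenvector r q \<kappa> \<psi>" for \<kappa> \<psi> using that by blast
    have "f r = 0"
    proof (rule eq_0_if_le_epsilon)
      fix \<epsilon> :: real assume \<epsilon>: "\<epsilon> > 0"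
      obtain N \<psi> \<kappa> where \<psi>: "\<And>i. localized_eigenvector r q (\<kappa> i) (\<psi> i)"
        and le: "ell2_norm (\<lambda>y. delta r y - (\<Sum>i<N::nat. \<psi> i y)) \<le> \<epsilon>"
        using localized_approximation[OF correlators \<epsilon>] by blast
      have \<psi>_ell: "\<psi> i \<in> ell2" for i using localized_eigenvector_eigen[OF \<psi>[of i]] by (simp add: eigen_def)
      have s: "(\<lambda>y. \<Sum>i<N. \<psi> i y) \<in> ell2" by (intro ell2_sum \<psi>_ell)
      have "ell2_inner (\<lambda>y. \<Sum>i<N. \<psi> i y) f = 0"
        using orth[OF \<psi>] by (simp add: ell2_inner_sum_left[OF ell \<psi>_ell])
      then have "ell2_inner (\<lambda>y. delta r y - (\<Sum>i<N. \<psi> i y)) f = f r"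
        by (simp add: ell2_inner_diff_left[OF ell2_delta s ell])
      then have "cmod (f r) \<le> ell2_norm (\<lambda>y. delta r y - (\<Sum>i<N. \<psi> i y)) * ell2_norm f"
        using ell2_Cauchy_Schwarz[OF ell2_diff[OF ell2_delta s] ell] by metis
      also have "\<dots> \<le> \<epsilon> * ell2_norm f" using le by (intro mult_right_mono) auto
      finally show "cmod (f r) \<le> \<epsilon> * ell2_norm f" .
    qed
    then show False using fr by simp
  qed
  then obtain \<kappa> \<psi> where \<psi>: "localized_eigenvector r q \<kappa> \<psi>" "ell2_inner \<psi> f \<noteq> 0" by blast
  note \<psi>' = localized_eigenvector_eigen[OF \<psi>(1)]
  have "\<kappa> = e" using eigen_orthogonal[OF \<psi>' f] \<psi>(2) by blast
  moreover have "\<psi> \<noteq> (\<lambda>x. 0)" using \<psi>(2) by auto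
  ultimately obtain c where c: "f = (\<lambda>x. c * \<psi> x)" using eigen_proportional[OF f, of \<psi>] \<psi>' by blast
  obtain A where A: "\<And>x. cmod (\<psi> x) \<le> A * decay ^ d r x" using \<psi>(1) by (auto simp: localized_eigenvector_def)
  have "cmod (f x) \<le> (cmod c * \<bar>A\<bar> + 1) * exp (- (- ln decay) * real (d x r))" for x
  proof -
    have "decay ^ d r x = exp (- (- ln decay) * real (d x r))"
      using decay_bounds by (simp add: gdist_sym[of x r] powr_realpow[symmetric] powr_def mult.commute)
    moreover have "cmod (f x) \<le> (cmod c * \<bar>A\<bar> + 1) * decay ^ d r x"
    proof -
      have "cmod (f x) \<le> cmod c * (A * decay ^ d r x)" unfolding c norm_mult using A by (intro mult_left_mono) auto
      also have "\<dots> = cmod c * A * decay ^ d r x" by simp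
      also have "\<dots> \<le> (cmod c * \<bar>A\<bar> + 1) * decay ^ d r x"
      proof (rule mult_right_mono)
        show "cmod c * A \<le> cmod c * \<bar>A\<bar> + 1" using mult_left_mono[OF abs_ge_self[of A] norm_ge_zero[of c]] by linarith
      qed (use decay_bounds in simp)
      finally show ?thesis .
    qed
    ultimately show ?thesis by simp
  qed
  moreover have "cmod c * \<bar>A\<bar> + 1 > 0" "- ln decay > 0" using decay_bounds by (auto intro: add_nonneg_pos)
  ultimately show ?thesis unfolding decays_exponentially_def by blast
qed

end

section \<open>From the hypotheses of the theorem to the model\<close>

lemma bounded_law_scaled:
  assumes [measurable]: "\<rho> \<in> borel_measurable borel" and le: "AE \<xi> in lborel. \<rho> \<xi> \<le> B"
    and B: "B > 0" and l: "l > 0" and prob: "prob_space (density lborel (\<lambda>\<xi>. ennreal (\<rho> \<xi>)))"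
  shows "bounded_law (distr (density lborel (\<lambda>\<xi>. ennreal (\<rho> \<xi>))) borel (\<lambda>\<xi>. l * \<xi>)) (B / l)"
proof -
  let ?D = "density lborel (\<lambda>\<xi>. ennreal (\<rho> \<xi>))"
  interpret D: prob_space ?D by (rule prob)
  interpret N: prob_space "distr ?D borel (\<lambda>\<xi>. l * \<xi>)" by (rule D.prob_space_distr) simp
  show ?thesis
  proof
    fix f :: "real \<Rightarrow> ennreal" assume [measurable]: "f \<in> borel_measurable borel"
    have "(\<integral>\<^sup>+t. f t \<partial>distr ?D borel (\<lambda>\<xi>. l * \<xi>)) = (\<integral>\<^sup>+\<xi>. ennreal (\<rho> \<xi>) * f (l * \<xi>) \<partial>lborel)"
      by (simp add: nn_integral_distr nn_integral_density)
    also have "\<dots> \<le> (\<integral>\<^sup>+\<xi>. ennreal B * f (l * \<xi>) \<partial>lborel)"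
      using le by (intro nn_integral_mono_AE) (auto elim!: eventually_mono intro!: mult_right_mono ennreal_leI)
    also have "\<dots> = ennreal (B / l) * (ennreal l * (\<integral>\<^sup>+\<xi>. f (l * \<xi>) \<partial>lborel))"
      using B l by (simp add: nn_integral_cmult flip: mult.assoc ennreal_mult)
    also have "ennreal l * (\<integral>\<^sup>+\<xi>. f (l * \<xi>) \<partial>lborel) = (\<integral>\<^sup>+t. f t \<partial>lborel)"
      using nn_integral_real_affine[of f l 0] l by simp
    finally show "(\<integral>\<^sup>+t. f t \<partial>distr ?D borel (\<lambda>\<xi>. l * \<xi>)) \<le> ennreal (B / l) * (\<integral>\<^sup>+t. f t \<partial>lborel)" .
  qed (use B l in auto)
qed

text \<open>The diagonal term is bounded and the coupling is nonzero, so neither changes the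
  domain.\<close>

lemma mult_domain_affine:
  fixes v s :: "'v \<Rightarrow> real"
  assumes l: "l > 0" and s: "\<And>x. \<bar>s x\<bar> \<le> C"
  shows "mult_domain (\<lambda>x. l * v x + s x) = mult_domain v"
proof -
  have s_ell: "(\<lambda>x. complex_of_real (s x) * f x) \<in> ell2" if "f \<in> ell2" for f
  proof (rule ell2_mono[OF ell2_scale[OF that, of "complex_of_real C"]])
    show "cmod (complex_of_real (s x) * f x) \<le> cmod (complex_of_real C * f x)" for x
      using s[of x] by (simp add: norm_mult mult_right_mono)
  qed
  have "(\<lambda>x. complex_of_real (l * v x + s x) * f x) \<in> ell2 \<longleftrightarrow> (\<lambda>x. complex_of_real (v x) * f x) \<in> ell2"
    if f: "f \<in> ell2" for f
  proof
    assume "(\<lambda>x. complex_of_real (l * v x + s x) * f x) \<in> ell2"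
    then have "(\<lambda>x. complex_of_real (1 / l) * (complex_of_real (l * v x + s x) * f x - complex_of_real (s x) * f x)) \<in> ell2"
      by (intro ell2_scale ell2_diff s_ell f)
    then show "(\<lambda>x. complex_of_real (v x) * f x) \<in> ell2" using l by (simp add: field_simps)
  next
    assume "(\<lambda>x. complex_of_real (v x) * f x) \<in> ell2"
    then have "(\<lambda>x. complex_of_real l * (complex_of_real (v x) * f x) + complex_of_real (s x) * f x) \<in> ell2"
      by (intro ell2_add ell2_scale s_ell f)
    then show "(\<lambda>x. complex_of_real (l * v x + s x) * f x) \<in> ell2" by (simp add: algebra_simps)
  qed
  then show ?thesis by (auto simp: mult_domain_def)
qed

lemma bounded_if_esssup_finite:
  assumes "esssup lborel (\<lambda>\<xi>. ereal \<bar>\<rho> \<xi>\<bar>) < \<infinity>"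
  shows "\<exists>B>0. AE \<xi> in lborel. \<rho> \<xi> \<le> B"
proof -
  obtain B where B: "esssup lborel (\<lambda>\<xi>. ereal \<bar>\<rho> \<xi>\<bar>) < ereal B"
    using ereal_dense2[OF assms] by blast
  have "AE \<xi> in lborel. ereal \<bar>\<rho> \<xi>\<bar> \<le> esssup lborel (\<lambda>\<xi>. ereal \<bar>\<rho> \<xi>\<bar>)" by (rule esssup_AE)
  then have "AE \<xi> in lborel. \<rho> \<xi> \<le> max B 1"
  proof eventually_elim
    case (elim \<xi>)
    then have "ereal \<bar>\<rho> \<xi>\<bar> < ereal B" using B by (rule le_less_trans)
    then show ?case by simp
  qed
  then show ?thesis by (intro exI[of _ "max B 1"]) simp
qed

text \<open>The joint law of independent variables is the product of their laws, so a null set of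
  configurations pulls back to a null set of the original space.\<close>

lemma (in prob_space) AE_iid:
  fixes X :: "'i \<Rightarrow> 'a \<Rightarrow> real"
  assumes "indep_vars (\<lambda>_. borel) X UNIV" and law: "\<And>i. distr M borel (X i) = \<nu>"
    and AE: "AE v in PiM UNIV (\<lambda>_. \<nu>). Q v"
  shows "AE \<omega> in M. Q (\<lambda>i. X i \<omega>)"
proof -
  have [measurable]: "X i \<in> borel_measurable M" for i using assms(1) by (simp add: indep_vars_def)
  have "distr M (PiM UNIV (\<lambda>_. borel)) (\<lambda>\<omega>. \<lambda>i\<in>UNIV. X i \<omega>) = PiM UNIV (\<lambda>_. \<nu>)"
    using indep_vars_iff_distr_eq_PiM[of UNIV X "\<lambda>_. borel"] assms(1) by (simp add: law)
  then have "AE v in distr M (PiM UNIV (\<lambda>_. borel)) (\<lambda>\<omega>. \<lambda>i\<in>UNIV. X i \<omega>). Q v" using AE by (simp only:)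
  then have "AE \<omega> in M. Q (\<lambda>i\<in>UNIV. X i \<omega>)" by (rule AE_distrD[rotated]) measurable
  then show ?thesis by (simp add: restrict_def)
qed

theorem theorem1p2:
  fixes k :: nat and \<gamma> \<eta> :: real
    and G :: "'v \<Rightarrow> 'v \<Rightarrow> bool" and r :: 'v
    and M :: "'w measure" and V :: "'v \<Rightarrow> 'w \<Rightarrow> real"
    and \<rho> :: "real \<Rightarrow> real"
  assumes "k \<ge> 2" and "\<gamma> > 1"
    and "is_Gamma k \<gamma> G r"
    and "prob_space M"
    and "prob_space.indep_vars M (\<lambda>_. borel) V UNIV"
    and "\<rho> \<in> borel_measurable borel" and "\<And>\<xi>. \<rho> \<xi> \<ge> 0"
    and "\<And>x. distributed M lborel (V x) (\<lambda>\<xi>. ennreal (\<rho> \<xi>))"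
    and "esssup lborel (\<lambda>\<xi>. ereal \<bar>\<rho> \<xi>\<bar>) < \<infinity>"
    and "\<eta> > 0" and "(\<integral>\<^sup>+ \<xi>. ennreal (\<bar>\<xi>\<bar> powr \<eta> * \<rho> \<xi>) \<partial>lborel) < \<infinity>"
  shows "\<forall>\<Delta> \<in> {adjacency_laplacian G, graph_laplacian G}. \<forall>l>0. AE \<omega> in M.
      only_pure_point_spectrum (mult_domain (\<lambda>x. V x \<omega>)) (anderson \<Delta> l (\<lambda>x. V x \<omega>)) \<and>
      (\<forall>f. eigenfunction (mult_domain (\<lambda>x. V x \<omega>)) (anderson \<Delta> l (\<lambda>x. V x \<omega>)) f \<longrightarrow>
           decays_exponentially G r f)"
proof (intro ballI allI impI)
  fix \<Delta> and l :: real
  assume \<Delta>: "\<Delta> \<in> {adjacency_laplacian G, graph_laplacian G}" and l: "l > 0"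
  interpret M: prob_space M by fact
  interpret subexponential_tree G "k + 1"
    by (rule Gamma_subexponential_tree) fact+
  \<comment> \<open>Both Laplacians are the adjacency operator plus a bounded diagonal term.\<close>
  define shift where "shift x = (if \<Delta> = adjacency_laplacian G then 0 else - real (card (neighbors G x)))" for x
  have \<Delta>_eq: "\<Delta> f x = (\<Sum>y | G x y. f y) + complex_of_real (shift x) * f x" for f x
    using \<Delta> by (auto simp: shift_def adjacency_laplacian_def graph_laplacian_def neighbors_eq)
  have shift: "\<bar>shift x\<bar> \<le> real (k + 1)" for x
    using card_adj[of x] by (auto simp: shift_def neighbors_eq)
  obtain B where B: "B > 0" "AE \<xi> in lborel. \<rho> \<xi> \<le> B"
    using bounded_if_esssup_finite assms(9) by blast
  let ?D = "density lborel (\<lambda>\<xi>. ennreal (\<rho> \<xi>))"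
  \<comment> \<open>The law of the potential multiplied by the coupling; its density is bounded by
    \<open>B / l\<close>.\<close>
  define \<nu> where "\<nu> = distr ?D borel (\<lambda>\<xi>. l * \<xi>)"
  have V [measurable]: "V x \<in> borel_measurable M" for x using assms(8)[of x] by (simp add: distributed_def)
  have D: "distr M lborel (V x) = ?D" for x using assms(8)[of x] by (simp add: distributed_def)
  have prob: "prob_space ?D" unfolding D[symmetric, of r] by (rule M.prob_space_distr) simp
  interpret bounded_law \<nu> "B / l"
    unfolding \<nu>_def by (rule bounded_law_scaled[OF assms(6) B(2,1) l prob])
  interpret anderson_tree G "k + 1" \<nu> "B / l" shift ..
  have law: "distr M borel (\<lambda>\<omega>. l * V x \<omega>) = \<nu>" for x
    unfolding \<nu>_def D[symmetric, of x] by (subst distr_distr) (auto simp: comp_def)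
  have "M.indep_vars (\<lambda>_. borel) (\<lambda>x \<omega>. l * V x \<omega>) UNIV"
    by (rule M.indep_vars_compose2[OF assms(5)]) simp
  from M.AE_iid[OF this law AE_localized_potential[unfolded P_def]]
  show "AE \<omega> in M. only_pure_point_spectrum (mult_domain (\<lambda>x. V x \<omega>)) (anderson \<Delta> l (\<lambda>x. V x \<omega>)) \<and>
      (\<forall>f. eigenfunction (mult_domain (\<lambda>x. V x \<omega>)) (anderson \<Delta> l (\<lambda>x. V x \<omega>)) f \<longrightarrow> decays_exponentially G r f)"
  proof eventually_elim
    case (elim \<omega>)
    let ?q = "pot (\<lambda>x. l * V x \<omega>)"
    interpret localized_potential G "k + 1" \<nu> "B / l" shift ?q by fact
    have "mult_domain (\<lambda>x. V x \<omega>) = mult_domain ?q"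
      unfolding pot_def by (rule mult_domain_affine[OF l shift, symmetric])
    moreover have "anderson \<Delta> l (\<lambda>x. V x \<omega>) = hop ?q"
      by (intro ext) (simp add: anderson_def \<Delta>_eq hop_def pot_def algebra_simps)
    ultimately show ?case
      using eigenbasis.only_pure_point_spectrum eigenfunction_decays by simp
  qed
qed

end
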